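(* Let $m\in\{1,\dots,11\}$ and let $a,b\in\mathbb{Z}$ be such that $F(x)=x^{12}+ax^m+b$ is irreducible over $\mathbb{Q}$. Let $K=\mathbb{Q}(\alpha)$ where $\alpha$ is a root of $F(x)$. Then: (1) If $(a,b)\equiv(0,3)\pmod 8$ or $(a,b)\equiv(0,7)\pmod 8$, then $2$ divides $i(K)$. (2) If $(a,b)\equiv(0,1)\pmod 9$ or $(a,b)\equiv(0,-1)\pmod 9$, then $3$ divides $i(K)$. In particular, if one of these conditions holds, then $K$ is not monogenic.
   Context: Standing assumption: for every rational prime $p$, $\nu_p(a)<12-m$ or $\nu_p(b)<12$, where $\nu_p$ is the $p$-adic valuation. For a number field $K$ with ring of integers $\mathbb{Z}_K$, the index $i(K)$ is the greatest common divisor of the indices $(\mathbb{Z}_K:\mathbb{Z}[\theta])$ over all $\theta\in\mathbb{Z}_K$ generating $K$. $K$ is monogenic if $\mathbb{Z}_K=\mathbb{Z}[\theta]$ for some $\theta\in\mathbb{Z}_K$. A congruence $(a,b)\equiv(c,d)\pmod n$ means $a\equiv c$ and $b\equiv d \pmod n$. *)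

theory Defs
  imports
    "HOL-Library.Extended_Nat"
    "HOL-Computational_Algebra.Computational_Algebra"
    "HOL-Number_Theory.Cong"
begin

(* multiplicity p 0 = 0 in the library, whereas the p-adic valuation of 0 is infinite. *)
definition padic_val :: "nat \<Rightarrow> int \<Rightarrow> enat" where
  "padic_val p x = (if x = 0 then \<infinity> else enat (multiplicity (int p) x))"

definition is_subfield :: "'a::field set \<Rightarrow> bool" where
  "is_subfield S \<longleftrightarrow> 0 \<in> S \<and> 1 \<in> S \<and>
     (\<forall>x\<in>S. \<forall>y\<in>S. x + y \<in> S \<and> x * y \<in> S) \<and>
     (\<forall>x\<in>S. - x \<in> S \<and> inverse x \<in> S)"

(* The field Q(x): in characteristic 0 every subfield contains Q. *)
definition rat_adjoin :: "'a::field_char_0 \<Rightarrow> 'a set" where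
  "rat_adjoin x = \<Inter>{S. is_subfield S \<and> x \<in> S}"

(* The ring Z[x]. *)
definition int_adjoin :: "'a::field_char_0 \<Rightarrow> 'a set" where
  "int_adjoin x = range (\<lambda>p :: int poly. poly (map_poly of_int p) x)"

definition ring_of_integers :: "'a::field_char_0 set \<Rightarrow> 'a set" where
  "ring_of_integers K = {x \<in> K. algebraic_int x}"

(* The index (G : H) of additive groups H \<subseteq> G, as the number of cosets x + H with x in G.
   It would be 0 for infinite index, but (Z_K : Z[\<theta>]) is finite
   for every integral generator \<theta> of a number field K. *)
definition add_index :: "'a::ab_group_add set \<Rightarrow> 'a set \<Rightarrow> nat" where
  "add_index G H = card ((\<lambda>x. (\<lambda>h. x + h) ` H) ` G)"

definition field_index :: "'a::field_char_0 set \<Rightarrow> nat" where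
  "field_index K =
     Gcd {add_index (ring_of_integers K) (int_adjoin \<theta>) |\<theta>.
            \<theta> \<in> ring_of_integers K \<and> rat_adjoin \<theta> = K}"

definition monogenic :: "'a::field_char_0 set \<Rightarrow> bool" where
  "monogenic K \<longleftrightarrow> (\<exists>\<theta>\<in>ring_of_integers K. ring_of_integers K = int_adjoin \<theta>)"

end

theory Submission
  imports Defs "HOL-Computational_Algebra.Field_as_Ring"
begin

text \<open>
  If \<open>p\<close> does not divide the index of \<open>\<int>[\<theta>]\<close> in the ring of integers \<open>O\<close>, then \<open>O = \<int>[\<theta>] + p O\<close>.
  Embed \<open>K\<close> into \<open>\<complex>\<close> through the twelve roots \<open>\<beta>\<close> of \<open>F\<close> and fix a valuation ring of \<open>\<complex>\<close> in which \<open>p\<close>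
  is not a unit. The residue of the conjugate \<open>\<theta>\<^sub>\<beta>\<close> then determines the residues at \<open>\<beta>\<close> of all integral
  elements, and Frobenius permutes the residues of the \<open>\<theta>\<^sub>\<beta>\<close>. Hence a root \<open>\<beta>\<close> at which some integral
  elements with residues in the field of \<open>q\<close> elements take values shared by no other root has the residue of
  \<open>\<theta>\<^sub>\<beta>\<close> in that field; the same holds for a pair of roots not separated by such elements if the pair is
  ramified. It remains to exhibit more such classes than there are available residues.

  Modulo 2 the separating elements are \<open>\<alpha>\<close>, \<open>t = (\<alpha>\<^sup>6 + 1)/2\<close> and \<open>t (\<alpha>\<^sup>3 + 1)/2\<close>, and there are at least
  five classes over the field of 4 elements. Modulo 3 they are \<open>\<alpha>\<close> and \<open>(\<alpha>\<^sup>4 \<mp> 1)\<^sup>2/3\<close>, with four classes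
  over the field of 3 elements if \<open>b \<equiv> -1\<close>, and eight classes over the field of 9 elements that do not
  reduce to the prime field if \<open>b \<equiv> 1\<close>. The position of the roots is read off from Newton polygons.
\<close>

section \<open>Valuation rings\<close>

text \<open>The prime ideals above \<open>p\<close> never appear as such: they are visible as
  Frobenius orbits of residues at the complex roots. The obstacle is a class of two roots that no
  available element separates. It may belong to a ramified prime, or to an unramified prime of twice
  the degree whose two residues Frobenius interchanges. Only the first keeps the residue of the
  generator in the small field, hence the search for an integral \<open>r\<close> with
  \<open>p\<close> dividing \<open>r^2\<close> but not \<open>r\<close>. The separating elements
  come from \<open>\<alpha>^12\<close> being congruent to \<open>-b\<close> modulo 8 or 9. For 2,
  \<open>t^2 - t = (\<alpha>^12 - 1)/4\<close>, and \<open>u = t (\<alpha>^3 + 1)/2\<close>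
  satisfies \<open>u^2 - t u = t (\<alpha>^12 - 1)/8\<close>. For 3, let \<open>\<epsilon>\<close>
  be \<open>-b\<close> modulo 9; then \<open>x = \<alpha>^4 - \<epsilon>\<close> satisfies
  \<open>x^3 + 3 \<epsilon> x^2 + 3 x = 0\<close> modulo 9. The Newton polygon allows valuations at
  least 1 (once) and 1/2 (twice), so \<open>x^2/3\<close> is integral, with residue 0 or -1.\<close>

locale subring =
  fixes V :: "'a::field set"
  assumes one_closed: "1 \<in> V"
    and diff_closed: "x \<in> V \<Longrightarrow> y \<in> V \<Longrightarrow> x - y \<in> V"
    and mult_closed: "x \<in> V \<Longrightarrow> y \<in> V \<Longrightarrow> x * y \<in> V"
begin

lemma zero_closed: "0 \<in> V"
  using diff_closed[OF one_closed one_closed] by simp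

lemma uminus_closed: "x \<in> V \<Longrightarrow> - x \<in> V"
  using diff_closed[OF zero_closed] by simp

lemma add_closed: "x \<in> V \<Longrightarrow> y \<in> V \<Longrightarrow> x + y \<in> V"
  using diff_closed[OF _ uminus_closed] by fastforce

lemma power_closed: "x \<in> V \<Longrightarrow> x ^ n \<in> V"
  by (induction n) (auto intro: one_closed mult_closed)

lemma of_nat_closed: "of_nat n \<in> V"
  by (induction n) (auto intro: zero_closed one_closed add_closed)

lemma of_int_closed: "of_int n \<in> V"
  by (cases n) (auto intro: of_nat_closed uminus_closed simp del: of_nat_Suc)

lemma numeral_closed: "numeral n \<in> V"
  using of_nat_closed[of "numeral n"] by simp

lemma sum_closed: "(\<And>i. i \<in> I \<Longrightarrow> f i \<in> V) \<Longrightarrow> (\<Sum>i\<in>I. f i) \<in> V"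
  by (induction I rule: infinite_finite_induct) (auto intro: zero_closed add_closed)

lemma coeff_mult_closed:
  "(\<And>i. coeff f i \<in> V) \<Longrightarrow> (\<And>i. coeff g i \<in> V) \<Longrightarrow> coeff (f * g) i \<in> V"
  by (auto simp: coeff_mult intro!: sum_closed mult_closed)

lemma coeff_prod_closed:
  "(\<And>i j. i \<in> I \<Longrightarrow> coeff (f i) j \<in> V) \<Longrightarrow> coeff (\<Prod>i\<in>I. f i) j \<in> V"
  by (induction I arbitrary: j rule: infinite_finite_induct)
     (auto intro: zero_closed one_closed coeff_mult_closed simp: coeff_1)

lemma poly_closed: "(\<And>i. coeff f i \<in> V) \<Longrightarrow> x \<in> V \<Longrightarrow> poly f x \<in> V"
  by (auto simp: poly_altdef intro!: sum_closed mult_closed power_closed)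

lemma poly_of_int_closed: "x \<in> V \<Longrightarrow> poly (map_poly of_int f) x \<in> V"
  by (rule poly_closed) (auto simp: coeff_map_poly of_int_closed)

lemmas closed = zero_closed one_closed diff_closed mult_closed uminus_closed add_closed
  power_closed of_nat_closed of_int_closed numeral_closed

lemma subring_adjoin: "subring {poly f x | f. \<forall>i. coeff f i \<in> V}" (is "subring ?S")
proof
  show "1 \<in> ?S"
    by (auto intro!: exI[of _ 1] simp: coeff_1 closed)
next
  fix y z assume "y \<in> ?S" "z \<in> ?S"
  then obtain f g where "y = poly f x" "\<forall>i. coeff f i \<in> V" "z = poly g x" "\<forall>i. coeff g i \<in> V"
    by auto
  then have "y - z = poly (f - g) x \<and> (\<forall>i. coeff (f - g) i \<in> V)"
    and "y * z = poly (f * g) x \<and> (\<forall>i. coeff (f * g) i \<in> V)"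
    by (auto intro: closed coeff_mult_closed)
  then show "y - z \<in> ?S" "y * z \<in> ?S"
    by blast+
qed

lemma subring_localize: "subring {c / u ^ n | c n. c \<in> V}" (is "subring ?S")
  if "u \<in> V" "u \<noteq> 0"
proof
  show "1 \<in> ?S"
    by (auto intro!: exI[of _ 1] exI[of _ "0::nat"] simp: closed)
next
  fix y z assume "y \<in> ?S" "z \<in> ?S"
  then obtain c d n k where *: "y = c / u ^ n" "z = d / u ^ k" "c \<in> V" "d \<in> V"
    by auto
  then have "y - z = (c * u ^ k - d * u ^ n) / u ^ (n + k)" "y * z = (c * d) / u ^ (n + k)"
    using that by (auto simp: field_simps power_add)
  moreover have "c * u ^ k - d * u ^ n \<in> V" "c * d \<in> V"
    using * that by (auto intro: closed)
  ultimately show "y - z \<in> ?S" "y * z \<in> ?S"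
    by blast+
qed

end

locale valuation_ring = subring +
  assumes inverse_closed: "x \<notin> V \<Longrightarrow> inverse x \<in> V"

lemma subring_Union_chain:
  assumes "C \<noteq> {}" "\<And>B. B \<in> C \<Longrightarrow> subring B" "\<And>A B. A \<in> C \<Longrightarrow> B \<in> C \<Longrightarrow> A \<subseteq> B \<or> B \<subseteq> A"
  shows "subring (\<Union>C)"
proof
  show "1 \<in> \<Union>C"
    using assms(1,2) subring.one_closed by fastforce
next
  fix x y assume "x \<in> \<Union>C" "y \<in> \<Union>C"
  then obtain B where "B \<in> C" "x \<in> B" "y \<in> B"
    using assms(3) by blast
  then show "x - y \<in> \<Union>C" "x * y \<in> \<Union>C"
    using assms(2) subring.diff_closed subring.mult_closed by blast+
qed

text \<open>In a subring that is maximal among those without \<open>s\<inverse>\<close>, every \<open>1 - s a\<close> is a unit. A relation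
  \<open>g(1/x) = s\<inverse>\<close> then expresses the top power of \<open>x\<close> through lower ones, so that two relations of
  minimal degrees in \<open>x\<close> and \<open>1/x\<close> cannot coexist.\<close>

lemma (in subring) minimal_relation_degree_less:
  assumes unit: "\<And>a. a \<in> V \<Longrightarrow> 1 - s * a \<noteq> 0 \<and> inverse (1 - s * a) \<in> V"
    and s: "s \<in> V" "inverse s \<notin> V"
    and xy: "x * y = 1"
    and f: "\<And>i. coeff f i \<in> V" "poly f x = inverse s"
    and f_min: "\<And>f'. (\<forall>i. coeff f' i \<in> V) \<Longrightarrow> poly f' x = inverse s \<Longrightarrow> degree f \<le> degree f'"
    and g: "\<And>i. coeff g i \<in> V" "poly g y = inverse s"
  shows "degree f < degree g"
proof (rule ccontr)
  assume "\<not> degree f < degree g"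
  then have le: "degree g \<le> degree f" by simp
  have s0: "s \<noteq> 0"
    using s zero_closed by auto
  obtain g0 g' where g_eq: "g = pCons g0 g'"
    by (cases g)
  have "degree g \<noteq> 0"
  proof
    assume "degree g = 0"
    then obtain c where "g = [:c:]" by (metis degree_eq_zeroE)
    then show False using g(1)[of 0] g(2) s(2) by simp
  qed
  then have g'0: "g' \<noteq> 0" and dg: "degree g = Suc (degree g')"
    by (auto simp: g_eq split: if_splits)
  define n where "n = degree f"
  have n: "n \<ge> Suc (degree g')" using le dg by (simp add: n_def)
  have coeff_g': "coeff g' i \<in> V" for i
    using g(1)[of "Suc i"] by (simp add: g_eq)
  have g0: "g0 \<in> V"
    using g(1)[of 0] by (simp add: g_eq)
  define u where "u = 1 - s * g0"
  have u: "u \<noteq> 0" "inverse u \<in> V"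
    using unit[OF g0] by (auto simp: u_def)
  have u_eq: "u = s * (y * poly g' y)"
    using g(2) s0 by (simp add: g_eq u_def field_simps)
  \<comment> \<open>As \<open>y\<close> inverts \<open>x\<close>, \<open>H\<close> is
    \<open>x^n * y * g'(y)\<close> rewritten as a polynomial in \<open>x\<close>. Its degree is
    below \<open>n\<close>, so \<open>u * x^n = s * H(x)\<close> lowers powers of
    \<open>x\<close>.\<close>
  define H where "H = (\<Sum>j\<le>degree g'. monom (coeff g' j) (n - 1 - j))"
  have xyk: "x ^ k = x ^ l * y ^ j" if "k + j = l" for k l j
  proof -
    have "x ^ l * y ^ j = x ^ k * (x * y) ^ j"
      by (simp add: that[symmetric] power_add power_mult_distrib)
    then show ?thesis using xy by simp
  qed
  have "x ^ n * (y * poly g' y) = (\<Sum>j\<le>degree g'. coeff g' j * (x ^ n * y ^ Suc j))"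
    by (simp add: poly_altdef sum_distrib_left algebra_simps)
  also have "\<dots> = (\<Sum>j\<le>degree g'. coeff g' j * x ^ (n - 1 - j))"
    using n by (intro sum.cong refl arg_cong2[of _ _ _ _ "(*)"] xyk[symmetric]) auto
  also have "\<dots> = poly H x"
    by (simp add: H_def poly_sum poly_monom)
  finally have H: "u * x ^ n = s * poly H x"
    by (simp add: u_eq algebra_simps)
  have coeff_H: "coeff H i \<in> V" for i
    by (auto simp: H_def coeff_sum intro!: sum_closed coeff_g' zero_closed)
  have coeff_H_big: "coeff H i = 0" if "i \<ge> n" for i
    using that n by (auto simp: H_def coeff_sum intro!: sum.neutral)
  \<comment> \<open>The top term of \<open>f\<close> is traded for lower ones without changing the
    value at \<open>x\<close>; minimality then leaves only \<open>f1 = 0\<close>, which that value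
    excludes.\<close>
  define f1 where "f1 = f - monom (coeff f n) n + smult (coeff f n * s * inverse u) H"
  have "poly f1 x = poly f x + coeff f n * inverse u * (s * poly H x - u * x ^ n)"
    using u(1) by (simp add: f1_def poly_monom right_diff_distrib mult.assoc)
  then have "poly f1 x = inverse s"
    using H f(2) by simp
  moreover have "\<forall>i. coeff f1 i \<in> V"
    using u f s coeff_H by (auto simp: f1_def intro!: closed)
  ultimately have "n \<le> degree f1"
    using f_min n_def by blast
  moreover have "coeff f1 i = 0" if "i \<ge> n" for i
    using that coeff_H_big[OF that] coeff_eq_0[of f i] by (cases "i = n") (auto simp: f1_def n_def)
  ultimately have "f1 = 0"
    by (metis leading_coeff_0_iff)
  then show False
    using \<open>poly f1 x = inverse s\<close> s0 by simp
qed

text \<open>A subring maximal among those that contain \<open>A\<close> and miss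
  \<open>inverse s\<close> is a valuation ring. The case \<open>s = p\<close> places a valuation
  above \<open>p\<close> on the complex numbers, the case \<open>s = 1/x\<close> tests the
  integrality of \<open>x\<close>.\<close>

theorem exists_valuation_ring:
  assumes A: "subring A" and s: "s \<in> A" "inverse s \<notin> A"
  obtains V where "valuation_ring V" "A \<subseteq> V" "inverse s \<notin> V"
proof -
  define \<A> where "\<A> = {B. subring B \<and> A \<subseteq> B \<and> inverse s \<notin> B}"
  have "\<exists>M\<in>\<A>. \<forall>X\<in>\<A>. M \<subseteq> X \<longrightarrow> X = M"
  proof (rule subset_Zorn_nonempty)
    show "\<A> \<noteq> {}"
      using assms by (auto simp: \<A>_def)
  next
    fix C assume C: "C \<noteq> {}" "subset.chain \<A> C"
    then have "subring (\<Union>C)"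
      by (intro subring_Union_chain) (auto simp: subset_chain_def \<A>_def)
    with C show "\<Union>C \<in> \<A>"
      by (auto simp: subset_chain_def \<A>_def)
  qed
  then obtain V where V: "subring V" "A \<subseteq> V" "inverse s \<notin> V"
    and max: "\<And>X. subring X \<Longrightarrow> A \<subseteq> X \<Longrightarrow> inverse s \<notin> X \<Longrightarrow> V \<subseteq> X \<Longrightarrow> X = V"
    unfolding \<A>_def by auto
  interpret subring V by fact
  have sV: "s \<in> V" using s V by auto
  \<comment> \<open>Localizing at \<open>u = 1 - s a\<close> cannot produce
    \<open>inverse s\<close>: powers of \<open>u\<close> are again of the form
    \<open>1 - s d\<close>, so \<open>inverse s = c / u^n\<close> would give
    \<open>inverse s = c + d\<close>. Maximality then puts \<open>inverse u\<close> into
    \<open>V\<close>.\<close>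
  have unit: "1 - s * a \<noteq> 0 \<and> inverse (1 - s * a) \<in> V" if a: "a \<in> V" for a
  proof
    define u where "u = 1 - s * a"
    have uV: "u \<in> V" using a sV by (auto simp: u_def intro: closed)
    show u0: "1 - s * a \<noteq> 0"
      using a V(3) inverse_unique[of s a] by auto
    let ?X = "{c / u ^ n | c n. c \<in> V}"
    have "\<exists>d\<in>V. u ^ n = 1 - s * d" for n
    proof (induction n)
      case (Suc n)
      then obtain d where d: "d \<in> V" "u ^ n = 1 - s * d" by auto
      have "u ^ Suc n = 1 - s * (a + u * d)"
        unfolding power_Suc d(2) by (simp add: u_def algebra_simps)
      then show ?case using d a uV by (blast intro: closed)
    qed (auto intro: closed)
    note pow = this
    have "inverse s \<notin> ?X"
    proof
      assume "inverse s \<in> ?X"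
      then obtain c n where c: "inverse s = c / u ^ n" "c \<in> V" by auto
      obtain d where d: "d \<in> V" "u ^ n = 1 - s * d" using pow by blast
      have "s \<noteq> 0" using V(3) zero_closed by auto
      then have "u ^ n = s * c" using c u0 by (simp add: u_def field_simps)
      then have "s * (c + d) = 1" using d by (simp add: algebra_simps)
      then have "inverse s = c + d" by (rule inverse_unique)
      then show False using V(3) c d by (auto intro: closed)
    qed
    moreover have "V \<subseteq> ?X"
      by (auto intro!: exI[of _ "0::nat"])
    ultimately have "?X = V"
      using max[of ?X] V subring_localize[OF uV] u0 by (auto simp: u_def)
    moreover have "inverse u \<in> ?X"
      by (auto intro!: exI[of _ 1] simp: divide_inverse closed)
    ultimately show "inverse (1 - s * a) \<in> V"
      by (simp add: u_def)
  qed
  \<comment> \<open>By maximality, adjoining a new \<open>x\<close> to \<open>V\<close> must capture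
    \<open>inverse s\<close>.\<close>
  have rel: "\<exists>f. (\<forall>i. coeff f i \<in> V) \<and> poly f x = inverse s" if x: "x \<notin> V" for x
  proof (rule ccontr)
    let ?X = "{poly f x | f. \<forall>i. coeff f i \<in> V}"
    assume "\<nexists>f. (\<forall>i. coeff f i \<in> V) \<and> poly f x = inverse s"
    then have "inverse s \<notin> ?X" by force
    moreover have VX: "V \<subseteq> ?X"
    proof
      fix c assume "c \<in> V"
      then show "c \<in> ?X"
        by (auto intro!: exI[of _ "[:c:]"] simp: coeff_pCons closed split: nat.splits)
    qed
    ultimately have "?X = V"
      using max[OF subring_adjoin, of x] V(2) by auto
    moreover have "x \<in> ?X"
      by (auto intro!: exI[of _ "[:0, 1:]"] simp: coeff_pCons closed split: nat.splits)
    ultimately show False using x by simp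
  qed
  have minrel: "\<exists>f. ((\<forall>i. coeff f i \<in> V) \<and> poly f x = inverse s) \<and>
      (\<forall>f'. (\<forall>i. coeff f' i \<in> V) \<and> poly f' x = inverse s \<longrightarrow> degree f \<le> degree f')"
    if "x \<notin> V" for x
    using rel[OF that] ex_has_least_nat[of "\<lambda>f. (\<forall>i. coeff f i \<in> V) \<and> poly f x = inverse s" _ degree]
    by blast
  have "inverse x \<in> V" if x: "x \<notin> V" for x
  proof (rule ccontr)
    assume y: "inverse x \<notin> V"
    have x0: "x \<noteq> 0" using x zero_closed by auto
    obtain f where f: "\<And>i. coeff f i \<in> V" "poly f x = inverse s"
      "\<And>f'. (\<forall>i. coeff f' i \<in> V) \<Longrightarrow> poly f' x = inverse s \<Longrightarrow> degree f \<le> degree f'"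
      using minrel[OF x] by blast
    obtain g where g: "\<And>i. coeff g i \<in> V" "poly g (inverse x) = inverse s"
      "\<And>f'. (\<forall>i. coeff f' i \<in> V) \<Longrightarrow> poly f' (inverse x) = inverse s \<Longrightarrow> degree g \<le> degree f'"
      using minrel[OF y] by blast
    have "degree f < degree g"
      by (rule minimal_relation_degree_less[OF unit sV V(3) _ f g(1,2)]) (use x0 in auto)
    moreover have "degree g < degree f"
      by (rule minimal_relation_degree_less[OF unit sV V(3) _ g f(1,2)]) (use x0 in auto)
    ultimately show False by simp
  qed
  then have "valuation_ring V"
    by unfold_locales
  with V that show thesis by blast
qed

section \<open>Maximal ideal, residue congruences and Newton polygons\<close>

context valuation_ring
begin

text \<open>The maximal ideal, taken inside the whole field: \<open>x \<notin> M\<close> says that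
  the valuation of \<open>x\<close> is at most 0 and does not put \<open>x\<close> into
  \<open>V\<close>.\<close>

definition M :: "'a set" where
  "M = {x. x = 0 \<or> inverse x \<notin> V}"

lemma M_subset: "x \<in> M \<Longrightarrow> x \<in> V"
  using inverse_closed[of "inverse x"] zero_closed by (auto simp: M_def)

lemma zero_in_M: "0 \<in> M"
  by (simp add: M_def)

lemma one_notin_M: "1 \<notin> M"
  by (simp add: M_def one_closed)

lemma not_M_D:
  assumes "x \<notin> M"
  shows "x \<noteq> 0" "inverse x \<in> V"
  using assms by (auto simp: M_def)

lemma M_mult: assumes "x \<in> M" "y \<in> V" shows "x * y \<in> M" "y * x \<in> M"
proof -
  show "x * y \<in> M"
  proof (rule ccontr)
    assume "x * y \<notin> M"
    then have "x * y \<noteq> 0" "inverse (x * y) \<in> V" by (auto simp: M_def)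
    then have "y * inverse (x * y) \<in> V" using assms by (auto intro: closed)
    moreover have "y * inverse (x * y) = inverse x" using \<open>x * y \<noteq> 0\<close> by (auto simp: field_simps)
    ultimately have "inverse x \<in> V" by metis
    then show False using assms(1) \<open>x * y \<noteq> 0\<close> by (simp add: M_def)
  qed
  then show "y * x \<in> M" by (simp add: mult.commute)
qed

lemma M_uminus: "x \<in> M \<Longrightarrow> - x \<in> M"
  using M_mult(1)[of x "-1"] by (auto intro: closed)

text \<open>Of two nonzero elements one divides the other in \<open>V\<close>, so the sum is a
  \<open>V\<close>-multiple of one of them.\<close>

lemma M_add: assumes "x \<in> M" "y \<in> M" shows "x + y \<in> M"
proof -
  have *: "x + y \<in> M" if "x \<in> M" "y \<in> M" "x / y \<in> V" "y \<noteq> 0" for x y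
  proof -
    have "y * (1 + x / y) \<in> M" using that by (intro M_mult closed)
    moreover have "y * (1 + x / y) = x + y" using that by (simp add: distrib_left)
    ultimately show ?thesis by simp
  qed
  show ?thesis
  proof (cases "x = 0 \<or> y = 0")
    case False
    then show ?thesis
      using *[of x y] *[of y x] assms inverse_closed[of "x / y"] by (auto simp: add.commute)
  qed (use assms in auto)
qed

lemma M_diff: "x \<in> M \<Longrightarrow> y \<in> M \<Longrightarrow> x - y \<in> M"
  using M_add[OF _ M_uminus, of x y] by simp

lemma M_sum: "(\<And>i. i \<in> I \<Longrightarrow> f i \<in> M) \<Longrightarrow> (\<Sum>i\<in>I. f i) \<in> M"
  by (induction I rule: infinite_finite_induct) (auto intro: zero_in_M M_add)

lemma M_cancel: assumes "x * y \<in> M" "x \<notin> M" shows "y \<in> M"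
  using M_mult(1)[OF assms(1) not_M_D(2)[OF assms(2)]] not_M_D(1)[OF assms(2)]
  by (simp add: field_simps)

lemma M_cancel': "x * y \<in> M \<Longrightarrow> y \<notin> M \<Longrightarrow> x \<in> M"
  using M_cancel[of y x] by (simp add: mult.commute)

lemma V_cancel: assumes "x * y \<in> V" "x \<notin> M" shows "y \<in> V"
  using mult_closed[OF assms(1) not_M_D(2)[OF assms(2)]] not_M_D(1)[OF assms(2)]
  by (simp add: field_simps)

lemma not_M_mult: "x \<notin> M \<Longrightarrow> y \<notin> M \<Longrightarrow> x * y \<notin> M"
  using M_cancel by blast

lemma not_M_power: "x \<notin> M \<Longrightarrow> x ^ n \<notin> M"
  by (induction n) (auto simp: one_notin_M dest: M_cancel)

lemma M_power_D: "x ^ n \<in> M \<Longrightarrow> x \<in> M"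
  using not_M_power by blast

lemma M_power: "x \<in> M \<Longrightarrow> n > 0 \<Longrightarrow> x ^ n \<in> M"
  by (cases n) (auto intro: M_mult power_closed M_subset)

lemma not_M_prod: "(\<And>i. i \<in> I \<Longrightarrow> f i \<notin> M) \<Longrightarrow> (\<Prod>i\<in>I. f i) \<notin> M"
  by (induction I rule: infinite_finite_induct) (auto simp: one_notin_M dest: M_cancel)

lemma not_M_add: "x \<notin> M \<Longrightarrow> y \<in> M \<Longrightarrow> x + y \<notin> M"
  using M_diff[of "x + y" y] by auto

lemma not_V_imp_inverse_M: "x \<notin> V \<Longrightarrow> inverse x \<in> M"
  by (simp add: M_def)

lemma V_power_D: assumes "x ^ n \<in> V" "n > 0" shows "x \<in> V"
proof (rule ccontr)
  assume "x \<notin> V"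
  then have "inverse (x ^ n) \<in> M"
    using M_power[OF not_V_imp_inverse_M assms(2)] by (simp add: power_inverse)
  then have "inverse (x ^ n) * x ^ n \<in> M"
    using assms by (intro M_mult)
  moreover have "x \<noteq> 0" using \<open>x \<notin> V\<close> zero_closed by auto
  ultimately show False using one_notin_M by simp
qed

lemma integrally_closed:
  assumes "lead_coeff f = 1" "\<And>i. coeff f i \<in> V" "poly f x = 0"
  shows "x \<in> V"
proof (rule ccontr)
  assume x: "x \<notin> V"
  then have x0: "x \<noteq> 0" using zero_closed by auto
  define n where "n = degree f"
  have "0 = inverse x ^ n * (\<Sum>i\<le>n. coeff f i * x ^ i)"
    using assms(3) by (simp add: poly_altdef n_def)
  also have "\<dots> = inverse x ^ n * (\<Sum>i<n. coeff f i * x ^ i) + 1"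
    using assms(1) x0 by (simp add: n_def lessThan_Suc_atMost[symmetric] field_simps)
  also have "inverse x ^ n * (\<Sum>i<n. coeff f i * x ^ i) = (\<Sum>i<n. coeff f i * inverse x ^ (n - i))"
    unfolding sum_distrib_left
    using x0 by (intro sum.cong refl) (auto simp: field_simps power_diff)
  finally have "1 = - (\<Sum>i<n. coeff f i * inverse x ^ (n - i))"
    by (metis add.commute add_eq_0_iff2 minus_minus)
  moreover have "(\<Sum>i<n. coeff f i * inverse x ^ (n - i)) \<in> M"
    using assms(2) not_V_imp_inverse_M[OF x] by (auto intro!: M_sum M_mult M_power)
  ultimately show False
    using one_notin_M M_uminus by metis
qed

lemma quadratic_closed:
  assumes "x ^ 2 = a * x + b" "a \<in> V" "b \<in> V"
  shows "x \<in> V"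
proof (rule integrally_closed)
  show "poly [:- b, - a, 1:] x = 0"
    using assms(1) by (simp add: algebra_simps power2_eq_square)
qed (use assms in \<open>auto simp: coeff_pCons closed split: nat.splits\<close>)

lemma algebraic_int_closed:
  assumes "algebraic_int x"
  shows "x \<in> V"
proof -
  obtain f where f: "lead_coeff f = 1" "\<forall>i. coeff f i \<in> \<int>" "poly f x = 0"
    using assms by cases
  have "coeff f i \<in> V" for i
    using f(2) of_int_closed by (metis Ints_cases)
  then show ?thesis
    using integrally_closed[OF f(1) _ f(3)] by blast
qed

definition req :: "'a \<Rightarrow> 'a \<Rightarrow> bool" (infix \<open>\<simeq>\<close> 50) where
  "x \<simeq> y \<longleftrightarrow> x - y \<in> M"

lemma req_refl [simp]: "x \<simeq> x"
  by (simp add: req_def zero_in_M)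

lemma req_sym: "x \<simeq> y \<Longrightarrow> y \<simeq> x"
  using M_uminus[of "x - y"] by (simp add: req_def)

lemma req_trans [trans]: "x \<simeq> y \<Longrightarrow> y \<simeq> z \<Longrightarrow> x \<simeq> z"
  using M_add[of "x - y" "y - z"] by (simp add: req_def)

lemma req_add: "x \<simeq> x' \<Longrightarrow> y \<simeq> y' \<Longrightarrow> x + y \<simeq> x' + y'"
  using M_add[of "x - x'" "y - y'"] by (simp add: req_def algebra_simps)

lemma req_diff: "x \<simeq> x' \<Longrightarrow> y \<simeq> y' \<Longrightarrow> x - y \<simeq> x' - y'"
  using M_diff[of "x - x'" "y - y'"] by (simp add: req_def algebra_simps)

lemma req_in_V: "x \<simeq> y \<Longrightarrow> x \<in> V \<Longrightarrow> y \<in> V"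
  using diff_closed[of x "x - y"] M_subset by (auto simp: req_def)

lemma req_M: "x \<simeq> y \<Longrightarrow> x \<in> M \<Longrightarrow> y \<in> M"
  using M_diff[of x "x - y"] by (simp add: req_def)

lemma req_mult:
  assumes "x \<simeq> x'" "y \<simeq> y'" "x \<in> V" "y \<in> V"
  shows "x * y \<simeq> x' * y'"
proof -
  have "x * y - x' * y' = x * (y - y') + (x - x') * y'"
    by (simp add: algebra_simps)
  also have "\<dots> \<in> M"
    using assms req_in_V[OF assms(2,4)]
    by (intro M_add M_mult(1)[of "x - x'"] M_mult(2)[of "y - y'"]) (auto simp: req_def)
  finally show ?thesis by (simp add: req_def)
qed

lemma req_power: "x \<simeq> x' \<Longrightarrow> x \<in> V \<Longrightarrow> x ^ n \<simeq> x' ^ n"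
  by (induction n) (auto intro: req_mult power_closed)

lemma req_poly_of_int:
  assumes "x \<simeq> y" "x \<in> V"
  shows "poly (map_poly of_int f) x \<simeq> poly (map_poly of_int f) y"
proof (induction f)
  case (pCons a f)
  then show ?case
    using assms by (auto simp: map_poly_pCons intro!: req_add req_mult poly_of_int_closed)
qed simp

lemma coeff_synthetic_div_closed:
  "(\<And>i. coeff f i \<in> V) \<Longrightarrow> c \<in> V \<Longrightarrow> coeff (synthetic_div f c) i \<in> V"
proof (induction f arbitrary: i)
  case (pCons a f)
  have "coeff f i \<in> V" for i using pCons.prems(1)[of "Suc i"] by simp
  with pCons show ?case by (auto simp: coeff_pCons intro: poly_closed split: nat.splits)
qed (auto intro: closed)

text \<open>The root bound over the residue field \<open>V/M\<close>, by synthetic division with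
  coefficients in \<open>V\<close>; being monic keeps the degree under reduction.\<close>

lemma card_incongruent_roots_le_degree:
  assumes "finite X" "X \<subseteq> V" "\<And>x y. x \<in> X \<Longrightarrow> y \<in> X \<Longrightarrow> x \<simeq> y \<Longrightarrow> x = y"
    and "\<And>i. coeff f i \<in> V" "lead_coeff f = 1" "\<And>x. x \<in> X \<Longrightarrow> poly f x \<in> M"
  shows "card X \<le> degree f"
  using assms
proof (induction X arbitrary: f rule: finite_induct)
  case (insert c X)
  define q where "q = synthetic_div f c"
  have f_eq: "f = [:-c, 1:] * q + [:poly f c:]"
    unfolding q_def by (rule synthetic_div_correct'[symmetric])
  have deg: "degree f > 0"
  proof (rule ccontr)
    assume "\<not> degree f > 0"
    then have "f = 1" using insert.prems(4) by (auto elim!: degree_eq_zeroE simp: one_pCons)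
    then show False using insert.prems(5)[of c] one_notin_M by simp
  qed
  have degq: "degree q = degree f - 1" by (simp add: q_def degree_synthetic_div)
  have "coeff f (degree f) = coeff q (degree f - 1) - c * coeff q (degree f)"
    using deg by (subst (1) f_eq) (cases "degree f", auto simp: coeff_pCons)
  moreover have "coeff q (degree f) = 0" using deg degq by (intro coeff_eq_0) auto
  ultimately have "lead_coeff q = 1" using insert.prems(4) degq by simp
  moreover have "coeff q i \<in> V" for i
    unfolding q_def using insert.prems by (intro coeff_synthetic_div_closed) auto
  moreover have "poly q x \<in> M" if x: "x \<in> X" for x
  proof -
    have "poly f x = (x - c) * poly q x + poly f c"
      by (subst f_eq) (simp add: algebra_simps)
    then have "(x - c) * poly q x = poly f x - poly f c" by simp
    also have "\<dots> \<in> M" using insert.prems(5) x by (intro M_diff) auto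
    finally show ?thesis
      using insert.prems(2)[of x c] x insert.hyps by (auto intro: M_cancel simp: req_def)
  qed
  ultimately have "card X \<le> degree q"
    using insert.prems by (intro insert.IH) auto
  then show ?case using insert.hyps degq deg by simp
qed simp

lemma coeff_prod_M_roots:
  assumes "finite S" "\<And>b. b \<in> S \<Longrightarrow> t b \<in> M"
  shows "(\<forall>i < card S. coeff (\<Prod>b\<in>S. [:- t b, 1:]) i \<in> M) \<and>
    coeff (\<Prod>b\<in>S. [:- t b, 1:]) (card S) = 1 \<and> (\<forall>i > card S. coeff (\<Prod>b\<in>S. [:- t b, 1:]) i = 0)"
  using assms
proof (induction S rule: finite_induct)
  case (insert c S)
  define A where "A = (\<Prod>b\<in>S. [:- t b, 1:])"
  have c: "t c \<in> M" and S: "\<And>b. b \<in> S \<Longrightarrow> t b \<in> M" using insert.prems by auto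
  have IH: "\<And>i. i < card S \<Longrightarrow> coeff A i \<in> M" "coeff A (card S) = 1" "\<And>i. i > card S \<Longrightarrow> coeff A i = 0"
    using insert.IH[OF S] by (auto simp: A_def)
  have AV: "coeff A i \<in> V" for i
    unfolding A_def using S by (intro coeff_prod_closed)
      (auto simp: coeff_pCons closed M_subset split: nat.splits)
  have eq: "coeff (\<Prod>b\<in>insert c S. [:- t b, 1:]) i = (if i = 0 then 0 else coeff A (i - 1)) - t c * coeff A i" for i
    using insert.hyps by (cases i) (auto simp: A_def[symmetric])
  have "(if i = 0 then 0 else coeff A (i - 1)) - t c * coeff A i \<in> M" if "i < Suc (card S)" for i
    using that IH(1)[of "i - 1"] M_mult(1)[OF c AV] by (intro M_diff) (auto simp: zero_in_M)
  then show ?case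
    using IH insert.hyps unfolding eq by auto
qed simp

text \<open>A root \<open>t\<close> outside \<open>M\<close> contributes
  \<open>-t (1 - X/t)\<close>, where the bracket has coefficients in \<open>V\<close> and constant
  term 1; the roots in \<open>M\<close> together reduce to a power of \<open>X\<close>. Hence the
  first coefficient outside \<open>M\<close> counts the latter, which is the first vertex of the
  Newton polygon.\<close>

lemma card_roots_in_M:
  assumes B: "finite B" and V: "\<And>i. coeff (smult a (\<Prod>b\<in>B. [:- t b, 1:])) i \<in> V"
    and k: "\<And>i. i < k \<Longrightarrow> coeff (smult a (\<Prod>b\<in>B. [:- t b, 1:])) i \<in> M"
      "coeff (smult a (\<Prod>b\<in>B. [:- t b, 1:])) k \<notin> M"
  shows "card {b\<in>B. t b \<in> M} = k"
proof -
  define Q where "Q = smult a (\<Prod>b\<in>B. [:- t b, 1:])"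
  define S where "S = {b\<in>B. t b \<in> M}"
  define L where "L = B - S"
  define A where "A = (\<Prod>b\<in>S. [:- t b, 1:])"
  define C where "C = (\<Prod>b\<in>L. [:1, - inverse (t b):])"
  define n where "n = card S"
  have fin: "finite S" "finite L" using B by (auto simp: S_def L_def)
  have A: "\<And>i. i < n \<Longrightarrow> coeff A i \<in> M" "coeff A n = 1"
    using coeff_prod_M_roots[OF fin(1), of t] by (auto simp: A_def n_def S_def)
  have AV: "coeff A i \<in> V" for i
    unfolding A_def by (intro coeff_prod_closed)
      (auto simp: S_def coeff_pCons closed M_subset split: nat.splits)
  have CV: "coeff C i \<in> V" for i
    unfolding C_def by (intro coeff_prod_closed)
      (auto simp: S_def L_def coeff_pCons closed not_M_D split: nat.splits)
  have C0: "coeff C 0 = 1"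
    using fin(2) unfolding C_def by (simp add: poly_0_coeff_0[symmetric] poly_prod)
  define D where "D = A * C"
  have DV: "coeff D i \<in> V" for i unfolding D_def by (intro coeff_mult_closed AV CV)
  have D_low: "coeff D i \<in> M" if "i < n" for i
    unfolding D_def coeff_mult using that A(1) CV by (intro M_sum M_mult) auto
  have "coeff D n = (\<Sum>j<n. coeff A j * coeff C (n - j)) + 1"
    by (simp add: D_def coeff_mult lessThan_Suc_atMost[symmetric] A(2) C0)
  moreover have "(\<Sum>j<n. coeff A j * coeff C (n - j)) \<in> M"
    using A(1) CV by (intro M_sum M_mult) auto
  ultimately have D_n: "coeff D n \<notin> M"
    using not_M_add[OF one_notin_M] by (metis add.commute)
  \<comment> \<open>Collects the scalars \<open>- t b\<close> of the roots outside \<open>M\<close>;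
    the coefficient of index \<open>n\<close> shows that it lies in \<open>V\<close>.\<close>
  define a' where "a' = a * (\<Prod>b\<in>L. - t b)"
  have "(\<Prod>b\<in>L. [:- t b, 1:]) = (\<Prod>b\<in>L. smult (- t b) [:1, - inverse (t b):])"
    by (intro prod.cong refl) (auto simp: L_def S_def not_M_D)
  also have "\<dots> = smult (\<Prod>b\<in>L. - t b) C"
    by (simp only: C_def prod_smult)
  finally have "Q = smult a' D"
    using B by (simp add: Q_def a'_def D_def A_def L_def S_def prod.subset_diff[of "{b \<in> B. t b \<in> M}" B] mult.commute)
  then have Q: "coeff Q i = a' * coeff D i" for i by simp
  have a': "a' \<in> V"
    using V_cancel[of "coeff D n" a'] V[of n] D_n Q[of n] by (simp add: Q_def mult.commute)
  have "\<not> n < k"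
  proof
    assume "n < k"
    then have "a' \<in> M" using k(1)[of n] Q[of n] D_n M_cancel' by (auto simp: Q_def)
    then show False using k(2) Q[of k] DV[of k] by (auto simp: Q_def intro: M_mult)
  qed
  moreover have "\<not> k < n"
    using k(2) Q[of k] D_low[of k] a' by (auto simp: Q_def intro: M_mult)
  ultimately show ?thesis by (simp add: n_def S_def)
qed

text \<open>The substitution \<open>X = \<zeta> + \<pi> Y\<close> moves the roots closer to
  \<open>\<zeta>\<close> than \<open>\<pi>\<close> into \<open>M\<close>; \<open>c\<close> rescales
  the polynomial so that the coefficient at the vertex is a unit.\<close>

lemma card_roots_in_ball:
  assumes B: "finite B" and nz: "\<pi> \<noteq> 0" "c \<noteq> 0"
    and V: "\<And>i. coeff (pcompose (\<Prod>b\<in>B. [:- b, 1:]) [:\<zeta>, \<pi>:]) i / c \<in> V"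
    and k: "\<And>i. i < k \<Longrightarrow> coeff (pcompose (\<Prod>b\<in>B. [:- b, 1:]) [:\<zeta>, \<pi>:]) i / c \<in> M"
      "coeff (pcompose (\<Prod>b\<in>B. [:- b, 1:]) [:\<zeta>, \<pi>:]) k / c \<notin> M"
  shows "card {b\<in>B. (b - \<zeta>) / \<pi> \<in> M} = k"
proof -
  have "pcompose (\<Prod>b\<in>B. [:- b, 1:]) [:\<zeta>, \<pi>:] = (\<Prod>b\<in>B. smult \<pi> [:- ((b - \<zeta>) / \<pi>), 1:])"
    using nz by (auto simp: pcompose_prod pcompose_pCons field_simps intro!: prod.cong)
  then have eq: "pcompose (\<Prod>b\<in>B. [:- b, 1:]) [:\<zeta>, \<pi>:] =
      smult (\<pi> ^ card B) (\<Prod>b\<in>B. [:- ((b - \<zeta>) / \<pi>), 1:])"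
    by (simp only: prod_smult prod_constant)
  show ?thesis
    using V k unfolding eq
    by (intro card_roots_in_M[OF B, of "\<pi> ^ card B / c"]) auto
qed

end

text \<open>If \<open>x\<close> is not integral over \<open>\<int>\<close>, then \<open>x \<notin> \<int>[x\<inverse>]\<close>, so some valuation ring misses \<open>x\<close>.\<close>

theorem algebraic_int_iff_valuation_ring:
  fixes x :: "'a::field_char_0"
  shows "algebraic_int x \<longleftrightarrow> (\<forall>V. valuation_ring V \<longrightarrow> x \<in> V)"
proof
  assume V: "\<forall>V. valuation_ring V \<longrightarrow> x \<in> V"
  show "algebraic_int x"
  proof (rule ccontr)
    assume x: "\<not> algebraic_int x"
    then have x0: "x \<noteq> 0" by auto
    interpret Z: subring "\<int> :: 'a set" by unfold_locales auto
    define A where "A = {poly f (inverse x) | f. \<forall>i. coeff f i \<in> \<int>}"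
    have A: "subring A" unfolding A_def by (rule Z.subring_adjoin)
    have "x \<notin> A"
    proof
      assume "x \<in> A"
      then obtain f where f: "x = poly f (inverse x)" "\<forall>i. coeff f i \<in> \<int>" by (auto simp: A_def)
      define n where "n = degree f"
      \<comment> \<open>The reversal of \<open>f\<close>: multiplying \<open>x = f(1/x)\<close> by
        \<open>x^n\<close> yields the monic equation \<open>x^(n+1) = g(x)\<close>.\<close>
      define g where "g = (\<Sum>i\<le>n. monom (coeff f i) (n - i))"
      have "x ^ Suc n = x ^ n * poly f (inverse x)" by (simp flip: f(1))
      also have "\<dots> = (\<Sum>i\<le>n. coeff f i * x ^ (n - i))"
        unfolding poly_altdef n_def[symmetric] sum_distrib_left
        using x0 by (intro sum.cong refl) (auto simp: field_simps power_diff)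
      also have "\<dots> = poly g x" by (simp add: g_def poly_sum poly_monom)
      finally have "poly (monom 1 (Suc n) - g) x = 0" by (simp add: poly_monom)
      moreover have "coeff g i = 0" if "i > n" for i
        using that by (auto simp: g_def coeff_sum intro!: sum.neutral)
      then have lc: "coeff (monom 1 (Suc n) - g) (Suc n) = 1" and "degree (monom 1 (Suc n) - g) \<le> Suc n"
        by (auto intro!: degree_le)
      then have "degree (monom 1 (Suc n) - g) = Suc n"
        using le_degree[of "monom 1 (Suc n) - g" "Suc n"] by simp
      note this lc
      moreover have "\<forall>i. coeff (monom 1 (Suc n) - g) i \<in> \<int>"
        using f(2) by (auto simp: g_def coeff_sum intro!: Ints_diff Ints_sum)
      ultimately show False
        using x algebraic_int.intros[of "monom 1 (Suc n) - g" x] by simp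
    qed
    moreover have "inverse x \<in> A"
      unfolding A_def by (auto intro!: exI[of _ "[:0, 1:]"] simp: coeff_pCons split: nat.splits)
    ultimately obtain V where "valuation_ring V" "x \<notin> V"
      using exists_valuation_ring[OF A, of "inverse x"] by auto
    with V show False by blast
  qed
qed (auto intro: valuation_ring.algebraic_int_closed)

text \<open>The integral elements are the intersection of all valuation rings, each of which is a
  subring.\<close>

lemma subring_algebraic_int: "subring {x :: 'a::field_char_0. algebraic_int x}"
proof
  have sub: "subring V" if "valuation_ring V" for V :: "'a set"
    using that by (simp add: valuation_ring_def)
  fix x y :: 'a assume "x \<in> {x. algebraic_int x}" "y \<in> {x. algebraic_int x}"
  then have xy: "x \<in> V" "y \<in> V" if "valuation_ring V" for V
    using that by (auto simp: algebraic_int_iff_valuation_ring)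
  show "x - y \<in> {x. algebraic_int x}"
    unfolding algebraic_int_iff_valuation_ring using xy subring.diff_closed[OF sub] by simp
  show "x * y \<in> {x. algebraic_int x}"
    unfolding algebraic_int_iff_valuation_ring using xy subring.mult_closed[OF sub] by simp
qed simp

text \<open>Valuation rings are integrally closed, so the coefficients may be integral elements
  rather than integers. The elements \<open>t\<close>, \<open>u\<close> and \<open>w\<close> are
  shown integral in this form.\<close>

lemma algebraic_int_quadratic:
  fixes x :: "'a::field_char_0"
  assumes "x ^ 2 = a * x + b" "algebraic_int a" "algebraic_int b"
  shows "algebraic_int x"
  unfolding algebraic_int_iff_valuation_ring
  using assms(1) valuation_ring.quadratic_closed valuation_ring.algebraic_int_closed[OF _ assms(2)]
    valuation_ring.algebraic_int_closed[OF _ assms(3)] by blast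

section \<open>Residue characteristic p: Frobenius and congruences modulo p\<close>

locale residue_char = valuation_ring V for V :: "'a::field_char_0 set" +
  fixes p :: nat
  assumes prime_p: "prime p" and p_in_M: "of_nat p \<in> M"
begin

lemma of_int_in_M_iff: "of_int n \<in> M \<longleftrightarrow> int p dvd n"
proof
  assume "int p dvd n"
  then obtain k where "n = int p * k" ..
  then show "of_int n \<in> M" using M_mult(1)[OF p_in_M of_int_closed] by simp
next
  assume n: "of_int n \<in> M"
  show "int p dvd n"
  proof (rule ccontr)
    assume "\<not> int p dvd n"
    then have "coprime (int p) n" using prime_p by (intro prime_imp_coprime) auto
    then obtain u v where "u * int p + v * n = 1" using bezout_int[of "int p" n] by auto
    then have "(of_int u :: 'a) * of_nat p + of_int v * of_int n = 1"
      by (metis of_int_add of_int_mult of_int_of_nat_eq of_int_1)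
    moreover have "(of_int u :: 'a) * of_nat p + of_int v * of_int n \<in> M"
      using n p_in_M by (intro M_add M_mult of_int_closed)
    ultimately show False using one_notin_M by simp
  qed
qed

text \<open>Ramification is invisible modulo \<open>M\<close>; it shows in elements whose square
  lies in this ideal while they themselves do not.\<close>

definition pV :: "'a set" where
  "pV = {of_nat p * x | x. x \<in> V}"

lemma pV_0: "0 \<in> pV"
  using zero_closed by (force simp: pV_def)

lemma pV_add: "x \<in> pV \<Longrightarrow> y \<in> pV \<Longrightarrow> x + y \<in> pV"
  using add_closed by (force simp: pV_def distrib_left[symmetric])

lemma pV_mult: assumes "x \<in> pV" "y \<in> V" shows "x * y \<in> pV" "y * x \<in> pV"
  using assms mult_closed by (auto simp: pV_def mult.assoc mult.commute mult.left_commute)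

lemma pV_diff: "x \<in> pV \<Longrightarrow> y \<in> pV \<Longrightarrow> x - y \<in> pV"
  using pV_add[of x "y * (-1)"] pV_mult(1)[of y "-1"] closed by simp

lemma pV_sum: "(\<And>i. i \<in> I \<Longrightarrow> f i \<in> pV) \<Longrightarrow> (\<Sum>i\<in>I. f i) \<in> pV"
  by (induction I rule: infinite_finite_induct) (auto intro: pV_0 pV_add)

lemma pV_subset_M: "x \<in> pV \<Longrightarrow> x \<in> M"
  using p_in_M by (auto simp: pV_def intro: M_mult)

lemma pV_cancel: assumes "x * y \<in> pV" "x \<notin> M" shows "y \<in> pV"
  using pV_mult(1)[OF assms(1) not_M_D(2)[OF assms(2)]] not_M_D(1)[OF assms(2)]
  by (simp add: field_simps)

lemma of_int_in_pV: "int p dvd n \<Longrightarrow> of_int n \<in> pV"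
  by (auto simp: pV_def of_int_closed elim!: dvdE)

lemma freshman_p: assumes "x \<in> V" "y \<in> V" shows "(x + y) ^ p - (x ^ p + y ^ p) \<in> pV"
proof -
  have p: "p > 0" using prime_p prime_gt_0_nat by blast
  have "(x + y) ^ p = (\<Sum>k\<le>p. of_nat (p choose k) * x ^ k * y ^ (p - k))"
    by (rule binomial_ring)
  also have "{..p} = insert 0 (insert p {1..<p})" using p by auto
  also have "(\<Sum>k\<in>insert 0 (insert p {1..<p}). of_nat (p choose k) * x ^ k * y ^ (p - k)) =
      y ^ p + (x ^ p + (\<Sum>k\<in>{1..<p}. of_nat (p choose k) * x ^ k * y ^ (p - k)))"
    using p by (subst sum.insert; simp)+
  finally have "(x + y) ^ p - (x ^ p + y ^ p) = (\<Sum>k\<in>{1..<p}. of_nat (p choose k) * x ^ k * y ^ (p - k))"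
    by simp
  also have "\<dots> \<in> pV"
  proof (intro pV_sum pV_mult)
    fix k assume "k \<in> {1..<p}"
    then have "p dvd (p choose k)" using prime_p by (intro dvd_choose_prime) auto
    then show "of_nat (p choose k) \<in> pV" using of_int_in_pV[of "int (p choose k)"] by simp
  qed (auto intro: closed assms)
  finally show ?thesis .
qed

lemma freshman_p_pV: assumes "x - y \<in> pV" "y \<in> V" shows "x ^ p - y ^ p \<in> pV"
proof -
  have p: "p > 0" using prime_p prime_gt_0_nat by blast
  have d: "x - y \<in> V" using assms(1) pV_subset_M M_subset by blast
  have "(x - y + y) ^ p - ((x - y) ^ p + y ^ p) \<in> pV" using d assms by (intro freshman_p)
  moreover have "(x - y) ^ p \<in> pV"
    using pV_mult(1)[OF assms(1) power_closed[OF d, of "p - 1"]] p by (simp add: power_eq_if)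
  ultimately show ?thesis using pV_add by fastforce
qed

lemma of_nat_power_p: "of_nat n ^ p - of_nat n \<in> pV"
proof (induction n)
  case 0
  show ?case using prime_gt_0_nat[OF prime_p] by (simp add: pV_0 zero_power)
next
  case (Suc n)
  have "(of_nat n + 1) ^ p - (of_nat n ^ p + 1 ^ p) \<in> pV" by (intro freshman_p closed)
  from pV_add[OF this Suc] show ?case by (simp add: algebra_simps)
qed

lemma of_int_power_p: "of_int a ^ p - of_int a \<in> pV"
proof -
  define n where "n = nat (a mod int p)"
  have n: "int n = a mod int p" using prime_gt_0_nat[OF prime_p] by (simp add: n_def)
  have "int p dvd a - int n" by (simp add: n)
  then have d: "of_int a - of_nat n \<in> pV" using of_int_in_pV by fastforce
  have "of_int a ^ p - of_nat n ^ p \<in> pV" by (intro freshman_p_pV d closed)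
  from pV_diff[OF pV_add[OF this of_nat_power_p[of n]] d] show ?thesis by simp
qed

text \<open>The coefficients are integers, fixed by the \<open>p\<close>-th power modulo
  \<open>p\<close>. The congruence holds modulo \<open>p\<close> itself and not only modulo
  \<open>M\<close>; the argument for unramified roots rests on this.\<close>

lemma poly_of_int_frobenius_p:
  assumes "x \<in> V"
  shows "poly (map_poly of_int f) (x ^ p) - poly (map_poly of_int f) x ^ p \<in> pV"
proof (induction f)
  case 0
  show ?case using prime_gt_0_nat[OF prime_p] by (simp add: pV_0 zero_power)
next
  case (pCons a f)
  let ?g = "poly (map_poly of_int f) x"
  have g: "?g \<in> V" by (intro poly_of_int_closed assms)
  have "of_int a - of_int a ^ p \<in> pV"
    using pV_mult(1)[OF of_int_power_p, of "-1" a] closed by simp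
  moreover have "x ^ p * (poly (map_poly of_int f) (x ^ p) - ?g ^ p) \<in> pV"
    using pCons.IH assms by (intro pV_mult closed)
  moreover have "(of_int a + x * ?g) ^ p - (of_int a ^ p + (x * ?g) ^ p) \<in> pV"
    using g assms by (intro freshman_p closed)
  ultimately have "of_int a - of_int a ^ p + x ^ p * (poly (map_poly of_int f) (x ^ p) - ?g ^ p)
      - ((of_int a + x * ?g) ^ p - (of_int a ^ p + (x * ?g) ^ p)) \<in> pV"
    by (intro pV_diff[OF pV_add])
  then show ?case by (simp add: map_poly_pCons algebra_simps power_mult_distrib)
qed

lemma poly_of_int_frobenius:
  assumes "x \<in> V"
  shows "poly (map_poly of_int f) (x ^ p ^ k) - poly (map_poly of_int f) x ^ p ^ k \<in> pV"
proof (induction k)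
  case (Suc k)
  have "poly (map_poly of_int f) ((x ^ p ^ k) ^ p) - poly (map_poly of_int f) (x ^ p ^ k) ^ p \<in> pV"
    using assms by (intro poly_of_int_frobenius_p closed)
  moreover have "poly (map_poly of_int f) (x ^ p ^ k) ^ p - (poly (map_poly of_int f) x ^ p ^ k) ^ p \<in> pV"
    using assms Suc by (intro freshman_p_pV closed poly_of_int_closed)
  ultimately have "poly (map_poly of_int f) ((x ^ p ^ k) ^ p) - (poly (map_poly of_int f) x ^ p ^ k) ^ p \<in> pV"
    using pV_add by fastforce
  then show ?case by (simp add: power_mult[symmetric] mult.commute)
qed (simp add: pV_0)

text \<open>Frobenius is additive on residues, and a power lies in \<open>M\<close> only if its base
  does; so Frobenius is injective on residues.\<close>

lemma req_of_power_req:
  assumes "x ^ p ^ k \<simeq> y ^ p ^ k" "x \<in> V" "y \<in> V"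
  shows "x \<simeq> y"
proof -
  have "(x - y) ^ p ^ k \<simeq> x ^ p ^ k - y ^ p ^ k" for k
  proof (induction k)
    case (Suc k)
    have *: "(u - v) ^ p \<simeq> u ^ p - v ^ p" if "u \<in> V" "v \<in> V" for u v
    proof -
      have "(u - v + v) ^ p - ((u - v) ^ p + v ^ p) \<in> pV" using that by (intro freshman_p closed)
      then show ?thesis using pV_subset_M M_uminus by (fastforce simp: req_def algebra_simps)
    qed
    have "((x - y) ^ p ^ k) ^ p \<simeq> (x ^ p ^ k - y ^ p ^ k) ^ p"
      using Suc assms by (intro req_power closed)
    also have "\<dots> \<simeq> (x ^ p ^ k) ^ p - (y ^ p ^ k) ^ p" using assms by (intro * closed)
    finally show ?case by (simp add: power_mult[symmetric] mult.commute)
  qed simp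
  then have "(x - y) ^ p ^ k \<in> M"
    using assms(1) M_add[of "(x - y) ^ p ^ k - (x ^ p ^ k - y ^ p ^ k)" "x ^ p ^ k - y ^ p ^ k"]
    by (simp add: req_def)
  then show ?thesis unfolding req_def by (rule M_power_D)
qed

end

section \<open>Residues of conjugates\<close>

text \<open>\<open>th\<close> lists the conjugates of the generator \<open>\<theta>\<close>, and
  \<open>R\<close> stands for the integral elements of the field, each seen as a function of the
  root. \<open>R_generated\<close> expresses that they are integer polynomials in
  \<open>\<theta>\<close> modulo \<open>p\<close>, with one \<open>f\<close> serving all roots at
  once; this is what relates residues at different roots.\<close>

locale conjugate_system = residue_char V p
  for V :: "complex set" and p :: nat +
  fixes B :: "complex set" and th :: "complex \<Rightarrow> complex" and G :: "int poly"
    and R :: "(complex \<Rightarrow> complex) set"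
  assumes finite_B: "finite B"
    and G: "map_poly of_int G = (\<Prod>b\<in>B. [:- th b, 1:])"
    and th_closed: "b \<in> B \<Longrightarrow> th b \<in> V"
    and R_closed: "r \<in> R \<Longrightarrow> b \<in> B \<Longrightarrow> r b \<in> V"
    and R_generated: "r \<in> R \<Longrightarrow>
      \<exists>f. \<exists>s\<in>R. \<forall>b\<in>B. r b = poly (map_poly of_int f) (th b) + of_nat p * s b"
begin

lemma R_poly:
  assumes "r \<in> R"
  shows "\<exists>f. \<forall>b\<in>B. r b - poly (map_poly of_int f) (th b) \<in> pV"
proof -
  obtain f s where s: "s \<in> R" and f: "\<forall>b\<in>B. r b = poly (map_poly of_int f) (th b) + of_nat p * s b"
    using R_generated[OF assms] by blast
  have "r b - poly (map_poly of_int f) (th b) \<in> pV" if "b \<in> B" for b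
    using f that R_closed[OF s that] by (auto simp: pV_def)
  then show ?thesis by blast
qed

lemma pV_req: "x - y \<in> pV \<Longrightarrow> x \<simeq> y"
  by (simp add: req_def pV_subset_M)

lemma th_separates:
  assumes "b \<in> B" "c \<in> B" "r \<in> R" "th b \<simeq> th c"
  shows "r b \<simeq> r c"
proof -
  obtain f where f: "\<And>b. b \<in> B \<Longrightarrow> r b \<simeq> poly (map_poly of_int f) (th b)"
    using R_poly[OF assms(3)] pV_req by metis
  have "r b \<simeq> poly (map_poly of_int f) (th b)" using f assms by blast
  also have "\<dots> \<simeq> poly (map_poly of_int f) (th c)"
    using assms th_closed by (intro req_poly_of_int)
  also have "\<dots> \<simeq> r c" using f assms req_sym by blast
  finally show ?thesis .
qed

text \<open>Modulo \<open>p\<close>, \<open>r\<close> is an integer polynomial in \<open>th\<close>,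
  and such polynomials commute with Frobenius. A Frobenius step seen on \<open>th\<close> is thus
  seen on every integral element.\<close>

lemma frobenius_conjugate:
  assumes "b \<in> B" "c \<in> B" "r \<in> R" "th b ^ p ^ k \<simeq> th c"
  shows "r b ^ p ^ k \<simeq> r c"
proof -
  obtain f where f: "\<And>b. b \<in> B \<Longrightarrow> r b \<simeq> poly (map_poly of_int f) (th b)"
    using R_poly[OF assms(3)] pV_req by metis
  have "r b ^ p ^ k \<simeq> poly (map_poly of_int f) (th b) ^ p ^ k"
    using f assms R_closed by (intro req_power) auto
  also have "\<dots> \<simeq> poly (map_poly of_int f) (th b ^ p ^ k)"
    by (rule req_sym[OF pV_req[OF poly_of_int_frobenius[OF th_closed[OF assms(1)]]]])
  also have "\<dots> \<simeq> poly (map_poly of_int f) (th c)"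
    using assms th_closed by (intro req_poly_of_int closed) auto
  also have "\<dots> \<simeq> r c" using f assms req_sym by blast
  finally show ?thesis .
qed

text \<open>The product is the value of the integer polynomial \<open>G\<close> at a Frobenius power
  of its root \<open>th b\<close>, hence a power of 0 modulo \<open>p\<close>.\<close>

lemma prod_diff_power_in_pV:
  assumes "b \<in> B"
  shows "(\<Prod>c\<in>B. th b ^ p ^ k - th c) \<in> pV"
proof -
  have G': "poly (map_poly of_int G) x = (\<Prod>c\<in>B. x - th c)" for x
    by (simp add: G poly_prod)
  have "poly (map_poly of_int G) (th b) = 0"
    using assms finite_B by (auto simp: G')
  then show ?thesis
    using poly_of_int_frobenius[OF th_closed[OF assms], of G k] prime_gt_0_nat[OF prime_p]
    by (simp add: G' zero_power)
qed

lemma ex_frobenius_conjugate: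
  assumes "b \<in> B"
  shows "\<exists>c\<in>B. th b ^ p ^ k \<simeq> th c"
  using prod_diff_power_in_pV[OF assms, of k] not_M_prod[of B "\<lambda>c. th b ^ p ^ k - th c"]
  by (auto simp: req_def dest: pV_subset_M)

lemma poly_of_int_pV:
  assumes "x - y \<in> pV" "y \<in> V"
  shows "poly (map_poly of_int f) x - poly (map_poly of_int f) y \<in> pV"
proof (induction f)
  case (pCons a f)
  have x: "x \<in> V"
    using assms pV_subset_M M_subset add_closed[of "x - y" y] by auto
  have "x * (poly (map_poly of_int f) x - poly (map_poly of_int f) y) +
      (x - y) * poly (map_poly of_int f) y \<in> pV"
    using pCons.IH assms x pV_mult poly_of_int_closed by (intro pV_add) auto
  then show ?case by (simp add: map_poly_pCons algebra_simps)
qed (simp add: pV_0)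

text \<open>If \<open>th b\<close> is a simple root of the reduction of \<open>G\<close>, then \<open>th b\<close> is congruent modulo \<open>p\<close>, and not
  only modulo the maximal ideal, to one of its proper Frobenius powers. Evaluating \<open>f(th b)\<close> at
  that power shows that an element of positive valuation has at least the valuation of \<open>p\<close>.\<close>

lemma simple_root_unramified:
  assumes b: "b \<in> B" and k: "k > 0" "th b ^ p ^ k \<simeq> th b"
    and simple: "\<And>c. c \<in> B \<Longrightarrow> th c \<simeq> th b \<Longrightarrow> c = b"
    and r: "r \<in> R" "r b ^ 2 \<in> pV"
  shows "r b \<in> pV"
proof -
  define N where "N = p ^ k"
  have N: "N \<ge> 2"
    using prime_ge_2_nat[OF prime_p] k(1) self_le_power[of p k] by (simp add: N_def)
  obtain f where f: "r b - poly (map_poly of_int f) (th b) \<in> pV"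
    using R_poly[OF r(1)] b by blast
  define y where "y = poly (map_poly of_int f) (th b)"
  have thb: "th b \<in> V" using b th_closed by blast
  have y: "y \<in> V" using thb by (simp add: y_def poly_of_int_closed)
  have rb: "r b \<in> V" using R_closed r b by blast
  have "y ^ 2 = r b ^ 2 - (r b - y) * (r b + y)"
    by (simp add: power2_eq_square algebra_simps)
  also have "\<dots> \<in> pV"
    by (rule pV_diff[OF r(2) pV_mult(1)[OF f[folded y_def] add_closed[OF rb y]]])
  finally have "y ^ 2 * y ^ (N - 2) \<in> pV" using y by (intro pV_mult closed)
  then have yN: "y ^ N \<in> pV" using N by (metis le_add_diff_inverse power_add)
  have "(th b ^ N - th b) * (\<Prod>c\<in>B - {b}. th b ^ N - th c) \<in> pV"
    using prod_diff_power_in_pV[OF b, of k] b finite_B by (simp add: N_def prod.remove)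
  \<comment> \<open>By simplicity only the factor of \<open>b\<close> itself lies in
    \<open>M\<close>, so the whole divisibility by \<open>p\<close> falls on
    \<open>th b ^ N - th b\<close>.\<close>
  moreover have "(\<Prod>c\<in>B - {b}. th b ^ N - th c) \<notin> M"
  proof (rule not_M_prod)
    fix c assume c: "c \<in> B - {b}"
    show "th b ^ N - th c \<notin> M"
    proof
      assume "th b ^ N - th c \<in> M"
      then have "th b ^ N \<simeq> th c" by (simp add: req_def)
      then have "th c \<simeq> th b" using k(2) req_sym req_trans unfolding N_def by blast
      then show False using simple c by blast
    qed
  qed
  ultimately have "th b ^ N - th b \<in> pV"
    using pV_cancel by (metis mult.commute)
  then have "poly (map_poly of_int f) (th b ^ N) - y \<in> pV"
    unfolding y_def using thb by (intro poly_of_int_pV)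
  moreover have "poly (map_poly of_int f) (th b ^ N) - y ^ N \<in> pV"
    unfolding y_def N_def using thb by (intro poly_of_int_frobenius)
  ultimately have "y \<in> pV"
    using yN pV_diff[of "poly (map_poly of_int f) (th b ^ N)" "poly (map_poly of_int f) (th b ^ N) - y"]
      pV_add[of "poly (map_poly of_int f) (th b ^ N) - y ^ N" "y ^ N"] by simp
  then show ?thesis using f pV_add[of "r b - y" y] by (simp add: y_def)
qed

text \<open>Frobenius fixes the values of \<open>I\<close> at \<open>b\<close>, so it carries the
  residues of \<open>th\<close> on the class \<open>{b, c}\<close> into those of the class. A swap
  of two distinct residues would make \<open>th b\<close> a simple root, which the ramified element
  rules out. The case \<open>c = b\<close> is a class with one root.\<close>

lemma frobenius_fixed_of_isolated:
  assumes b: "b \<in> B" and c: "c \<in> B" and k: "k > 0"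
    and fixed: "\<And>r. r \<in> I \<Longrightarrow> r \<in> R \<and> r b ^ p ^ k \<simeq> r b \<and> r c \<simeq> r b"
    and isolated: "\<And>d. d \<in> B \<Longrightarrow> (\<And>r. r \<in> I \<Longrightarrow> r d \<simeq> r b) \<Longrightarrow> d = b \<or> d = c"
    and ramified: "c = b \<or> (\<exists>r\<in>R. r b ^ 2 \<in> pV \<and> r b \<notin> pV)"
  shows "th b ^ p ^ k \<simeq> th b"
proof -
  have step: "d' = b \<or> d' = c" if d: "d = b \<or> d = c" "d' \<in> B" "th d ^ p ^ k \<simeq> th d'" for d d'
  proof (rule isolated[OF d(2)])
    fix r assume r: "r \<in> I"
    have dB: "d \<in> B" and rd: "r d \<simeq> r b" using d b c fixed[OF r] by auto
    have "r d' \<simeq> r d ^ p ^ k"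
      using frobenius_conjugate[OF dB d(2) _ d(3)] fixed[OF r] req_sym by blast
    also have "\<dots> \<simeq> r b ^ p ^ k"
      using rd R_closed dB fixed[OF r] by (intro req_power) auto
    also have "\<dots> \<simeq> r b" using fixed[OF r] by blast
    finally show "r d' \<simeq> r b" .
  qed
  obtain d where d: "d \<in> B" "th b ^ p ^ k \<simeq> th d" using ex_frobenius_conjugate[OF b] by blast
  show ?thesis
  proof (cases "d = b")
    case True
    then show ?thesis using d(2) by simp
  next
    case False
    then have dc: "d = c" "c \<noteq> b" using step[OF _ d(1), of b] d by auto
    obtain d' where d': "d' \<in> B" "th c ^ p ^ k \<simeq> th d'" using ex_frobenius_conjugate[OF c] by blast
    have thV: "th b \<in> V" "th c \<in> V" using b c th_closed by auto
    consider "d' = b" | "d' = c" using step[OF _ d'(1), of c] d' by auto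
    then have "th b \<simeq> th c"
    proof cases
      case 1
      have "th b ^ p ^ (k + k) = (th b ^ p ^ k) ^ p ^ k"
        by (simp add: power_add power_mult)
      also have "\<dots> \<simeq> th c ^ p ^ k" using d dc thV by (intro req_power closed) auto
      also have "\<dots> \<simeq> th b" using d' 1 by simp
      finally have "th b ^ p ^ (k + k) \<simeq> th b" .
      moreover obtain r where "r \<in> R" "r b ^ 2 \<in> pV" "r b \<notin> pV" using ramified dc by blast
      \<comment> \<open>Contrapositive use: an \<open>r\<close> whose square is divisible by
        \<open>p\<close> without \<open>r\<close> being so shows that \<open>th b\<close> is not a
        simple root.\<close>
      ultimately obtain e where e: "e \<in> B" "th e \<simeq> th b" "e \<noteq> b"
        using simple_root_unramified[OF b, of "k + k" r] k by auto
      have "e = b \<or> e = c"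
        using th_separates[OF e(1) b _ e(2)] fixed by (intro isolated e) auto
      with e show ?thesis using req_sym by blast
    next
      case 2
      \<comment> \<open>Both residues are sent to that of \<open>th c\<close>, and Frobenius is
        injective.\<close>
      have "th b ^ p ^ k \<simeq> th c ^ p ^ k" using d dc d' 2 req_sym req_trans by blast
      then show ?thesis using thV by (rule req_of_power_req)
    qed
    then show ?thesis using d dc req_sym req_trans by blast
  qed
qed

text \<open>Separated roots have distinct residues of \<open>th\<close>, all of them roots of the
  reduction of \<open>f\<close>. The final contradictions are instances of this count.\<close>

lemma card_separated_le_degree:
  assumes J: "finite J" "\<And>j. j \<in> J \<Longrightarrow> \<beta> j \<in> B"
    and sep: "\<And>i j. i \<in> J \<Longrightarrow> j \<in> J \<Longrightarrow> i \<noteq> j \<Longrightarrow> \<exists>r\<in>R. \<not> r (\<beta> i) \<simeq> r (\<beta> j)"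
    and f: "lead_coeff f = 1" "\<And>i. coeff f i \<in> V" "\<And>j. j \<in> J \<Longrightarrow> poly f (th (\<beta> j)) \<in> M"
  shows "card J \<le> degree f"
proof -
  have incong: "i = j" if "i \<in> J" "j \<in> J" "th (\<beta> i) \<simeq> th (\<beta> j)" for i j
    using sep[of i j] th_separates[of "\<beta> i" "\<beta> j"] that J by blast
  then have incong': "x = y" if "x \<in> (\<lambda>j. th (\<beta> j)) ` J" "y \<in> (\<lambda>j. th (\<beta> j)) ` J" "x \<simeq> y" for x y
    using that by blast
  have "inj_on (\<lambda>j. th (\<beta> j)) J"
    using incong by (intro inj_onI) auto
  then have "card J = card ((\<lambda>j. th (\<beta> j)) ` J)"
    by (simp add: card_image)
  also have "\<dots> \<le> degree f"
    using J f th_closed by (intro card_incongruent_roots_le_degree[OF _ _ incong']) auto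
  finally show ?thesis .
qed

end

text \<open>Translation by \<open>x\<close> permutes the cosets. Summing
  \<open>x + rep C - rep (s C)\<close>, each in \<open>H\<close>, over all cosets leaves the index
  times \<open>x\<close>.\<close>

lemma of_nat_add_index_mult:
  fixes G H :: "'a::comm_ring_1 set"
  assumes H: "\<And>x y. x \<in> H \<Longrightarrow> y \<in> H \<Longrightarrow> x - y \<in> H" "H \<noteq> {}" and "H \<subseteq> G"
    and G: "\<And>x y. x \<in> G \<Longrightarrow> y \<in> G \<Longrightarrow> x - y \<in> G" and x: "x \<in> G"
  shows "of_nat (add_index G H) * x \<in> H"
proof -
  have H0: "0 \<in> H" using H by (metis all_not_in_conv diff_self)
  have Huminus: "- y \<in> H" if "y \<in> H" for y using H(1)[OF H0 that] by simp
  have Hadd: "y + z \<in> H" if "y \<in> H" "z \<in> H"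
    for y z using H(1)[OF that(1) Huminus[OF that(2)]] by simp
  have Gadd: "y + z \<in> G" if "y \<in> G" "z \<in> G" for y z
    using G[OF that(1) G[OF _ that(2), of 0]] \<open>H \<subseteq> G\<close> H0 by auto
  define Q where "Q = (\<lambda>x. (\<lambda>h. x + h) ` H) ` G"
  define rep where "rep C = (SOME y. y \<in> C)" for C :: "'a set"
  have rep: "rep C \<in> C" if "C \<in> Q" for C
    using that H0 unfolding rep_def Q_def by (intro someI_ex[of "\<lambda>y. y \<in> C"]) auto
  define s where "s C = (\<lambda>h. x + h) ` C" for C
  have s: "s C \<in> Q" if C: "C \<in> Q" for C
  proof -
    obtain y where y: "y \<in> G" "C = (\<lambda>h. y + h) ` H" using C unfolding Q_def by blast
    then have "s C = (\<lambda>h. (x + y) + h) ` H" by (simp add: s_def image_image add.assoc)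
    then show ?thesis using Gadd[OF x y(1)] by (auto simp: Q_def)
  qed
  show ?thesis
  proof (cases "finite Q")
    case True
    have "inj_on s Q" by (auto simp: inj_on_def s_def inj_image_eq_iff)
    with s True have bij: "bij_betw s Q Q"
      by (simp add: bij_betw_def endo_inj_surj image_subsetI)
    have "x + rep C - rep (s C) \<in> H" if C: "C \<in> Q" for C
    proof -
      obtain y where y: "C = (\<lambda>h. y + h) ` H" using C unfolding Q_def by blast
      obtain h where "rep C = y + h" "h \<in> H" using rep[OF C] y by auto
      moreover obtain h' where "rep (s C) = x + (y + h')" "h' \<in> H"
        using rep[OF s[OF C]] y by (auto simp: s_def)
      ultimately show ?thesis using H(1) by simp
    qed
    then have "(\<Sum>C\<in>Q. x + rep C - rep (s C)) \<in> H"
      by (induction Q rule: infinite_finite_induct) (auto intro: H0 Hadd)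
    also have "(\<Sum>C\<in>Q. x + rep C - rep (s C)) = of_nat (card Q) * x"
      using sum.reindex_bij_betw[OF bij, of rep] by (simp add: sum_subtractf sum.distrib)
    finally show ?thesis by (simp add: add_index_def Q_def)
  \<comment> \<open>For infinitely many cosets \<open>card\<close> is 0 and the claim becomes
    \<open>0 \<in> H\<close>.\<close>
  qed (simp add: add_index_def Q_def[symmetric] H0)
qed

section \<open>Transport between K and its complex conjugates through rational polynomials\<close>

definition ev :: "rat poly \<Rightarrow> 'a::field_char_0 \<Rightarrow> 'a" where
  "ev f x = poly (map_poly of_rat f) x"

lemma ev_pCons [simp]: "ev (pCons a f) x = of_rat a + x * ev f x"
  by (simp add: ev_def map_poly_pCons)

lemma ev_0 [simp]: "ev 0 x = 0"
  by (simp add: ev_def)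

lemma ev_1 [simp]: "ev 1 x = 1"
  by (simp add: one_pCons)

lemma ev_add [simp]: "ev (f + g) x = ev f x + ev g x"
  by (induction f g rule: poly_induct2) (simp_all add: of_rat_add algebra_simps)

lemma ev_diff [simp]: "ev (f - g) x = ev f x - ev g x"
  using ev_add[of g "f - g" x] by simp

lemma ev_smult [simp]: "ev (smult c f) x = of_rat c * ev f x"
  by (induction f) (simp_all add: of_rat_mult algebra_simps)

lemma ev_mult [simp]: "ev (f * g) x = ev f x * ev g x"
  by (induction f) (simp_all add: algebra_simps)

lemma ev_power [simp]: "ev (f ^ n) x = ev f x ^ n"
  by (induction n) simp_all

lemma ev_pcompose: "ev (pcompose f g) x = ev f (ev g x)"
  by (induction f) (simp_all add: pcompose_pCons)

lemma ev_map_poly_of_int: "ev (map_poly of_int f) x = poly (map_poly of_int f) x"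
  by (induction f) (simp_all add: map_poly_pCons)

lemma irreducible_bezout:
  fixes F f :: "rat poly"
  assumes "irreducible F" "\<not> F dvd f"
  shows "\<exists>u v. u * F + v * f = 1"
proof -
  have "prime_elem F" using assms(1) by (rule irreducible_imp_prime_elem)
  then have "coprime F f" using assms(2) by (rule prime_elem_imp_coprime)
  then have "gcd F f = 1" by simp
  then show ?thesis using bezout_coefficients_fst_snd[of F f] by auto
qed

lemma irreducible_dvd_iff_ev:
  fixes x :: "'a::field_char_0"
  assumes "irreducible F" "ev F x = 0"
  shows "ev f x = 0 \<longleftrightarrow> F dvd f"
proof
  assume f: "ev f x = 0"
  show "F dvd f"
  proof (rule ccontr)
    assume "\<not> F dvd f"
    then obtain u v where "u * F + v * f = 1"
      using irreducible_bezout[OF assms(1)] by blast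
    then have "ev (u * F + v * f) x = 1" by simp
    then show False using f assms by simp
  qed
qed (use assms in \<open>auto elim!: dvdE\<close>)

text \<open>This makes the embeddings well defined: a relation at one root of an irreducible
  \<open>F\<close> is a multiple of \<open>F\<close> and holds at every root.\<close>

lemma ev_transfer:
  assumes "irreducible F" "ev F x = 0" "ev F y = 0" "ev f x = ev g x"
  shows "ev f y = ev g y"
  using irreducible_dvd_iff_ev[OF assms(1,2), of "f - g"] irreducible_dvd_iff_ev[OF assms(1,3), of "f - g"]
    assms(4) by simp

lemma is_subfield_range_ev:
  assumes "irreducible F" "ev F x = 0"
  shows "is_subfield (range (\<lambda>f. ev f x))"
  unfolding is_subfield_def
proof (intro conjI ballI)
  let ?S = "range (\<lambda>f. ev f x)"
  show "0 \<in> ?S" "1 \<in> ?S" by (metis ev_0 rangeI, metis ev_1 rangeI)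
  fix y assume "y \<in> ?S"
  then obtain f where f: "y = ev f x" by auto
  show "- y \<in> ?S" using f ev_diff[of 0 f x] by (metis diff_0 ev_0 rangeI)
  show "inverse y \<in> ?S"
  proof (cases "y = 0")
    case True
    then show ?thesis by (metis inverse_zero ev_0 rangeI)
  next
    case False
    then have "\<not> F dvd f" using irreducible_dvd_iff_ev[OF assms] f by auto
    then obtain u v where "u * F + v * f = 1"
      using irreducible_bezout[OF assms(1)] by blast
    then have "ev (u * F + v * f) x = 1" by simp
    then have "inverse y = ev v x" using assms f by (intro inverse_unique) (simp add: mult.commute)
    then show ?thesis by auto
  qed
  fix z assume "z \<in> ?S"
  then obtain g where g: "z = ev g x" by auto
  show "y + z \<in> ?S" "y * z \<in> ?S"
    using f g by (metis ev_add rangeI, metis ev_mult rangeI)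
qed

lemma is_subfield_ev_closed:
  fixes S :: "'a::field_char_0 set"
  assumes "is_subfield S" "x \<in> S"
  shows "ev f x \<in> S"
proof -
  have S: "0 \<in> S" "1 \<in> S" "\<And>x y. x \<in> S \<Longrightarrow> y \<in> S \<Longrightarrow> x + y \<in> S" "\<And>x y. x \<in> S \<Longrightarrow> y \<in> S \<Longrightarrow> x * y \<in> S"
    "\<And>x. x \<in> S \<Longrightarrow> - x \<in> S" "\<And>x. x \<in> S \<Longrightarrow> inverse x \<in> S"
    using assms(1) by (auto simp: is_subfield_def)
  have nat: "of_nat n \<in> S" for n by (induction n) (auto intro: S)
  have int: "of_int n \<in> S" for n by (cases n) (auto intro: S(5) nat simp del: of_nat_Suc)
  have rat: "of_rat q \<in> S" for q
    by (cases q) (auto simp: of_rat_rat divide_inverse intro!: S int)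
  show ?thesis by (induction f) (auto intro: S rat assms)
qed

lemma rat_adjoin_eq:
  assumes "irreducible F" "ev F x = 0"
  shows "rat_adjoin x = range (\<lambda>f. ev f x)"
proof
  have "x = ev [:0, 1:] x" by simp
  then show "rat_adjoin x \<subseteq> range (\<lambda>f. ev f x)"
    unfolding rat_adjoin_def using is_subfield_range_ev[OF assms] by blast
  show "range (\<lambda>f. ev f x) \<subseteq> rat_adjoin x"
    unfolding rat_adjoin_def using is_subfield_ev_closed by blast
qed

text \<open>Take an annihilating polynomial of least degree: a factor vanishing at \<open>x\<close>
  already has the full degree, so its cofactor is constant.\<close>

lemma ex_irreducible_poly:
  fixes x :: "'a::field_char_0"
  assumes "algebraic_int x"
  obtains F where "irreducible F" "lead_coeff F = 1" "ev F x = 0"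
proof -
  obtain P :: "int poly" where P: "poly (map_poly of_int P) x = 0" "lead_coeff P = 1"
    using assms by (auto simp: algebraic_int_altdef_ipoly)
  define Q where "Q f \<longleftrightarrow> f \<noteq> 0 \<and> ev f x = 0" for f
  have "coeff (map_poly rat_of_int P) (degree P) = 1" using P(2) by (simp add: coeff_map_poly)
  then have "Q (map_poly of_int P)"
    using P by (auto simp: Q_def ev_map_poly_of_int)
  then obtain f where f: "Q f" and min: "\<And>g. Q g \<Longrightarrow> degree f \<le> degree g"
    using ex_has_least_nat[of Q _ degree] by blast
  have unit: "is_unit g" if "f = h * g" "ev h x = 0" for g h
  proof -
    have "h \<noteq> 0" "g \<noteq> 0" using f that by (auto simp: Q_def)
    then have "degree f \<le> degree h" using min that by (auto simp: Q_def)
    then have "degree g = 0" using that \<open>h \<noteq> 0\<close> \<open>g \<noteq> 0\<close> by (simp add: degree_mult_eq)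
    then show ?thesis using \<open>g \<noteq> 0\<close> by (simp add: is_unit_iff_degree)
  qed
  have irr: "irreducible f"
  proof (rule irreducibleI)
    show "f \<noteq> 0" using f by (simp add: Q_def)
    show "\<not> is_unit f"
    proof
      assume "is_unit f"
      then obtain g where "f * g = 1" by (metis dvdE)
      then have "ev (f * g) x = 1" by simp
      then show False using f by (simp add: Q_def)
    qed
    fix a b assume ab: "f = a * b"
    then have "ev a x = 0 \<or> ev b x = 0" using f by (simp add: Q_def)
    then show "a dvd 1 \<or> b dvd 1" using unit[of a b] unit[of b a] ab by (auto simp: mult.commute)
  qed
  let ?c = "inverse (lead_coeff f)"
  have c: "?c \<noteq> 0" using f by (auto simp: Q_def)
  have "irreducible (smult ?c f)"
    using irr irreducible_mult_unit_left[of "[:?c:]" f] c by (simp add: is_unit_const_poly_iff dvd_field_iff)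
  moreover have "lead_coeff (smult ?c f) = 1" using c by simp
  moreover have "ev (smult ?c f) x = 0" using f by (simp add: Q_def)
  ultimately show thesis by (rule that)
qed

text \<open>The derivative is nonzero of smaller degree, so the irreducible \<open>F\<close> does
  not divide it and shares no root with it; all roots are simple.\<close>

lemma map_poly_of_rat_roots:
  assumes irr: "irreducible F" and lc: "lead_coeff F = 1"
  shows "finite {z. ev F z = (0::complex)}"
    and "map_poly of_rat F = (\<Prod>z | ev F z = (0::complex). [:- z, 1:])"
proof -
  let ?F = "map_poly of_rat F :: complex poly"
  have nz: "F \<noteq> 0" using irr by auto
  have deg: "degree ?F = degree F" by (intro degree_map_poly) auto
  have lcF: "lead_coeff ?F = 1" using lc deg by (simp add: coeff_map_poly)
  then have "?F \<noteq> 0" by auto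
  then show "finite {z. ev F z = (0::complex)}" by (simp add: ev_def poly_roots_finite)
  have "degree F > 0"
  proof (rule ccontr)
    assume "\<not> degree F > 0"
    then have "is_unit F" using nz by (simp add: is_unit_iff_degree)
    then show False using irr by (simp add: irreducible_def)
  qed
  then have dF: "pderiv F \<noteq> 0" "degree (pderiv F) < degree F"
    by (auto simp: pderiv_eq_0_iff degree_pderiv)
  then have ndvd: "\<not> F dvd pderiv F" using dvd_imp_degree_le by fastforce
  have pd: "pderiv ?F = map_poly of_rat (pderiv F)"
    by (rule poly_eqI) (simp add: coeff_pderiv coeff_map_poly of_rat_mult of_rat_add)
  have "rsquarefree ?F"
    unfolding rsquarefree_roots pd using irreducible_dvd_iff_ev[OF irr, folded ev_def] ndvd
    unfolding ev_def by blast
  from complex_poly_decompose_rsquarefree[OF this]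
  show "?F = (\<Prod>z | ev F z = (0::complex). [:- z, 1:])"
    by (simp add: lcF ev_def)
qed

lemma algebraic_int_transfer:
  fixes x :: "'a::field_char_0" and y :: "'b::field_char_0"
  assumes F: "irreducible F" "ev F x = 0" "ev F y = 0" and f: "algebraic_int (ev f x)"
  shows "algebraic_int (ev f y)"
proof -
  obtain P :: "int poly" where P: "poly (map_poly of_int P) (ev f x) = 0" "lead_coeff P = 1"
    using f by (auto simp: algebraic_int_altdef_ipoly)
  let ?Q = "pcompose (map_poly of_int P) f"
  have "ev ?Q x = ev 0 x" using P by (simp add: ev_pcompose ev_map_poly_of_int)
  then have "ev ?Q y = 0" using ev_transfer[OF F, of ?Q 0] by simp
  then show ?thesis
    using P(2) by (auto simp: algebraic_int_altdef_ipoly ev_pcompose ev_map_poly_of_int)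
qed

text \<open>The coefficients are rational, and integral as polynomial expressions in the roots,
  hence integers.\<close>

lemma int_poly_of_integral_roots:
  assumes "map_poly of_rat F = (\<Prod>z\<in>Z. [:- z, 1 :: complex:])" "\<And>z. z \<in> Z \<Longrightarrow> algebraic_int z"
  obtains G :: "int poly" where "F = map_poly of_int G"
proof -
  interpret subring "{x :: complex. algebraic_int x}" by (rule subring_algebraic_int)
  have "of_rat (coeff F i) \<in> (\<int> :: complex set)" for i
  proof (rule rational_algebraic_int_is_int)
    have "coeff (\<Prod>z\<in>Z. [:- z, 1 :: complex:]) i \<in> {x. algebraic_int x}"
      using assms(2) by (intro coeff_prod_closed) (auto simp: coeff_pCons split: nat.splits)
    moreover have "of_rat (coeff F i) = coeff (\<Prod>z\<in>Z. [:- z, 1 :: complex:]) i"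
      by (simp flip: assms(1) add: coeff_map_poly)
    ultimately show "algebraic_int (of_rat (coeff F i) :: complex)" by simp
  qed simp
  then have "coeff F i \<in> \<int>" for i
    by (metis Ints_cases Ints_of_int of_rat_eq_iff of_rat_of_int_eq)
  then have "F = map_poly of_int (map_poly floor F)"
    by (intro poly_eqI) (auto simp: coeff_map_poly elim!: Ints_cases)
  then show thesis by (rule that)
qed

text \<open>With \<open>n\<close> the index, \<open>n x\<close> is an integer polynomial in
  \<open>\<theta>\<close>, and \<open>u p + v n = 1\<close> splits \<open>x\<close> as
  \<open>v (n x) + p (u x)\<close>. An infinite index is encoded as 0 and so counts as divisible by
  \<open>p\<close>.\<close>

lemma in_int_adjoin_plus_multiple:
  fixes K :: "'a::field_char_0 set"
  assumes K: "is_subfield K" and p: "prime p" "\<not> p dvd add_index (ring_of_integers K) (int_adjoin \<theta>)"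
    and \<theta>: "\<theta> \<in> ring_of_integers K" and x: "x \<in> ring_of_integers K"
  obtains f y where "y \<in> ring_of_integers K" "x = poly (map_poly of_int f) \<theta> + of_nat p * y"
proof -
  let ?O = "ring_of_integers K" and ?H = "int_adjoin \<theta>"
  define n where "n = add_index ?O ?H"
  interpret A: subring "{x :: 'a. algebraic_int x}" by (rule subring_algebraic_int)
  have K_diff: "a - b \<in> K" if "a \<in> K" "b \<in> K" for a b
    using K that unfolding is_subfield_def by (metis add_uminus_conv_diff)
  interpret O: subring ?O
    using A.one_closed A.diff_closed A.mult_closed K K_diff
    by unfold_locales (auto simp: ring_of_integers_def is_subfield_def)
  have diff: "y - z \<in> ?H" if yz: "y \<in> ?H" "z \<in> ?H" for y z
  proof -
    obtain f g where "y = poly (map_poly of_int f) \<theta>" "z = poly (map_poly of_int g) \<theta>"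
      using yz unfolding int_adjoin_def by blast
    then have "y - z = ev (map_poly of_int f - map_poly of_int g) \<theta>"
      by (simp add: ev_map_poly_of_int)
    also have "map_poly rat_of_int f - map_poly of_int g = map_poly of_int (f - g)"
      by (rule poly_eqI) (simp add: coeff_map_poly)
    finally show ?thesis by (auto simp: int_adjoin_def ev_map_poly_of_int)
  qed
  have "of_nat n * x \<in> ?H"
    unfolding n_def
  proof (rule of_nat_add_index_mult[OF diff _ _ O.diff_closed x])
    show "?H \<noteq> {}" by (simp add: int_adjoin_def)
    show "?H \<subseteq> ?O" using O.poly_of_int_closed[OF \<theta>] by (auto simp: int_adjoin_def)
  qed
  then obtain f where f: "of_nat n * x = poly (map_poly of_int f) \<theta>"
    by (auto simp: int_adjoin_def)
  have "coprime (int p) (int n)"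
    using p by (intro prime_imp_coprime) (auto simp: n_def)
  then obtain u v where uv: "u * int p + v * int n = 1"
    using bezout_int[of "int p" "int n"] by auto
  have "of_int (u * int p + v * int n) * x = x" by (simp add: uv)
  then have "x = of_int v * (of_nat n * x) + of_nat p * (of_int u * x)"
    by (simp add: algebra_simps)
  also have "of_int v * (of_nat n * x) = poly (map_poly of_int (smult v f)) \<theta>"
    unfolding f by (simp flip: ev_map_poly_of_int add: map_poly_smult)
  finally show thesis
    using that O.mult_closed[OF O.of_int_closed x] by blast
qed

text \<open>With \<open>\<theta> = h(\<alpha>)\<close> and \<open>\<alpha> = k(\<theta>)\<close>,
  the map \<open>h\<close> carries the roots of \<open>F\<close> bijectively onto those of the
  minimal polynomial of \<open>\<theta>\<close>, with inverse \<open>k\<close>. That polynomial has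
  integer coefficients and provides \<open>G\<close>.\<close>

theorem conjugate_system_exists:
  fixes \<alpha> \<theta> :: "'a::field_char_0"
  assumes F: "irreducible F" "ev F \<alpha> = 0" and K: "K = rat_adjoin \<alpha>"
    and \<theta>: "\<theta> \<in> ring_of_integers K" "rat_adjoin \<theta> = K"
    and V: "residue_char V p" and index: "\<not> p dvd add_index (ring_of_integers K) (int_adjoin \<theta>)"
    and B: "finite B" "B = {z. ev F z = 0}"
  obtains th G where "conjugate_system V p B th G {\<lambda>b. ev f b | f. algebraic_int (ev f \<alpha>)}"
proof -
  interpret residue_char V p by fact
  have K_eq: "K = range (\<lambda>f. ev f \<alpha>)" using rat_adjoin_eq[OF F] K by simp
  have sub: "is_subfield K" using is_subfield_range_ev[OF F] K_eq by simp
  have \<theta>_int: "algebraic_int \<theta>" and "\<theta> \<in> K" using \<theta>(1) by (auto simp: ring_of_integers_def)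
  obtain h where h: "\<theta> = ev h \<alpha>" using \<open>\<theta> \<in> K\<close> K_eq by auto
  obtain \<mu> where \<mu>: "irreducible \<mu>" "lead_coeff \<mu> = 1" "ev \<mu> \<theta> = 0"
    using ex_irreducible_poly[OF \<theta>_int] .
  have "\<alpha> \<in> K" unfolding K_eq by (rule image_eqI[of _ _ "[:0, 1:]"]) auto
  then obtain k where k: "\<alpha> = ev k \<theta>" using rat_adjoin_eq[OF \<mu>(1,3)] \<theta>(2) by auto
  define th where "th = (\<lambda>b::complex. ev h b)"
  have BD: "ev F b = 0" if "b \<in> B" for b using that B by simp
  have k_th: "ev k (th b) = b" if "b \<in> B" for b
  proof -
    have "ev (pcompose k h) \<alpha> = ev [:0, 1:] \<alpha>" by (simp flip: h k add: ev_pcompose)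
    then have "ev (pcompose k h) b = ev [:0, 1:] b" by (rule ev_transfer[OF F BD[OF that]])
    then show ?thesis by (simp add: ev_pcompose th_def)
  qed
  have roots: "{z. ev \<mu> z = 0} = th ` B"
  proof (intro equalityI subsetI)
    fix z :: complex assume "z \<in> {z. ev \<mu> z = 0}"
    then have z: "ev \<mu> z = 0" by simp
    have "ev (pcompose F k) z = ev 0 z"
      by (rule ev_transfer[OF \<mu>(1,3) z]) (use F(2) in \<open>simp flip: k add: ev_pcompose\<close>)
    moreover have "ev (pcompose h k) z = ev [:0, 1:] z"
      by (rule ev_transfer[OF \<mu>(1,3) z]) (simp flip: h k add: ev_pcompose)
    ultimately have "ev k z \<in> B" "z = th (ev k z)" by (simp_all add: B ev_pcompose th_def)
    then show "z \<in> th ` B" by blast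
  next
    fix z assume "z \<in> th ` B"
    then obtain b where b: "ev F b = 0" "z = ev h b" by (auto simp: B th_def)
    have "ev (pcompose \<mu> h) b = ev 0 b"
      by (rule ev_transfer[OF F b(1)]) (use \<mu>(3) in \<open>simp flip: h add: ev_pcompose\<close>)
    then show "z \<in> {z. ev \<mu> z = 0}" using b by (simp add: ev_pcompose)
  qed
  have int: "algebraic_int (ev f b)" if "algebraic_int (ev f \<alpha>)" "b \<in> B" for f b
    using algebraic_int_transfer[OF F _ that(1), of b] that(2) B by simp
  have th_int: "algebraic_int (th b)" if "b \<in> B" for b
    unfolding th_def using int[OF _ that, of h] \<theta>_int by (simp flip: h)
  obtain G where G: "\<mu> = map_poly of_int G"
    using int_poly_of_integral_roots[OF map_poly_of_rat_roots(2)[OF \<mu>(1,2)]] roots th_int by auto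
  have "map_poly of_int G = (map_poly of_rat \<mu> :: complex poly)"
    by (rule poly_eqI) (simp add: G coeff_map_poly)
  also have "\<dots> = (\<Prod>z\<in>th ` B. [:- z, 1:])"
    using map_poly_of_rat_roots(2)[OF \<mu>(1,2)] roots by simp
  also have "\<dots> = (\<Prod>b\<in>B. [:- th b, 1:])"
    using k_th by (subst prod.reindex) (auto intro: inj_on_inverseI)
  finally have G': "map_poly of_int G = (\<Prod>b\<in>B. [:- th b, 1:])" .
  have "conjugate_system V p B th G {\<lambda>b. ev f b | f. algebraic_int (ev f \<alpha>)}" (is "conjugate_system _ _ _ _ _ ?R")
  proof
    show "finite B" "map_poly of_int G = (\<Prod>b\<in>B. [:- th b, 1:])" by fact+
    show "th b \<in> V" if "b \<in> B" for b using th_int[OF that] by (rule algebraic_int_closed)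
    show "r b \<in> V" if "r \<in> ?R" "b \<in> B" for r b using that int by (auto intro: algebraic_int_closed)
    show "\<exists>f. \<exists>s\<in>?R. \<forall>b\<in>B. r b = poly (map_poly of_int f) (th b) + of_nat p * s b" if r: "r \<in> ?R"
      for r
    proof -
      obtain f where f: "r = (\<lambda>b. ev f b)" "algebraic_int (ev f \<alpha>)" using r by auto
      have "ev f \<alpha> \<in> ring_of_integers K" using f by (auto simp: ring_of_integers_def K_eq)
      then obtain g y where y: "y \<in> ring_of_integers K" "ev f \<alpha> = poly (map_poly of_int g) \<theta> + of_nat p * y"
        using in_int_adjoin_plus_multiple[OF sub prime_p index \<theta>(1)] by metis
      obtain e where e: "y = ev e \<alpha>" "algebraic_int (ev e \<alpha>)"
        using y(1) by (auto simp: ring_of_integers_def K_eq)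
      have "ev f \<alpha> = ev (pcompose (map_poly of_int g) h + smult (of_nat p) e) \<alpha>"
        using y(2) by (simp flip: h e(1) add: ev_pcompose ev_map_poly_of_int)
      then have "ev f b = ev (pcompose (map_poly of_int g) h + smult (of_nat p) e) b" if "b \<in> B"
        for b
        by (rule ev_transfer[OF F BD[OF that]])
      then show ?thesis
        using f e by (auto simp: ev_pcompose ev_map_poly_of_int th_def intro!: exI[of _ g] bexI[of _ "\<lambda>b. ev e b"])
    qed
  qed
  then show thesis by (rule that)
qed

section \<open>Roots of the trinomial near a given point\<close>

lemma pcompose_monom: "pcompose (monom c n) q = smult c (q ^ n)"
  by (induction n) (simp_all add: monom_0 monom_Suc pcompose_pCons)

lemma coeff_linear_power_eq:
  fixes x y :: "'a::comm_semiring_1"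
  shows "coeff ([:x, y:] ^ n) i = of_nat (n choose i) * y ^ i * x ^ (n - i)"
proof (cases "i \<le> n")
  case False
  have "degree ([:x, y:] ^ n) \<le> n"
    using degree_power_le[of "[:x, y:]" n] by (simp split: if_splits)
  with False have "coeff ([:x, y:] ^ n) i = 0" by (intro coeff_eq_0) auto
  then show ?thesis using False by (simp add: binomial_eq_0)
qed (rule coeff_linear_poly_power)

context residue_char
begin

lemma numeral_in_M_iff: "numeral n \<in> M \<longleftrightarrow> p dvd numeral n"
  using of_int_in_M_iff[of "numeral n"] by (metis int_dvd_int_iff of_int_numeral of_nat_numeral)

lemma req_not_M: "x \<simeq> y \<Longrightarrow> y \<notin> M \<Longrightarrow> x \<notin> M"
  using req_M by blast

text \<open>The cofactor of \<open>x - y\<close> in \<open>x^n - y^n\<close> is congruent to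
  \<open>n x^(n-1)\<close>, a unit here. This keeps cube roots apart modulo 2 and fourth roots apart
  modulo 3.\<close>

lemma eq_of_power_eq:
  assumes "x ^ n = y ^ n" "x \<simeq> y" "x \<in> V" "x \<notin> M" "\<not> p dvd n"
  shows "x = y"
proof (rule ccontr)
  assume ne: "x \<noteq> y"
  have yV: "y \<in> V" using assms req_in_V by blast
  have "(x - y) * (\<Sum>i<n. y ^ (n - Suc i) * x ^ i) = 0"
    using assms(1) by (simp add: power_diff_sumr2[symmetric])
  then have "(\<Sum>i<n. y ^ (n - Suc i) * x ^ i) = 0" using ne by simp
  moreover have "(\<Sum>i<n. y ^ (n - Suc i) * x ^ i) - (\<Sum>i<n. x ^ (n - 1)) \<in> M"
    unfolding sum_subtractf[symmetric]
  proof (rule M_sum)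
    fix i assume "i \<in> {..<n}"
    then have "x ^ (n - 1) = x ^ (n - Suc i) * x ^ i" by (simp add: power_add[symmetric])
    moreover have "y ^ (n - Suc i) * x ^ i \<simeq> x ^ (n - Suc i) * x ^ i"
      using assms yV by (intro req_mult req_power closed) (auto intro: req_sym)
    ultimately show "y ^ (n - Suc i) * x ^ i - x ^ (n - 1) \<in> M" by (simp add: req_def)
  qed
  ultimately have "of_nat n * x ^ (n - 1) \<in> M" using M_uminus by fastforce
  moreover have "of_nat n \<notin> M" using of_int_in_M_iff[of "int n"] assms(5) by simp
  ultimately show False using not_M_power[OF assms(4)] M_cancel by blast
qed

end

locale trinomial_conjugates = conjugate_system +
  fixes m :: nat and a b :: int
  assumes B_poly: "(\<Prod>\<beta>\<in>B. [:- \<beta>, 1:]) = monom 1 12 + monom (of_int a) m + [:of_int b:]"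
    and id_R: "(\<lambda>\<beta>. \<beta>) \<in> R" and p_dvd_a: "int p dvd a" and p_ndvd_b: "\<not> int p dvd b"
begin

lemma B_root: "\<beta> \<in> B \<Longrightarrow> \<beta> ^ 12 + of_int a * \<beta> ^ m + of_int b = 0"
proof -
  assume "\<beta> \<in> B"
  then have "poly (\<Prod>\<beta>\<in>B. [:- \<beta>, 1:]) \<beta> = 0" using finite_B by (auto simp: poly_prod)
  then show ?thesis by (simp add: B_poly poly_monom)
qed

lemma B_V: "\<beta> \<in> B \<Longrightarrow> \<beta> \<in> V"
  using R_closed[OF id_R] .

text \<open>In the expansion at \<open>\<zeta> + \<pi> Y\<close> the term \<open>a X^m\<close> adds
  to each nonconstant coefficient a multiple of \<open>a \<pi>\<close>, negligible by assumption.
  The Newton polygon is then governed by the binomial coefficients of 12, whatever \<open>m\<close>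
  is, with first vertex at \<open>k\<close>.\<close>

lemma card_roots_near:
  assumes V: "\<zeta> \<in> V" "\<zeta> \<notin> M" "\<pi> \<in> V" and nz: "\<pi> \<noteq> 0" "c \<noteq> 0" and k: "k > 0"
    and a: "of_int a * \<pi> / c \<in> M" and F: "(\<zeta> ^ 12 + of_int a * \<zeta> ^ m + of_int b) / c \<in> M"
    and low: "\<And>i. 0 < i \<Longrightarrow> i < k \<Longrightarrow> of_nat (12 choose i) * \<pi> ^ i / c \<in> M"
    and mid: "of_nat (12 choose k) * \<pi> ^ k / c \<notin> M"
    and all: "\<And>i. i \<ge> k \<Longrightarrow> of_nat (12 choose i) * \<pi> ^ i / c \<in> V"
  shows "card {\<beta>\<in>B. (\<beta> - \<zeta>) / \<pi> \<in> M} = k"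
proof -
  define q where "q i = coeff (pcompose (\<Prod>b\<in>B. [:- b, 1:]) [:\<zeta>, \<pi>:]) i / c" for i
  have q0: "q 0 \<in> M"
    using F by (simp add: q_def B_poly pcompose_add pcompose_monom coeff_linear_power_eq)
  have q_pos: "q i - of_nat (12 choose i) * \<pi> ^ i / c * \<zeta> ^ (12 - i) \<in> M" if "i > 0" for i
  proof -
    obtain j where i: "i = Suc j" using \<open>i > 0\<close> by (cases i) auto
    have "q i = of_nat (12 choose i) * \<pi> ^ i / c * \<zeta> ^ (12 - i) +
        (of_int a * \<pi> / c) * (of_nat (m choose i) * \<pi> ^ j * \<zeta> ^ (m - i))"
      by (simp add: q_def B_poly pcompose_add pcompose_monom coeff_linear_power_eq i add_divide_distrib algebra_simps)
    moreover have "(of_int a * \<pi> / c) * (of_nat (m choose i) * \<pi> ^ j * \<zeta> ^ (m - i)) \<in> M"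
      using a V by (intro M_mult(1) closed)
    ultimately show ?thesis by simp
  qed
  have q_low: "q i \<in> M" if "i < k" for i
  proof (cases "i = 0")
    case False
    then have "of_nat (12 choose i) * \<pi> ^ i / c * \<zeta> ^ (12 - i) \<in> M"
      using low that V by (intro M_mult(1) closed) auto
    from M_add[OF q_pos[of i] this] False show ?thesis by simp
  qed (use q0 in simp)
  have q_V: "q i \<in> V" for i
  proof (cases "i < k")
    case False
    then have "of_nat (12 choose i) * \<pi> ^ i / c * \<zeta> ^ (12 - i) \<in> V"
      using all V by (intro mult_closed[OF _ power_closed]) auto
    from add_closed[OF M_subset[OF q_pos[of i]] this] False k show ?thesis by simp
  qed (use q_low M_subset in blast)
  have q_k: "q k \<notin> M"
  proof -
    have "of_nat (12 choose k) * \<pi> ^ k / c * \<zeta> ^ (12 - k) \<notin> M"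
      using mid V by (intro not_M_mult not_M_power)
    from not_M_add[OF this q_pos[OF k]] show ?thesis by simp
  qed
  show ?thesis
    using card_roots_in_ball[OF finite_B nz, of \<zeta> k] q_V q_low q_k unfolding q_def by blast
qed

lemma B_not_M: "\<beta> \<in> B \<Longrightarrow> \<beta> \<notin> M"
proof
  assume \<beta>: "\<beta> \<in> B" "\<beta> \<in> M"
  have "of_int a * \<beta> ^ m \<in> M"
    using p_dvd_a B_V[OF \<beta>(1)] by (intro M_mult(1) closed) (simp add: of_int_in_M_iff)
  moreover have "\<beta> ^ 12 \<in> M" using \<beta>(2) by (intro M_power) auto
  ultimately have "- (\<beta> ^ 12 + of_int a * \<beta> ^ m) \<in> M" by (intro M_uminus M_add)
  moreover have "- (\<beta> ^ 12 + of_int a * \<beta> ^ m) = of_int b"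
    using B_root[OF \<beta>(1)] by (metis add_eq_0_iff minus_minus)
  ultimately show False using p_ndvd_b by (simp add: of_int_in_M_iff)
qed

end

section \<open>The prime 2\<close>

locale trinomial_2 = trinomial_conjugates V 2 for V +
  assumes a8: "8 dvd a"
    and t_R: "(\<lambda>\<beta>. (\<beta> ^ 6 + 1) / 2) \<in> R" and cube_R: "(\<lambda>\<beta>. \<beta> ^ 3 - 1) \<in> R"
begin

lemma two_in_M: "2 \<in> M"
  using p_in_M by simp

lemma three_notin_M: "3 \<notin> M"
  by (simp add: numeral_in_M_iff)

lemma minus_one_closed: "- 1 \<in> V"
  by (intro closed)

lemma ii_closed: "\<i> \<in> V"
  by (rule V_power_D[of _ 2]) (auto intro: minus_one_closed)

lemma ii_notin_M: "\<i> \<notin> M"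
  by (simp add: M_def uminus_closed ii_closed)

text \<open>As \<open>(1 + \<i>)^2 = 2 \<i>\<close>, the number \<open>1 + \<i>\<close> has half the
  valuation of 2; it is the radius of the discs that hold a ramified pair.\<close>

lemma square_half_in_M_iff: "x ^ 2 / 2 \<in> M \<longleftrightarrow> x / (1 + \<i>) \<in> M"
proof -
  have "(1 + \<i>) ^ 2 = 2 * \<i>" by (simp add: power2_eq_square algebra_simps)
  then have eq: "x ^ 2 / 2 = \<i> * (x / (1 + \<i>)) ^ 2"
    by (simp add: power_divide)
  show ?thesis
    unfolding eq
    by (auto intro: M_power_D[OF M_cancel[OF _ ii_notin_M]] M_mult(2)[OF M_power ii_closed])
qed

text \<open>\<open>y^6 - x^6\<close> is \<open>y^2 - x^2\<close> times a factor congruent to the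
  unit \<open>3 x^4\<close>, and \<open>(y^2 - x^2)/2\<close> differs from
  \<open>(y - x)^2/2\<close> by \<open>x (y - x)\<close>. So the residues of \<open>\<alpha>\<close>
  and \<open>t\<close> determine the disc of radius \<open>1 + \<i>\<close>.\<close>

lemma sixth_power_half_imp_near:
  assumes "x \<in> V" "x \<notin> M" "y \<simeq> x" "(y ^ 6 - x ^ 6) / 2 \<in> M"
  shows "(y - x) ^ 2 / 2 \<in> M"
proof -
  have y: "y \<in> V" using assms req_in_V req_sym by blast
  have "y ^ 4 + y ^ 2 * x ^ 2 + x ^ 4 \<simeq> x ^ 4 + x ^ 2 * x ^ 2 + x ^ 4"
    using assms y by (intro req_add req_mult req_power closed) auto
  moreover have "x ^ 4 + x ^ 2 * x ^ 2 + x ^ 4 = 3 * x ^ 4" by (simp add: power_add[symmetric])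
  ultimately have "y ^ 4 + y ^ 2 * x ^ 2 + x ^ 4 \<notin> M"
    using req_not_M not_M_mult[OF three_notin_M not_M_power[OF assms(2)]] by metis
  moreover have "(y ^ 4 + y ^ 2 * x ^ 2 + x ^ 4) * ((y ^ 2 - x ^ 2) / 2) = (y ^ 6 - x ^ 6) / 2"
    by (simp add: algebra_simps power_add[symmetric] eval_nat_numeral)
  ultimately have "(y ^ 2 - x ^ 2) / 2 \<in> M" using assms(4) M_cancel by metis
  moreover have "x * (y - x) \<in> M" using assms by (intro M_mult(2)) (auto simp: req_def)
  ultimately have "(y ^ 2 - x ^ 2) / 2 - x * (y - x) \<in> M" by (rule M_diff)
  also have "(y ^ 2 - x ^ 2) / 2 - x * (y - x) = (y - x) ^ 2 / 2"
    by (simp add: power2_eq_square field_simps)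
  finally show ?thesis .
qed

lemma near_imp:
  assumes "x \<in> V" "y \<in> V" "(y - x) ^ 2 / 2 \<in> M"
  shows "y \<simeq> x" "(y ^ 6 + 1) / 2 \<simeq> (x ^ 6 + 1) / 2"
proof -
  have "2 * ((y - x) ^ 2 / 2) \<in> M" using assms by (intro M_mult(2) closed)
  then have yx: "y - x \<in> M" using M_power_D[of "y - x" 2] by simp
  then show "y \<simeq> x" by (simp add: req_def)
  have "((y - x) ^ 2 / 2 + x * (y - x)) * (y ^ 4 + y ^ 2 * x ^ 2 + x ^ 4) \<in> M"
    using assms yx by (intro M_mult(1)[of _ "y ^ 4 + y ^ 2 * x ^ 2 + x ^ 4"] M_add M_mult(2)[of "y - x"] closed)
  also have "((y - x) ^ 2 / 2 + x * (y - x)) * (y ^ 4 + y ^ 2 * x ^ 2 + x ^ 4) = (y ^ 6 + 1) / 2 - (x ^ 6 + 1) / 2"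
    by (simp add: field_simps power_add[symmetric] eval_nat_numeral)
  finally show "(y ^ 6 + 1) / 2 \<simeq> (x ^ 6 + 1) / 2" by (simp add: req_def)
qed

text \<open>After division by 4 the coefficients of index 1 and 2 are \<open>3 (1 + \<i>)\<close>
  and the unit \<open>33 \<i>\<close>, up to powers of \<open>\<eta>\<close> and negligible terms;
  the vertex is at 2.\<close>

lemma card_near:
  assumes "\<eta> \<in> V" "\<eta> \<notin> M" "(\<eta> ^ 12 + of_int a * \<eta> ^ m + of_int b) / 4 \<in> M"
  shows "card {\<beta>\<in>B. (\<beta> - \<eta>) / (1 + \<i>) \<in> M} = 2"
proof (rule card_roots_near[where c = 4])
  have sq: "(1 + \<i>) ^ 2 = 2 * \<i>" by (simp add: power2_eq_square algebra_simps)
  show pi: "1 + \<i> \<in> V" by (intro closed ii_closed)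
  have pi_M: "1 + \<i> \<in> M"
    by (rule M_power_D[of _ 2]) (simp only: sq M_mult(1)[OF two_in_M ii_closed])
  show "1 + \<i> \<noteq> 0" by (simp add: complex_eq_iff)
  obtain l where l: "a = 8 * l" using a8 by (elim dvdE)
  have "2 * (of_int l * (1 + \<i>)) \<in> M" by (intro M_mult(1) two_in_M closed ii_closed)
  then show "of_int a * (1 + \<i>) / 4 \<in> M" by (simp add: l)
  show "of_nat (12 choose i) * (1 + \<i>) ^ i / 4 \<in> M" if "0 < i" "i < 2" for i
  proof -
    have "i = 1" using that by simp
    moreover have "3 * (1 + \<i>) \<in> M" by (intro M_mult(2) pi_M closed)
    ultimately show ?thesis by (simp add: add_divide_distrib)
  qed
  have c2: "12 choose 2 = (66 :: nat)" by (simp add: choose_two)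
  have "33 * \<i> \<notin> M" by (intro not_M_mult ii_notin_M) (simp add: numeral_in_M_iff)
  then show "of_nat (12 choose 2) * (1 + \<i>) ^ 2 / 4 \<notin> M" by (simp add: c2 sq)
  show "of_nat (12 choose i) * (1 + \<i>) ^ i / 4 \<in> V" if i: "2 \<le> i" for i
  proof -
    consider "i = 2" | "i = 3" | "i \<ge> 4" using i by linarith
    then show ?thesis
    proof cases
      case 1
      have "33 * \<i> \<in> V" by (intro closed ii_closed)
      then show ?thesis by (simp add: 1 c2 sq)
    next
      case 2
      have c3: "12 choose 3 = (220 :: nat)" by (simp add: eval_nat_numeral)
      have "55 * (1 + \<i>) ^ 3 \<in> V" by (intro closed ii_closed)
      then show ?thesis by (simp add: 2 c3)
    next
      case 3
      have "(1 + \<i>) ^ 4 = ((1 + \<i>) ^ 2) ^ 2" by (simp flip: power_mult)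
      also have "\<dots> = - 4" by (simp add: sq power_mult_distrib)
      finally have "(1 + \<i>) ^ i = - 4 * (1 + \<i>) ^ (i - 4)"
        using 3 by (metis le_add_diff_inverse power_add)
      moreover have "- (of_nat (12 choose i) * (1 + \<i>) ^ (i - 4)) \<in> V" by (intro closed ii_closed)
      ultimately show ?thesis by simp
    qed
  qed
qed (use assms in auto)

text \<open>The disc around \<open>\<eta>\<close> is one class of two roots. The identity
  \<open>(\<beta>^3 - 1)^2 = 2 (t - \<beta>^3)\<close> makes \<open>\<beta>^3 - 1\<close> the
  ramified element; if 2 divided it, \<open>t\<close> would be congruent to 1, whence the assumption
  on \<open>\<tau>\<close>. The same identity at \<open>\<eta>\<close> puts the residue of
  \<open>\<eta>\<close> into the field of 4 elements.\<close>

lemma ramified_residue: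
  assumes \<eta>: "\<eta> \<in> V" "\<eta> \<notin> M" "(\<eta> ^ 12 + of_int a * \<eta> ^ m + of_int b) / 4 \<in> M"
    and \<tau>: "\<tau> = (\<eta> ^ 6 + 1) / 2" "\<tau> \<in> V" "\<tau> ^ 4 \<simeq> \<tau>" "\<not> \<tau> \<simeq> 1"
  obtains \<beta> where "\<beta> \<in> B" "\<beta> \<simeq> \<eta>" "(\<beta> ^ 6 + 1) / 2 \<simeq> \<tau>" "th \<beta> ^ 4 \<simeq> th \<beta>"
proof -
  let ?C = "{\<beta>\<in>B. (\<beta> - \<eta>) / (1 + \<i>) \<in> M}"
  obtain \<beta> \<gamma> where C: "?C = {\<beta>, \<gamma>}" using card_near[OF \<eta>] by (auto simp: card_2_iff)
  have ball: "x \<in> B \<and> x \<simeq> \<eta> \<and> (x ^ 6 + 1) / 2 \<simeq> \<tau>" if "x \<in> ?C" for x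
  proof -
    have x: "x \<in> B" "(x - \<eta>) ^ 2 / 2 \<in> M" using that by (auto simp: square_half_in_M_iff)
    show ?thesis using near_imp[OF \<eta>(1) B_V[OF x(1)] x(2)] x(1) by (simp add: \<tau>(1))
  qed
  have \<beta>: "\<beta> \<in> B" "\<beta> \<simeq> \<eta>" "(\<beta> ^ 6 + 1) / 2 \<simeq> \<tau>" and \<gamma>: "\<gamma> \<in> B" "\<gamma> \<simeq> \<eta>" "(\<gamma> ^ 6 + 1) / 2 \<simeq> \<tau>"
    using ball C by auto
  have "(\<eta> ^ 3 - 1) ^ 2 = 2 * (\<tau> - \<eta> ^ 3)"
    by (simp add: \<tau>(1) power2_eq_square field_simps power_add[symmetric])
  also have "\<dots> \<in> M" using \<eta> \<tau> by (intro M_mult(1) two_in_M closed)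
  finally have "\<eta> ^ 3 - 1 \<in> M" by (rule M_power_D)
  then have "\<eta> * (\<eta> ^ 3 - 1) \<in> M" using \<eta> by (intro M_mult(2))
  then have \<eta>4: "\<eta> ^ 4 \<simeq> \<eta>" by (simp add: req_def algebra_simps eval_nat_numeral)
  have tV: "(\<beta> ^ 6 + 1) / 2 \<in> V" using R_closed[OF t_R \<beta>(1)] .
  have \<beta>4: "\<beta> ^ 4 \<simeq> \<beta>"
    using req_power[OF \<beta>(2) B_V[OF \<beta>(1)], of 4] \<eta>4 \<beta>(2) by (meson req_sym req_trans)
  have t4: "((\<beta> ^ 6 + 1) / 2) ^ 4 \<simeq> (\<beta> ^ 6 + 1) / 2"
    using req_power[OF \<beta>(3) tV, of 4] \<tau>(3) \<beta>(3) by (meson req_sym req_trans)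
  have "th \<beta> ^ 2 ^ 2 \<simeq> th \<beta>"
  proof (rule frobenius_fixed_of_isolated[OF \<beta>(1) \<gamma>(1), of _ "{\<lambda>\<beta>. \<beta>, \<lambda>\<beta>. (\<beta> ^ 6 + 1) / 2}"])
    show "r \<in> R \<and> r \<beta> ^ 2 ^ 2 \<simeq> r \<beta> \<and> r \<gamma> \<simeq> r \<beta>" if "r \<in> {\<lambda>\<beta>. \<beta>, \<lambda>\<beta>. (\<beta> ^ 6 + 1) / 2}" for r
      using that id_R t_R \<beta>4 t4 \<beta> \<gamma> by (auto intro: req_trans[OF _ req_sym])
    show "d = \<beta> \<or> d = \<gamma>" if d: "d \<in> B" "\<And>r. r \<in> {\<lambda>\<beta>. \<beta>, \<lambda>\<beta>. (\<beta> ^ 6 + 1) / 2} \<Longrightarrow> r d \<simeq> r \<beta>" for d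
    proof -
      have "d \<simeq> \<beta>" "(d ^ 6 + 1) / 2 \<simeq> (\<beta> ^ 6 + 1) / 2"
        using d(2)[of "\<lambda>\<beta>. \<beta>"] d(2)[of "\<lambda>\<beta>. (\<beta> ^ 6 + 1) / 2"] by auto
      then have "(d - \<beta>) ^ 2 / 2 \<in> M"
        using B_V[OF \<beta>(1)] B_not_M[OF \<beta>(1)]
        by (intro sixth_power_half_imp_near) (auto simp: req_def diff_divide_distrib[symmetric])
      then have "(d - \<beta>) / (1 + \<i>) \<in> M" by (simp add: square_half_in_M_iff)
      moreover have "(\<beta> - \<eta>) / (1 + \<i>) \<in> M" using C by auto
      ultimately have "(d - \<beta>) / (1 + \<i>) + (\<beta> - \<eta>) / (1 + \<i>) \<in> M" by (rule M_add)
      then have "d \<in> ?C" using d(1) by (simp add: add_divide_distrib[symmetric])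
      then show ?thesis using C by auto
    qed
    have "(\<beta> ^ 3 - 1) ^ 2 = 2 * ((\<beta> ^ 6 + 1) / 2 - \<beta> ^ 3)"
      by (simp add: power2_eq_square field_simps power_add[symmetric])
    moreover have "(\<beta> ^ 6 + 1) / 2 - \<beta> ^ 3 \<in> V" using tV B_V[OF \<beta>(1)] by (intro closed)
    ultimately have "(\<beta> ^ 3 - 1) ^ 2 \<in> pV"
      unfolding pV_def by (metis (mono_tags) mem_Collect_eq of_nat_numeral)
    moreover have "\<beta> ^ 3 - 1 \<notin> pV"
    proof
      assume "\<beta> ^ 3 - 1 \<in> pV"
      then obtain s where s: "\<beta> ^ 3 - 1 = 2 * s" "s \<in> V" by (auto simp: pV_def)
      then have "\<beta> ^ 3 = 1 + 2 * s" by (simp add: algebra_simps)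
      moreover have "\<beta> ^ 6 = (\<beta> ^ 3) ^ 2" by (simp flip: power_mult)
      ultimately have "(\<beta> ^ 6 + 1) / 2 - 1 = 2 * (s + s ^ 2)"
        by (simp add: power2_eq_square field_simps)
      also have "\<dots> \<in> M" using s by (intro M_mult(1) two_in_M closed)
      finally have "(\<beta> ^ 6 + 1) / 2 \<simeq> 1" by (simp add: req_def)
      then show False using \<tau>(4) \<beta>(3) req_sym req_trans by blast
    qed
    ultimately show "\<gamma> = \<beta> \<or> (\<exists>r\<in>R. r \<beta> ^ 2 \<in> pV \<and> r \<beta> \<notin> pV)"
      by (intro disjI2 bexI[OF _ cube_R]) simp
  qed simp
  then show thesis using that[OF \<beta>] by simp
qed

text \<open>The disc of radius 2 around \<open>S\<close> holds one root, since
  \<open>12 * 2 / 8 = 3\<close> is a unit. There \<open>t\<close> is congruent to 1, so the integral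
  element \<open>t (\<beta>^3 + 1)/2\<close> has the residue of \<open>(\<beta>^3 + 1)/2\<close>,
  which determines the root within that disc.\<close>

lemma unramified_residue:
  assumes u_R: "(\<lambda>\<beta>. (\<beta> ^ 6 + 1) / 2 * ((\<beta> ^ 3 + 1) / 2)) \<in> R"
    and S: "S \<in> V" "S \<simeq> 1" "(S ^ 2 - 1) / 4 \<in> V"
      "(S ^ 12 + of_int a * S ^ m + of_int b) / 8 \<in> M"
    and U: "U = (S ^ 3 + 1) / 2" "U \<in> V" "U ^ 4 \<simeq> U"
  obtains \<beta> where "\<beta> \<in> B" "(\<beta> ^ 6 + 1) / 2 \<simeq> 1"
    "(\<beta> ^ 6 + 1) / 2 * ((\<beta> ^ 3 + 1) / 2) \<simeq> U" "th \<beta> ^ 4 \<simeq> th \<beta>"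
proof -
  let ?C = "{\<beta>\<in>B. (\<beta> - S) / 2 \<in> M}"
  let ?t = "\<lambda>\<beta>. (\<beta> ^ 6 + 1) / 2" and ?v = "\<lambda>\<beta>. (\<beta> ^ 3 + 1) / 2"
  have S_M: "S \<notin> M" using req_not_M[OF S(2) one_notin_M] .
  obtain l where l: "a = 8 * l" using a8 by (elim dvdE)
  have "card ?C = 1"
  proof (rule card_roots_near[where c = 8])
    have "2 * of_int l \<in> M" by (intro M_mult(1) two_in_M closed)
    then show "of_int a * 2 / 8 \<in> M" by (simp add: l)
    have "3 \<notin> M" by (rule three_notin_M)
    then show "of_nat (12 choose 1) * 2 ^ 1 / 8 \<notin> M" by simp
    show "of_nat (12 choose i) * 2 ^ i / 8 \<in> V" if i: "1 \<le> i" for i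
    proof -
      consider "i = 1" | "i = 2" | "i \<ge> 3" using i by linarith
      then show ?thesis
      proof cases
        case 3
        then have "(2::complex) ^ i = 8 * 2 ^ (i - 3)"
          using power_add[of "2::complex" 3 "i - 3"] by simp
        moreover have "of_nat (12 choose i) * 2 ^ (i - 3) \<in> V" by (intro closed)
        ultimately show ?thesis by simp
      qed (use closed in \<open>auto simp: choose_two\<close>)
    qed
  qed (use S S_M closed in auto)
  then obtain \<beta> where C: "?C = {\<beta>}" by (auto simp: card_1_singleton_iff)
  define \<mu> where "\<mu> = (\<beta> - S) / 2"
  have \<mu>: "\<mu> \<in> M" and \<beta>: "\<beta> \<in> B" using C by (auto simp: \<mu>_def)
  have \<beta>_eq: "\<beta> = S + 2 * \<mu>" by (simp add: \<mu>_def)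
  have \<beta>V: "\<beta> \<in> V" and \<mu>V: "\<mu> \<in> V" using B_V[OF \<beta>] M_subset[OF \<mu>] .
  have "\<beta> - S \<in> M" using \<mu>V unfolding \<beta>_eq by (simp add: M_mult(1)[OF two_in_M])
  then have \<beta>1: "\<beta> \<simeq> 1" using S(2) req_trans by (simp add: req_def)
  \<comment> \<open>Chosen so that \<open>\<beta>^2 = 1 + 4 w\<close>; this makes \<open>t\<close>
    equal to 1 modulo 2.\<close>
  define w where "w = (S ^ 2 - 1) / 4 + S * \<mu> + \<mu> ^ 2"
  have w: "w \<in> V" unfolding w_def using S \<mu>V by (intro closed)
  have "\<beta> ^ 2 = 1 + 4 * w" by (simp add: \<beta>_eq w_def power2_eq_square field_simps)
  moreover have "\<beta> ^ 6 = (\<beta> ^ 2) ^ 3" by (simp flip: power_mult)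
  ultimately have "?t \<beta> - 1 = 2 * (3 * w + 12 * w ^ 2 + 16 * w ^ 3)"
    by (simp add: power2_eq_square power3_eq_cube field_simps)
  also have "\<dots> \<in> M" using w by (intro M_mult(1) two_in_M closed)
  finally have t1: "?t \<beta> \<simeq> 1" by (simp add: req_def)
  have "?v \<beta> - U = \<mu> * (\<beta> ^ 2 + \<beta> * S + S ^ 2)"
    by (simp add: \<mu>_def U(1) power2_eq_square power3_eq_cube field_simps)
  also have "\<dots> \<in> M" using \<mu> \<beta>V S by (intro M_mult(1) closed)
  finally have vU: "?v \<beta> \<simeq> U" by (simp add: req_def)
  have vV: "?v \<beta> \<in> V" using req_in_V[OF req_sym[OF vU] U(2)] .
  have tV: "?t \<beta> \<in> V" using R_closed[OF t_R \<beta>] .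
  have uU: "?t \<beta> * ?v \<beta> \<simeq> U" using req_mult[OF t1 vU tV vV] by simp
  have uV: "?t \<beta> * ?v \<beta> \<in> V" using tV vV by (rule mult_closed)
  have t4: "?t \<beta> ^ 4 \<simeq> ?t \<beta>"
    using req_power[OF t1 tV, of 4] t1 by (metis power_one req_sym req_trans)
  have u4: "(?t \<beta> * ?v \<beta>) ^ 4 \<simeq> ?t \<beta> * ?v \<beta>"
    using req_power[OF uU uV, of 4] U(3) uU by (meson req_sym req_trans)
  have b4: "\<beta> ^ 4 \<simeq> \<beta>"
    using req_power[OF \<beta>1 \<beta>V, of 4] \<beta>1 by (metis power_one req_sym req_trans)
  let ?I = "{\<lambda>\<beta>. \<beta>, ?t, \<lambda>\<beta>. ?t \<beta> * ?v \<beta>}"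
  have "th \<beta> ^ 2 ^ 2 \<simeq> th \<beta>"
  proof (rule frobenius_fixed_of_isolated[OF \<beta> \<beta>, of _ ?I])
    show "r \<in> R \<and> r \<beta> ^ 2 ^ 2 \<simeq> r \<beta> \<and> r \<beta> \<simeq> r \<beta>" if "r \<in> ?I" for r
      using that id_R t_R u_R b4 t4 u4 by auto
    show "d = \<beta> \<or> d = \<beta>" if d: "d \<in> B" "\<And>r. r \<in> ?I \<Longrightarrow> r d \<simeq> r \<beta>" for d
    proof -
      have d1: "d \<simeq> \<beta>" "?t d \<simeq> ?t \<beta>" "?t d * ?v d \<simeq> ?t \<beta> * ?v \<beta>"
        using d(2)[of "\<lambda>\<beta>. \<beta>"] d(2)[of ?t] d(2)[of "\<lambda>\<beta>. ?t \<beta> * ?v \<beta>"] by auto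
      have td1: "?t d \<simeq> 1" using d1(2) t1 by (rule req_trans)
      have "?t d \<notin> M" using req_not_M[OF td1 one_notin_M] .
      moreover have "?t d * ?v d \<in> V" using R_closed[OF u_R d(1)] .
      ultimately have vdV: "?v d \<in> V" by (intro V_cancel[of "?t d" "?v d"])
      have "1 * ?v d \<simeq> ?t d * ?v d"
        using td1 vdV one_closed by (intro req_mult) (auto intro: req_sym)
      then have "?v d \<simeq> ?t d * ?v d" by simp
      then have "?v d \<simeq> ?v \<beta>"
        by (rule req_trans[OF _ req_trans[OF d1(3) req_trans[OF uU req_sym[OF vU]]]])
      then have "(d ^ 2 + d * \<beta> + \<beta> ^ 2) * ((d - \<beta>) / 2) \<in> M"
        by (simp add: req_def power2_eq_square power3_eq_cube field_simps)
      moreover have "d ^ 2 + d * \<beta> + \<beta> ^ 2 \<notin> M"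
      proof (rule req_not_M)
        have "d \<simeq> 1" using d1(1) \<beta>1 by (rule req_trans)
        then show "d ^ 2 + d * \<beta> + \<beta> ^ 2 \<simeq> 1 ^ 2 + 1 * 1 + 1 ^ 2"
          using \<beta>1 \<beta>V B_V[OF d(1)] by (intro req_add req_mult req_power) auto
        show "1 ^ 2 + 1 * 1 + 1 ^ 2 \<notin> M" using three_notin_M by simp
      qed
      ultimately have "(d - \<beta>) / 2 \<in> M" by (rule M_cancel)
      then have "(d - \<beta>) / 2 + \<mu> \<in> M" using \<mu> by (rule M_add)
      then have "d \<in> ?C" using d(1) by (simp add: \<mu>_def add_divide_distrib[symmetric])
      then show ?thesis using C by auto
    qed
  qed auto
  then show thesis using that[OF \<beta> t1 uU] by simp
qed

lemma card_fixed_le_4: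
  assumes "finite J" "\<And>j. j \<in> J \<Longrightarrow> \<beta> j \<in> B \<and> th (\<beta> j) ^ 4 \<simeq> th (\<beta> j)"
    and "\<And>i j. i \<in> J \<Longrightarrow> j \<in> J \<Longrightarrow> i \<noteq> j \<Longrightarrow> \<exists>r\<in>R. \<not> r (\<beta> i) \<simeq> r (\<beta> j)"
  shows "card J \<le> 4"
proof -
  have "card J \<le> degree [:0, - 1, 0, 0, 1 :: complex:]"
  proof (rule card_separated_le_degree[of J \<beta>])
    show "poly [:0, - 1, 0, 0, 1:] (th (\<beta> j)) \<in> M" if "j \<in> J" for j
      using assms(2)[OF that] by (simp add: req_def algebra_simps eval_nat_numeral)
  qed (use assms closed in \<open>auto simp: coeff_pCons split: nat.splits\<close>)
  then show ?thesis by simp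
qed

text \<open>Here \<open>t^2 - t + 1\<close> reduces to 0, so \<open>t\<close> takes both residues
  outside the prime field. Together with the three cube roots of 1 as residues of
  \<open>\<alpha>\<close> this makes six classes for a field of 4 elements.\<close>

lemma contradiction_3_mod_8:
  assumes b: "[b = 3] (mod 8)"
  shows False
proof -
  obtain l where l: "a = 8 * l" using a8 by (elim dvdE)
  define k where "k = b div 8"
  have k: "b = 3 + 8 * k" using b by (simp add: Cong.cong_def k_def) presburger
  define \<delta> where "\<delta> = \<i> * of_real (sqrt 3)"
  have \<delta>: "\<delta> ^ 2 = - 3" by (simp add: \<delta>_def power_mult_distrib flip: of_real_power)
  have \<delta>0: "\<delta> \<noteq> 0" using \<delta> by auto
  have "- 3 \<in> V" by (intro closed)
  then have \<delta>V: "\<delta> \<in> V" using \<delta> V_power_D[of \<delta> 2] by simp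
  have "- 3 \<notin> M" using M_uminus[of "-3"] three_notin_M by auto
  then have \<delta>M: "\<delta> \<notin> M" using \<delta> M_power[of \<delta> 2] by auto
  \<comment> \<open>The solutions of \<open>\<eta>^12 = -3\<close> are approximate roots since
    \<open>b\<close> is 3 modulo 8. As \<open>\<eta>\<close> and \<open>-\<eta>\<close> lie in the
    same disc, a fixed square root selects one of each pair.\<close>
  define J where "J = {\<eta>. \<eta> ^ 3 = csqrt \<delta>} \<union> {\<eta>. \<eta> ^ 3 = csqrt (- \<delta>)}"
  have ne: "csqrt \<delta> \<noteq> csqrt (- \<delta>)"
  proof
    assume "csqrt \<delta> = csqrt (- \<delta>)"
    then have "csqrt \<delta> ^ 2 = csqrt (- \<delta>) ^ 2" by simp
    then show False using \<delta>0 by simp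
  qed
  have cards: "card {\<eta>. \<eta> ^ 3 = csqrt \<delta>} = 3" "card {\<eta>. \<eta> ^ 3 = csqrt (- \<delta>)} = 3"
    using \<delta>0 by (auto intro!: card_nth_roots)
  then have fin: "finite {\<eta>. \<eta> ^ 3 = csqrt \<delta>}" "finite {\<eta>. \<eta> ^ 3 = csqrt (- \<delta>)}"
    using card.infinite by fastforce+
  have cardJ: "card J = 6" "finite J"
    using ne cards fin unfolding J_def by (subst card_Un_disjoint) auto
  have cube: "\<eta> ^ 6 = z" if "\<eta> ^ 3 = csqrt z" for \<eta> z
  proof -
    have "\<eta> ^ 6 = (\<eta> ^ 3) ^ 2" by (simp flip: power_mult)
    then show ?thesis unfolding that by simp
  qed
  then have six: "\<eta> ^ 6 = \<delta> \<or> \<eta> ^ 6 = - \<delta>" if "\<eta> \<in> J" for \<eta>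
    using that by (auto simp: J_def)
  have J: "\<eta> \<in> V" "\<eta> \<notin> M" if "\<eta> \<in> J" for \<eta>
  proof -
    show "\<eta> \<in> V" using six[OF that] \<delta>V uminus_closed[OF \<delta>V] by (auto intro: V_power_D[of \<eta> 6])
    show "\<eta> \<notin> M" using six[OF that] \<delta>M M_uminus[of "- \<delta>"] M_power[of \<eta> 6] by auto
  qed
  have "\<exists>\<beta>. \<beta> \<in> B \<and> \<beta> \<simeq> \<eta> \<and> (\<beta> ^ 6 + 1) / 2 \<simeq> (\<eta> ^ 6 + 1) / 2 \<and> th \<beta> ^ 4 \<simeq> th \<beta>"
    if \<eta>: "\<eta> \<in> J" for \<eta>
  proof -
    define \<tau> where "\<tau> = (\<eta> ^ 6 + 1) / 2"
    have sq: "(\<eta> ^ 6) ^ 2 = - 3" using six[OF \<eta>] \<delta> by (elim disjE) (simp_all only: power2_minus)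
    have "((e + 1) / 2) ^ 2 = 1 * ((e + 1) / 2) + (- 1)" if "e ^ 2 = - 3" for e :: complex
      using that by (simp add: power2_eq_square field_simps)
    from this[OF sq] have \<tau>2: "\<tau> ^ 2 = 1 * \<tau> + (- 1)" by (simp only: \<tau>_def)
    have \<tau>V: "\<tau> \<in> V" by (rule quadratic_closed[OF \<tau>2]) (intro closed)+
    have "\<eta> ^ 12 = - 3" using sq by (simp flip: power_mult)
    then have "(\<eta> ^ 12 + of_int a * \<eta> ^ m + of_int b) / 4 = 2 * (of_int k + of_int l * \<eta> ^ m)"
      by (simp add: l k algebra_simps)
    moreover have "2 * (of_int k + of_int l * \<eta> ^ m) \<in> M"
      using J[OF \<eta>] by (intro M_mult(1) two_in_M closed)
    ultimately have F: "(\<eta> ^ 12 + of_int a * \<eta> ^ m + of_int b) / 4 \<in> M" by (simp only:)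
    have "\<tau> ^ 4 = (\<tau> ^ 2) ^ 2" by (simp flip: power_mult)
    also have "\<dots> = (\<tau> - 1) ^ 2" using \<tau>2 by simp
    also have "\<dots> = \<tau> ^ 2 - 2 * \<tau> + 1" by (simp add: power2_eq_square algebra_simps)
    also have "\<dots> = \<tau> - 2 * \<tau>" using \<tau>2 by simp
    finally have "\<tau> ^ 4 - \<tau> = - (2 * \<tau>)" by simp
    also have "\<dots> \<in> M" by (intro M_uminus M_mult(1) two_in_M \<tau>V)
    finally have \<tau>4: "\<tau> ^ 4 \<simeq> \<tau>" by (simp add: req_def)
    have \<tau>1: "\<not> \<tau> \<simeq> 1"
    proof
      assume "\<tau> \<simeq> 1"
      then have 1: "\<tau> - 1 \<in> M" by (simp add: req_def)
      then have "\<tau> ^ 2 \<in> M" using \<tau>2 by simp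
      then have "\<tau> \<in> M" by (rule M_power_D)
      then have "\<tau> - (\<tau> - 1) \<in> M" using 1 by (rule M_diff)
      then show False using one_notin_M by simp
    qed
    show ?thesis
      using ramified_residue[OF J[OF \<eta>] F \<tau>_def \<tau>V \<tau>4 \<tau>1] unfolding \<tau>_def by blast
  qed
  then obtain \<beta> where \<beta>: "\<And>\<eta>. \<eta> \<in> J \<Longrightarrow> \<beta> \<eta> \<in> B \<and> \<beta> \<eta> \<simeq> \<eta> \<and>
      (\<beta> \<eta> ^ 6 + 1) / 2 \<simeq> (\<eta> ^ 6 + 1) / 2 \<and> th (\<beta> \<eta>) ^ 4 \<simeq> th (\<beta> \<eta>)"
    by metis
  have "card J \<le> 4"
  proof (rule card_fixed_le_4[OF cardJ(2)])
    fix x y assume xy: "x \<in> J" "y \<in> J" "x \<noteq> y"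
    show "\<exists>r\<in>R. \<not> r (\<beta> x) \<simeq> r (\<beta> y)"
    proof (rule ccontr)
      assume "\<not> (\<exists>r\<in>R. \<not> r (\<beta> x) \<simeq> r (\<beta> y))"
      then have "\<beta> x \<simeq> \<beta> y" "(\<beta> x ^ 6 + 1) / 2 \<simeq> (\<beta> y ^ 6 + 1) / 2" using id_R t_R by auto
      then have "x \<simeq> y" and t: "(x ^ 6 + 1) / 2 \<simeq> (y ^ 6 + 1) / 2"
        using \<beta>[OF xy(1)] \<beta>[OF xy(2)] by (meson req_sym req_trans)+
      \<comment> \<open>Congruent elements with equal cubes coincide; so the cubes are the two
        different square roots, and the values of \<open>t\<close> differ by the unit
        \<open>\<delta>\<close> up to sign.\<close>
      then have "x ^ 3 \<noteq> y ^ 3" using eq_of_power_eq[of x 3 y] J[OF xy(1)] xy(3) by auto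
      then have "(x ^ 3 = csqrt \<delta> \<and> y ^ 3 = csqrt (- \<delta>)) \<or> (x ^ 3 = csqrt (- \<delta>) \<and> y ^ 3 = csqrt \<delta>)"
        using xy by (auto simp: J_def)
      then have "(x ^ 6 = \<delta> \<and> y ^ 6 = - \<delta>) \<or> (x ^ 6 = - \<delta> \<and> y ^ 6 = \<delta>)" using cube by blast
      then have "(x ^ 6 + 1) / 2 - (y ^ 6 + 1) / 2 = \<delta> \<or> (x ^ 6 + 1) / 2 - (y ^ 6 + 1) / 2 = - \<delta>"
        by (auto simp: field_simps)
      then show False using t \<delta>M M_uminus[of "- \<delta>"] by (auto simp: req_def)
    qed
  qed (use \<beta> in auto)
  then show False using cardJ by simp
qed

text \<open>Now \<open>t^2 - t\<close> reduces to 0. The cube roots of \<open>\<i>\<close> have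
  \<open>t = 0\<close> and give three ramified classes; near 1, where \<open>t\<close> is 1, the
  element \<open>u\<close> separates two unramified roots. Five classes exceed 4 residues.\<close>

lemma contradiction_7_mod_8:
  assumes b: "[b = 7] (mod 8)" and u_R: "(\<lambda>\<beta>. (\<beta> ^ 6 + 1) / 2 * ((\<beta> ^ 3 + 1) / 2)) \<in> R"
  shows False
proof -
  let ?t = "\<lambda>\<beta>::complex. (\<beta> ^ 6 + 1) / 2" and ?u = "\<lambda>\<beta>::complex. (\<beta> ^ 6 + 1) / 2 * ((\<beta> ^ 3 + 1) / 2)"
  obtain l where l: "a = 8 * l" using a8 by (elim dvdE)
  define k1 where "k1 = b div 8 + 1"
  have k: "b = 8 * k1 - 1" using b by (simp add: Cong.cong_def k1_def) presburger
  have i4: "\<exists>\<beta>. \<beta> \<in> B \<and> \<beta> \<simeq> \<eta> \<and> ?t \<beta> \<simeq> 0 \<and> th \<beta> ^ 4 \<simeq> th \<beta>"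
    and iV: "\<eta> \<in> V" "\<eta> \<notin> M" if \<eta>: "\<eta> ^ 3 = \<i>" for \<eta>
  proof -
    show \<eta>V: "\<eta> \<in> V" using V_power_D[of \<eta> 3] \<eta> ii_closed by simp
    show \<eta>M: "\<eta> \<notin> M" using M_power[of \<eta> 3] \<eta> ii_notin_M by auto
    have "\<eta> ^ 6 = (\<eta> ^ 3) ^ 2" "\<eta> ^ 12 = (\<eta> ^ 3) ^ 4" by (simp_all flip: power_mult)
    then have \<eta>6: "\<eta> ^ 6 = - 1" "\<eta> ^ 12 = 1" unfolding \<eta> by (simp_all add: power4_eq_xxxx)
    have "(\<eta> ^ 12 + of_int a * \<eta> ^ m + of_int b) / 4 = 2 * (of_int k1 + of_int l * \<eta> ^ m)"
      by (simp add: l k \<eta>6 algebra_simps)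
    also have "\<dots> \<in> M" using \<eta>V by (intro M_mult(1) two_in_M closed)
    finally have F: "(\<eta> ^ 12 + of_int a * \<eta> ^ m + of_int b) / 4 \<in> M" .
    have "\<not> 0 \<simeq> 1" using M_uminus[of "-1"] one_notin_M by (auto simp: req_def)
    then show "\<exists>\<beta>. \<beta> \<in> B \<and> \<beta> \<simeq> \<eta> \<and> ?t \<beta> \<simeq> 0 \<and> th \<beta> ^ 4 \<simeq> th \<beta>"
      using ramified_residue[OF \<eta>V \<eta>M F, of 0] \<eta>6 zero_closed by auto
  qed
  \<comment> \<open>The unramified roots near 1 are closest to the square roots of \<open>1 - 4 c\<close>, where \<open>c\<close> is the parity
     of \<open>(1 + a + b) / 8\<close>.\<close>
  define S where "S = (if even (k1 + l) then 1 else \<i> * of_real (sqrt 3))"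
  define c :: int where "c = (if even (k1 + l) then 0 else 1)"
  have S2: "S ^ 2 = 1 - 4 * of_int c"
    by (auto simp: S_def c_def power_mult_distrib simp flip: of_real_power)
  have "1 - 4 * of_int c \<in> V" by (intro closed)
  then have SV: "S \<in> V" using V_power_D[of S 2] S2 by simp
  have "(S - 1) ^ 2 = 2 * (1 - 2 * of_int c - S)"
    using S2 by (simp add: power2_eq_square algebra_simps)
  also have "\<dots> \<in> M" using SV by (intro M_mult(1) two_in_M closed)
  finally have "S - 1 \<in> M" by (rule M_power_D)
  then have S1: "S \<simeq> 1" by (simp add: req_def)
  define U where "U s = (s ^ 3 + 1) / 2" for s :: complex
  have u4: "\<exists>\<beta>. \<beta> \<in> B \<and> ?t \<beta> \<simeq> 1 \<and> ?u \<beta> \<simeq> U s \<and> th \<beta> ^ 4 \<simeq> th \<beta>" if s: "s = S \<or> s = - S" for s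
  proof -
    have s2: "s ^ 2 = 1 - 4 * of_int c" using s S2 by auto
    have sV: "s \<in> V" using s SV uminus_closed by auto
    have "- S - 1 = - (S - 1) - 2" by simp
    also have "\<dots> \<in> M" by (rule M_diff[OF M_uminus[OF \<open>S - 1 \<in> M\<close>] two_in_M])
    finally have s1: "s \<simeq> 1" using s S1 by (auto simp: req_def)
    \<comment> \<open>Integral because \<open>y^2 + y = - c\<close>. Hence \<open>s^m\<close> is 1
      modulo 2, and the residue of \<open>(s^12 + a s^m + b)/8\<close> is the same for every
      \<open>m\<close>.\<close>
    define y where "y = (s - 1) / 2"
    have "y ^ 2 = (s ^ 2 - 2 * s + 1) / 4"
      by (simp add: y_def power2_eq_square field_simps)
    also have "\<dots> = (- 1) * y + (- of_int c)"
      unfolding s2 by (simp add: y_def field_simps)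
    finally have yV: "y \<in> V" by (rule quadratic_closed) (intro closed)+
    have "s ^ m - 1 = 2 * (y * (\<Sum>i<m. s ^ i))"
      by (simp add: y_def power_diff_1_eq)
    then have sm: "s ^ m = 1 + 2 * (y * (\<Sum>i<m. s ^ i))" by (simp add: algebra_simps)
    have s12: "s ^ 12 = 1 + 728 * of_int c"
    proof -
      have "s ^ 12 = (s ^ 2) ^ 6" by (simp flip: power_mult)
      then show ?thesis by (simp add: s2 c_def)
    qed
    \<comment> \<open>\<open>91 = 728 / 8\<close>, with 728 coming from \<open>(-3)^6 = 729\<close>
      in the case \<open>c = 1\<close>; being odd, it corrects the parity of
      \<open>k1 + l\<close>.\<close>
    have "even (k1 + l + 91 * c)" by (simp add: c_def)
    then obtain e where e: "k1 + l + 91 * c = 2 * e" by (elim evenE)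
    have "(s ^ 12 + of_int a * s ^ m + of_int b) / 8 =
        of_int (k1 + l + 91 * c) + 2 * (of_int l * (y * (\<Sum>i<m. s ^ i)))"
      by (simp add: s12 sm l k algebra_simps add_divide_distrib)
    also have "\<dots> = 2 * (of_int e + of_int l * (y * (\<Sum>i<m. s ^ i)))"
      unfolding e by (simp add: algebra_simps)
    also have "\<dots> \<in> M" using sV yV by (intro M_mult(1) two_in_M closed sum_closed)
    finally have F: "(s ^ 12 + of_int a * s ^ m + of_int b) / 8 \<in> M" .
    have s6: "s ^ 6 = 1 - 28 * of_int c"
    proof -
      have "s ^ 6 = (s ^ 2) ^ 3" by (simp flip: power_mult)
      then show ?thesis by (simp add: s2 c_def)
    qed
    have "U s ^ 2 = (s ^ 6 + 2 * s ^ 3 + 1) / 4"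
      by (simp add: U_def power2_eq_square field_simps flip: power_add)
    then have U2: "U s ^ 2 = 1 * U s + (- 7 * of_int c)"
      unfolding s6 by (simp add: U_def field_simps)
    have UV: "U s \<in> V" by (rule quadratic_closed[OF U2]) (intro closed)+
    have "U s ^ 4 = (U s ^ 2) ^ 2" by (simp flip: power_mult)
    also have "\<dots> = (U s - 7 * of_int c) ^ 2" using U2 by simp
    also have "\<dots> = U s ^ 2 - 14 * of_int c * U s + 49 * of_int c ^ 2"
      by (simp add: power2_eq_square algebra_simps)
    also have "\<dots> = U s + 2 * (of_int (21 * c) - 7 * of_int c * U s)"
      unfolding U2 by (auto simp: c_def)
    finally have "U s ^ 4 - U s = 2 * (of_int (21 * c) - 7 * of_int c * U s)" by simp
    also have "\<dots> \<in> M" using UV by (intro M_mult(1) two_in_M closed)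
    finally have U4: "U s ^ 4 \<simeq> U s" by (simp add: req_def)
    have "(s ^ 2 - 1) / 4 = of_int (- c)" by (simp add: s2)
    then have sq: "(s ^ 2 - 1) / 4 \<in> V" using of_int_closed by metis
    show ?thesis
      using unramified_residue[OF u_R sV s1 sq F U_def UV U4] by blast
  qed
  define J0 where "J0 = {\<eta>. \<eta> ^ 3 = \<i>}"
  have "card J0 = 3" unfolding J0_def by (intro card_nth_roots) auto
  then have J0: "card J0 = 3" "finite J0" using card.infinite by fastforce+
  define J where "J = J0 <+> {S, - S}"
  have "S \<noteq> 0" using S_def by auto
  then have "card J = 5" using J0 by (simp add: J_def card_Plus)
  have "\<exists>\<beta>. \<beta> \<in> B \<and> th \<beta> ^ 4 \<simeq> th \<beta> \<and>
      (case j of Inl \<eta> \<Rightarrow> \<beta> \<simeq> \<eta> \<and> ?t \<beta> \<simeq> 0 | Inr s \<Rightarrow> ?t \<beta> \<simeq> 1 \<and> ?u \<beta> \<simeq> U s)" if "j \<in> J" for j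
    using that i4 u4 by (cases j) (auto simp: J_def J0_def)
  then obtain \<beta> where \<beta>: "\<And>j. j \<in> J \<Longrightarrow> \<beta> j \<in> B \<and> th (\<beta> j) ^ 4 \<simeq> th (\<beta> j) \<and>
      (case j of Inl \<eta> \<Rightarrow> \<beta> j \<simeq> \<eta> \<and> ?t (\<beta> j) \<simeq> 0 | Inr s \<Rightarrow> ?t (\<beta> j) \<simeq> 1 \<and> ?u (\<beta> j) \<simeq> U s)"
    by metis
  have "card J \<le> 4"
  proof (rule card_fixed_le_4)
    show "finite J" using J0 by (simp add: J_def)
    fix x y assume xy: "x \<in> J" "y \<in> J" "x \<noteq> y"
    have not01: "\<not> 0 \<simeq> 1" "\<not> 1 \<simeq> 0" using M_uminus[of "-1"] one_notin_M by (auto simp: req_def)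
    show "\<exists>r\<in>R. \<not> r (\<beta> x) \<simeq> r (\<beta> y)"
    proof (rule ccontr)
      assume "\<not> (\<exists>r\<in>R. \<not> r (\<beta> x) \<simeq> r (\<beta> y))"
      then have eq: "\<beta> x \<simeq> \<beta> y" "?t (\<beta> x) \<simeq> ?t (\<beta> y)" "?u (\<beta> x) \<simeq> ?u (\<beta> y)"
        using id_R t_R u_R by auto
      show False
      proof (cases x; cases y)
        fix s r assume [simp]: "x = Inl s" "y = Inl r"
        have "\<beta> x \<simeq> s" "\<beta> y \<simeq> r" using \<beta>[OF xy(1)] \<beta>[OF xy(2)] by auto
        from req_trans[OF req_sym[OF this(1)] req_trans[OF eq(1) this(2)]] have "s \<simeq> r" .
        then show False using eq_of_power_eq[of s 3 r] iV[of s] xy by (auto simp: J_def J0_def)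
      next
        fix s r assume [simp]: "x = Inl s" "y = Inr r"
        have "?t (\<beta> x) \<simeq> 0" "?t (\<beta> y) \<simeq> 1" using \<beta>[OF xy(1)] \<beta>[OF xy(2)] by auto
        from req_trans[OF req_sym[OF this(1)] req_trans[OF eq(2) this(2)]] show False using not01 by simp
      next
        fix s r assume [simp]: "x = Inr s" "y = Inl r"
        have "?t (\<beta> x) \<simeq> 1" "?t (\<beta> y) \<simeq> 0" using \<beta>[OF xy(1)] \<beta>[OF xy(2)] by auto
        from req_trans[OF req_sym[OF this(1)] req_trans[OF eq(2) this(2)]] show False using not01 by simp
      next
        fix s r assume [simp]: "x = Inr s" "y = Inr r"
        have "?u (\<beta> x) \<simeq> U s" "?u (\<beta> y) \<simeq> U r" using \<beta>[OF xy(1)] \<beta>[OF xy(2)] by auto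
        from req_trans[OF req_sym[OF this(1)] req_trans[OF eq(3) this(2)]] have "U s \<simeq> U r" .
        \<comment> \<open>\<open>U s\<close> and \<open>U (- s)\<close> differ by
          \<open>s^3\<close>, which is a unit.\<close>
        moreover have "U s - U r = S ^ 3 \<or> U s - U r = - (S ^ 3)"
          using xy by (auto simp: J_def U_def field_simps power3_eq_cube)
        ultimately have "S ^ 3 \<in> M" using M_uminus[of "- (S ^ 3)"] by (auto simp: req_def)
        then have "S \<in> M" by (rule M_power_D)
        then show False using S1 req_not_M one_notin_M by blast
      qed
    qed
  qed (use \<beta> in auto)
  then show False using \<open>card J = 5\<close> by simp
qed

end

section \<open>The prime 3\<close>

text \<open>\<open>\<epsilon>\<close> is \<open>-b\<close> modulo 9, so the roots approximate the
  solutions of \<open>X^12 = \<epsilon>\<close>, whose fourth powers are \<open>\<epsilon>\<close>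
  times a cube root of unity.\<close>

locale trinomial_3 = trinomial_conjugates V 3 for V +
  fixes \<epsilon> :: int
  assumes \<epsilon>: "\<epsilon> = 1 \<or> \<epsilon> = - 1" and a9: "9 dvd a" and b9: "9 dvd b + \<epsilon>"
    and w_R: "(\<lambda>\<beta>. (\<beta> ^ 4 - of_int \<epsilon>) ^ 2 / 3) \<in> R" and fourth_R: "(\<lambda>\<beta>. \<beta> ^ 4 - of_int \<epsilon>) \<in> R"
begin

abbreviation e :: complex where "e \<equiv> of_int \<epsilon>"

definition \<delta> :: complex where "\<delta> = \<i> * of_real (sqrt 3)"

definition \<omega> :: complex where "\<omega> = (\<delta> - 1) / 2"

lemma e_square: "e ^ 2 = 1" "e * e = 1"
  using \<epsilon> by auto

lemma e_notin_M: "e \<notin> M"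
  using \<epsilon> by (auto simp: of_int_in_M_iff)

lemma \<delta>_square: "\<delta> ^ 2 = - 3" "\<delta> * \<delta> = - 3"
proof -
  show "\<delta> ^ 2 = - 3"
    by (simp add: \<delta>_def power_mult_distrib flip: of_real_power)
  then show "\<delta> * \<delta> = - 3" by (simp add: power2_eq_square)
qed

lemma \<delta>_nonzero: "\<delta> \<noteq> 0"
  using \<delta>_square by auto

lemma three_in_M: "3 \<in> M"
  using p_in_M by simp

lemma \<delta>_in_M: "\<delta> \<in> M"
  using M_power_D[of \<delta> 2] M_uminus[OF three_in_M] by (simp add: \<delta>_square)

lemma \<delta>_closed: "\<delta> \<in> V"
  by (rule M_subset[OF \<delta>_in_M])

lemma \<omega>_eq: "\<delta> = 2 * \<omega> + 1" "\<omega> * \<omega> = - \<omega> - 1" "\<omega> ^ 3 = 1"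
proof -
  show 1: "\<delta> = 2 * \<omega> + 1" by (simp add: \<omega>_def)
  have "\<omega> * \<omega> = (\<delta> * \<delta> - 2 * \<delta> + 1) / 4" by (simp add: \<omega>_def field_simps)
  also have "\<dots> = - \<omega> - 1" unfolding \<delta>_square by (simp add: \<omega>_def field_simps)
  finally show 2: "\<omega> * \<omega> = - \<omega> - 1" .
  have "\<omega> ^ 3 = \<omega> * (\<omega> * \<omega>)" by (simp add: power3_eq_cube)
  also have "\<dots> = \<omega> * (- \<omega> - 1)" by (simp only: 2)
  also have "\<dots> = - (\<omega> * \<omega>) - \<omega>" by (simp add: algebra_simps)
  also have "\<dots> = 1" unfolding 2 by simp
  finally show "\<omega> ^ 3 = 1" .
qed

lemma \<omega>_closed: "\<omega> \<in> V"
  by (rule V_power_D[of _ 3]) (auto simp: \<omega>_eq one_closed)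

lemma \<omega>_notin_M: "\<omega> \<notin> M"
  using M_power[of \<omega> 3] \<omega>_eq(3) one_notin_M by auto

text \<open>The two quotients reduce to -1 and 1: the nontrivial cube roots of unity leave 1 in
  opposite directions, and the square in \<open>w\<close> forgets the sign.\<close>

lemma \<omega>_diff: "(\<omega> - 1) / \<delta> = - (\<omega> * \<omega>)" "(\<omega> * \<omega> - 1) / \<delta> = \<omega>"
proof -
  have "- (\<omega> * \<omega>) * \<delta> = (\<omega> + 1) * (2 * \<omega> + 1)" unfolding \<omega>_eq(1,2) by simp
  also have "\<dots> = 2 * (\<omega> * \<omega>) + 3 * \<omega> + 1" by (simp add: algebra_simps)
  also have "\<dots> = \<omega> - 1" unfolding \<omega>_eq(2) by simp
  finally have "\<omega> - 1 = - (\<omega> * \<omega>) * \<delta>" by simp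
  then show "(\<omega> - 1) / \<delta> = - (\<omega> * \<omega>)" using \<delta>_nonzero by simp
  have "\<omega> * \<delta> = 2 * (\<omega> * \<omega>) + \<omega>" unfolding \<omega>_eq(1) by (simp add: algebra_simps)
  also have "\<dots> = \<omega> * \<omega> - 1" unfolding \<omega>_eq(2) by simp
  finally have "\<omega> * \<omega> - 1 = \<omega> * \<delta>" by simp
  then show "(\<omega> * \<omega> - 1) / \<delta> = \<omega>" using \<delta>_nonzero by simp
qed

lemma \<omega>_req_1: "\<omega> \<simeq> 1" "\<omega> * \<omega> \<simeq> 1"
proof -
  have "\<delta> * ((\<omega> - 1) / \<delta>) \<in> M" "\<delta> * ((\<omega> * \<omega> - 1) / \<delta>) \<in> M"
    unfolding \<omega>_diff by (intro M_mult(1) \<delta>_in_M closed \<omega>_closed)+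
  then show "\<omega> \<simeq> 1" "\<omega> * \<omega> \<simeq> 1"
    using \<delta>_nonzero by (simp_all add: req_def)
qed

text \<open>The cofactor of \<open>x - y\<close> is congruent to \<open>4 y^3\<close>, a
  unit.\<close>

lemma fourth_power_near_iff:
  assumes "x \<in> V" "y \<in> V" "y \<notin> M" "x \<simeq> y"
  shows "(x ^ 4 - y ^ 4) / \<delta> \<in> M \<longleftrightarrow> (x - y) / \<delta> \<in> M"
proof -
  have eq: "(x ^ 4 - y ^ 4) / \<delta> = (x - y) / \<delta> * (x ^ 3 + x ^ 2 * y + x * y ^ 2 + y ^ 3)"
    using \<delta>_nonzero by (simp add: field_simps eval_nat_numeral)
  have "x ^ 3 + x ^ 2 * y + x * y ^ 2 + y ^ 3 \<simeq> y ^ 3 + y ^ 2 * y + y * y ^ 2 + y ^ 3"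
    using assms by (intro req_add req_mult req_power closed) auto
  moreover have "y ^ 3 + y ^ 2 * y + y * y ^ 2 + y ^ 3 = 4 * y ^ 3"
    by (simp add: eval_nat_numeral)
  moreover have "4 * y ^ 3 \<notin> M"
    using assms by (intro not_M_mult not_M_power) (auto simp: numeral_in_M_iff)
  ultimately have "x ^ 3 + x ^ 2 * y + x * y ^ 2 + y ^ 3 \<notin> M"
    using req_not_M by metis
  moreover have "x ^ 3 + x ^ 2 * y + x * y ^ 2 + y ^ 3 \<in> V" using assms by (intro closed)
  ultimately show ?thesis unfolding eq using M_cancel' M_mult(1) by blast
qed

text \<open>With step \<open>\<delta>\<close> and scale \<open>\<delta>^3\<close> the linear
  coefficient is the unit \<open>12 / \<delta>^2 = -4\<close> up to a power of \<open>\<eta>\<close>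
  and a negligible term, and the constant one is a multiple of
  \<open>9 / \<delta>^3 = \<delta>\<close>.\<close>

lemma ex1_near:
  assumes \<eta>: "\<eta> \<in> V" "\<eta> ^ 12 = e"
  obtains \<beta> where "{\<beta>\<in>B. (\<beta> - \<eta>) / \<delta> \<in> M} = {\<beta>}" "\<beta> \<in> B" "\<beta> \<simeq> \<eta>" "(\<beta> ^ 4 - \<eta> ^ 4) / \<delta> \<in> M"
proof -
  obtain l where l: "a = 9 * l" using a9 by (elim dvdE)
  obtain k where k: "b + \<epsilon> = 9 * k" using b9 by (elim dvdE)
  have kc: "e + of_int b = 9 * of_int k"
    using arg_cong[OF k, of complex_of_int] by (simp add: add.commute)
  have \<eta>M: "\<eta> \<notin> M" using M_power[of \<eta> 12] \<eta>(2) e_notin_M by auto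
  have d3: "\<delta> ^ 3 = - 3 * \<delta>" using \<delta>_square(1) by (simp add: power3_eq_cube power2_eq_square)
  have "card {\<beta>\<in>B. (\<beta> - \<eta>) / \<delta> \<in> M} = 1"
  proof (rule card_roots_near[where c = "\<delta> ^ 3"])
    have "of_int a * \<delta> / \<delta> ^ 3 = 3 * (- of_int l)"
      using \<delta>_nonzero by (simp add: d3 l)
    also have "\<dots> \<in> M" by (intro M_mult(1) three_in_M closed)
    finally show "of_int a * \<delta> / \<delta> ^ 3 \<in> M" .
    have "\<eta> ^ 12 + of_int a * \<eta> ^ m + of_int b = 9 * (of_int k + of_int l * \<eta> ^ m)"
      using kc by (simp add: \<eta> l algebra_simps)
    moreover have "9 / \<delta> ^ 3 = \<delta>"
      using \<delta>_nonzero \<delta>_square by (simp add: d3 field_simps)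
    ultimately have "(\<eta> ^ 12 + of_int a * \<eta> ^ m + of_int b) / \<delta> ^ 3 = \<delta> * (of_int k + of_int l * \<eta> ^ m)"
      by (metis times_divide_eq_left)
    also have "\<dots> \<in> M" using \<eta> by (intro M_mult(1) \<delta>_in_M closed)
    finally show "(\<eta> ^ 12 + of_int a * \<eta> ^ m + of_int b) / \<delta> ^ 3 \<in> M" .
    have m4: "of_nat (12 choose 1) * \<delta> ^ 1 / \<delta> ^ 3 = - 4"
      using \<delta>_nonzero by (simp add: d3)
    have "- 4 \<notin> M" using M_uminus[of "- 4"] by (auto simp: numeral_in_M_iff)
    then show "of_nat (12 choose 1) * \<delta> ^ 1 / \<delta> ^ 3 \<notin> M" unfolding m4 .
    show "of_nat (12 choose i) * \<delta> ^ i / \<delta> ^ 3 \<in> V" if i: "1 \<le> i" for i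
    proof -
      consider "i = 1" | "i = 2" | "i \<ge> 3" using i by linarith
      then show ?thesis
      proof cases
        case 1
        then show ?thesis unfolding 1 m4 by (intro closed)
      next
        case 2
        have "of_nat (12 choose 2) * \<delta> ^ 2 / \<delta> ^ 3 = 66 / \<delta>"
          using \<delta>_nonzero by (simp add: choose_two eval_nat_numeral)
        also have "66 = (- 22 * \<delta>) * \<delta>" unfolding mult.assoc \<delta>_square(2) by simp
        also have "(- 22 * \<delta>) * \<delta> / \<delta> = - 22 * \<delta>" using \<delta>_nonzero by simp
        also have "\<dots> \<in> V" by (intro closed \<delta>_closed)
        finally show ?thesis by (simp add: 2)
      next
        case 3
        then have "\<delta> ^ i = \<delta> ^ (i - 3) * \<delta> ^ 3" by (simp flip: power_add)
        then have "of_nat (12 choose i) * \<delta> ^ i / \<delta> ^ 3 = of_nat (12 choose i) * \<delta> ^ (i - 3)"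
          using \<delta>_nonzero by simp
        also have "\<dots> \<in> V" by (intro closed \<delta>_closed)
        finally show ?thesis .
      qed
    qed
  qed (use \<eta> \<eta>M \<delta>_nonzero \<delta>_closed in auto)
  then obtain \<beta> where C: "{\<beta>\<in>B. (\<beta> - \<eta>) / \<delta> \<in> M} = {\<beta>}" by (auto simp: card_1_singleton_iff)
  then have \<beta>: "\<beta> \<in> B" "(\<beta> - \<eta>) / \<delta> \<in> M" by auto
  have "(\<beta> - \<eta>) / \<delta> * \<delta> \<in> M" using \<beta>(2) \<delta>_closed by (rule M_mult(1))
  then have "\<beta> \<simeq> \<eta>" using \<delta>_nonzero by (simp add: req_def)
  with that[OF C \<beta>(1)] show thesis
    using fourth_power_near_iff[OF B_V[OF \<beta>(1)] \<eta>(1) \<eta>M] \<beta>(2) by blast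
qed

abbreviation w :: "complex \<Rightarrow> complex" where "w \<equiv> \<lambda>\<beta>. (\<beta> ^ 4 - e) ^ 2 / 3"

text \<open>A square root of \<open>-w\<close>. Near a given \<open>\<zeta>\<close> its residues 0
  and plus or minus \<open>\<epsilon>\<close> single out one root each, but it is the square that is
  supplied as an element of \<open>R\<close>.\<close>

definition \<rho> :: "complex \<Rightarrow> complex" where "\<rho> x = (x ^ 4 - e) / \<delta>"

lemma w_eq_\<rho>: "w x = - (\<rho> x ^ 2)"
  by (simp add: \<rho>_def power_divide \<delta>_square)

lemma \<rho>_closed: "x \<in> B \<Longrightarrow> \<rho> x \<in> V"
proof -
  assume "x \<in> B"
  then have "- w x \<in> V" using R_closed[OF w_R] by (intro uminus_closed) auto
  then have "\<rho> x ^ 2 \<in> V" by (simp only: w_eq_\<rho> minus_minus)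
  then show ?thesis by (rule V_power_D) simp
qed

lemma \<rho>_req_iff: "\<rho> x \<simeq> \<rho> y \<longleftrightarrow> (x ^ 4 - y ^ 4) / \<delta> \<in> M"
  by (simp add: \<rho>_def req_def diff_divide_distrib[symmetric])

lemma w_req: "x \<in> B \<Longrightarrow> \<rho> x \<simeq> r \<Longrightarrow> w x \<simeq> - (r ^ 2)"
  using req_diff[OF req_refl[of 0] req_power[of "\<rho> x" r 2]] \<rho>_closed by (simp add: w_eq_\<rho>)

text \<open>Both admissible residues \<open>c\<close> of \<open>w\<close> lie in the prime field.
  For \<open>c = - 1\<close> the class may be a pair, and \<open>\<beta>^4 - \<epsilon>\<close>
  certifies ramification: its square is \<open>3 w\<close>, while its divisibility by 3 would make
  the residue of \<open>w\<close> vanish.\<close>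

lemma frobenius_fixed_3:
  assumes k: "k > 0" and \<zeta>: "\<zeta> \<in> V" "\<zeta> ^ 3 ^ k \<simeq> \<zeta>"
    and \<beta>: "\<beta> \<in> B" "\<beta> \<simeq> \<zeta>" "w \<beta> \<simeq> c" and \<gamma>: "\<gamma> \<in> B" "\<gamma> \<simeq> \<zeta>" "w \<gamma> \<simeq> c"
    and c: "c = 0 \<or> c = - 1"
    and iso: "\<And>d. d \<in> B \<Longrightarrow> d \<simeq> \<zeta> \<Longrightarrow> w d \<simeq> c \<Longrightarrow> d = \<beta> \<or> d = \<gamma>"
    and ram: "\<gamma> = \<beta> \<or> c = - 1"
  shows "th \<beta> ^ 3 ^ k \<simeq> th \<beta>"
proof (rule frobenius_fixed_of_isolated[OF \<beta>(1) \<gamma>(1) k, of "{\<lambda>\<beta>. \<beta>, w}"])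
  have wV: "w \<beta> \<in> V" using R_closed[OF w_R \<beta>(1)] .
  have "c ^ 3 ^ k = c" using c by auto
  then have "w \<beta> ^ 3 ^ k \<simeq> w \<beta>"
    using req_power[OF \<beta>(3) wV, of "3 ^ k"] \<beta>(3) by (metis req_sym req_trans)
  moreover have "\<beta> ^ 3 ^ k \<simeq> \<beta>"
    using req_power[OF \<beta>(2) B_V[OF \<beta>(1)], of "3 ^ k"] \<beta>(2) \<zeta>(2) by (meson req_sym req_trans)
  moreover have "\<gamma> \<simeq> \<beta>" "w \<gamma> \<simeq> w \<beta>" using \<beta> \<gamma> by (meson req_sym req_trans)+
  ultimately show "r \<in> R \<and> r \<beta> ^ 3 ^ k \<simeq> r \<beta> \<and> r \<gamma> \<simeq> r \<beta>" if "r \<in> {\<lambda>\<beta>. \<beta>, w}" for r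
    using that id_R w_R by auto
  show "d = \<beta> \<or> d = \<gamma>" if d: "d \<in> B" "\<And>r. r \<in> {\<lambda>\<beta>. \<beta>, w} \<Longrightarrow> r d \<simeq> r \<beta>" for d
  proof (rule iso[OF d(1)])
    show "d \<simeq> \<zeta>" using d(2)[of "\<lambda>\<beta>. \<beta>"] \<beta>(2) req_trans by blast
    show "w d \<simeq> c" using d(2)[of w] \<beta>(3) req_trans by blast
  qed
  show "\<gamma> = \<beta> \<or> (\<exists>r\<in>R. r \<beta> ^ 2 \<in> pV \<and> r \<beta> \<notin> pV)"
  proof (cases "\<gamma> = \<beta>")
    case False
    then have c1: "c = - 1" using ram by simp
    have "(\<beta> ^ 4 - e) ^ 2 = of_nat 3 * w \<beta>" by simp
    then have "(\<beta> ^ 4 - e) ^ 2 \<in> pV" using wV unfolding pV_def by blast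
    moreover have "\<beta> ^ 4 - e \<notin> pV"
    proof
      assume "\<beta> ^ 4 - e \<in> pV"
      then obtain s where s: "\<beta> ^ 4 - e = 3 * s" "s \<in> V" by (auto simp: pV_def)
      have "w \<beta> = 3 * s ^ 2" unfolding s(1) by (simp add: power2_eq_square)
      also have "\<dots> \<in> M" using s by (intro M_mult(1) three_in_M closed)
      finally have "- 1 \<in> M" using req_M[OF \<beta>(3)] c1 by simp
      then show False using M_uminus[of "- 1"] one_notin_M by simp
    qed
    ultimately show ?thesis by (intro disjI2 bexI[OF _ fourth_R]) simp
  qed simp
qed

text \<open>\<open>\<rho>\<close> vanishes at \<open>\<zeta>\<close>, so a nearby root with
  \<open>w\<close> in \<open>M\<close> has its fourth power close to \<open>\<zeta>^4\<close> and
  lies in the disc around \<open>\<zeta>\<close>, which holds one root.\<close>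

lemma unramified_residue_3:
  assumes k: "k > 0" and \<zeta>: "\<zeta> \<in> V" "\<zeta> ^ 4 = e" "\<zeta> ^ 3 ^ k \<simeq> \<zeta>"
  obtains \<beta> where "\<beta> \<in> B" "\<beta> \<simeq> \<zeta>" "w \<beta> \<simeq> 0" "th \<beta> ^ 3 ^ k \<simeq> th \<beta>"
proof -
  have e3: "e ^ 3 = e" using \<epsilon> by auto
  have z12: "\<zeta> ^ 12 = e"
  proof -
    have "\<zeta> ^ 12 = (\<zeta> ^ 4) ^ 3" by (simp flip: power_mult)
    then show ?thesis unfolding \<zeta>(2) e3 .
  qed
  have \<zeta>M: "\<zeta> \<notin> M" using M_power[of \<zeta> 4] \<zeta>(2) e_notin_M by auto
  obtain \<beta> where C: "{\<beta>\<in>B. (\<beta> - \<zeta>) / \<delta> \<in> M} = {\<beta>}" and \<beta>: "\<beta> \<in> B" "\<beta> \<simeq> \<zeta>" "(\<beta> ^ 4 - \<zeta> ^ 4) / \<delta> \<in> M"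
    using ex1_near[OF \<zeta>(1) z12] by blast
  have \<rho>\<zeta>: "\<rho> \<zeta> = 0" by (simp add: \<rho>_def \<zeta>)
  have w0: "w \<beta> \<simeq> 0" using w_req[OF \<beta>(1), of 0] \<beta>(3) \<rho>_req_iff[of \<beta> \<zeta>] \<rho>\<zeta> by simp
  have "th \<beta> ^ 3 ^ k \<simeq> th \<beta>"
  proof (rule frobenius_fixed_3[OF k \<zeta>(1,3) \<beta>(1,2) w0 \<beta>(1,2) w0])
    fix d assume d: "d \<in> B" "d \<simeq> \<zeta>" "w d \<simeq> 0"
    have "\<rho> d ^ 2 \<in> M" using d(3) M_uminus[of "w d"]
      by (simp only: w_eq_\<rho> req_def diff_0_right minus_minus)
    then have "\<rho> d \<in> M" by (rule M_power_D)
    then have "(d ^ 4 - \<zeta> ^ 4) / \<delta> \<in> M" by (simp add: \<rho>_def \<zeta>)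
    then have "(d - \<zeta>) / \<delta> \<in> M" using fourth_power_near_iff[OF B_V[OF d(1)] \<zeta>(1) \<zeta>M d(2)] by blast
    then have "d \<in> {\<beta>}" unfolding C[symmetric] using d(1) by simp
    then show "d = \<beta> \<or> d = \<beta>" by simp
  qed auto
  then show thesis using that[OF \<beta>(1,2) w0] by blast
qed

text \<open>The pair sits near \<open>\<zeta> \<omega>\<close> and
  \<open>\<zeta> \<omega>^2\<close>: for a cube root of unity \<open>u\<close> one has
  \<open>\<rho> (\<zeta> u) = \<epsilon> (u - 1) / \<delta>\<close>, and the two residues are
  opposite with common square 1.\<close>

lemma ramified_residue_3:
  assumes k: "k > 0" and \<zeta>: "\<zeta> \<in> V" "\<zeta> ^ 4 = e" "\<zeta> ^ 3 ^ k \<simeq> \<zeta>"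
  obtains \<beta> where "\<beta> \<in> B" "\<beta> \<simeq> \<zeta>" "w \<beta> \<simeq> - 1" "th \<beta> ^ 3 ^ k \<simeq> th \<beta>"
proof -
  have e3: "e ^ 3 = e" using \<epsilon> by auto
  have \<zeta>M: "\<zeta> \<notin> M" using M_power[of \<zeta> 4] \<zeta>(2) e_notin_M by auto
  have eV: "e \<in> V" by (rule of_int_closed)
  have near: "\<exists>\<beta>. {\<beta>\<in>B. (\<beta> - \<zeta> * u) / \<delta> \<in> M} = {\<beta>} \<and> \<beta> \<in> B \<and> \<beta> \<simeq> \<zeta> \<and> \<rho> \<beta> \<simeq> s \<and>
      (\<forall>d\<in>B. d \<simeq> \<zeta> \<longrightarrow> \<rho> d \<simeq> s \<longrightarrow> d = \<beta>)"
    if u: "u \<in> V" "u \<notin> M" "u \<simeq> 1" "u ^ 3 = 1" "e * ((u - 1) / \<delta>) \<simeq> s" for u s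
  proof -
    have uV: "\<zeta> * u \<in> V" and uM: "\<zeta> * u \<notin> M"
      using not_M_mult[OF \<zeta>M u(2)] mult_closed[OF \<zeta>(1) u(1)] by auto
    have u4: "u ^ 4 = u" using u(4) by (simp add: eval_nat_numeral)
    have "(\<zeta> * u) ^ 12 = (\<zeta> ^ 4) ^ 3 * (u ^ 3) ^ 4"
      by (simp add: power_mult_distrib flip: power_mult)
    also have "\<dots> = e" unfolding \<zeta>(2) u(4) e3 by simp
    finally obtain \<beta> where \<beta>: "{\<beta>\<in>B. (\<beta> - \<zeta> * u) / \<delta> \<in> M} = {\<beta>}" "\<beta> \<in> B" "\<beta> \<simeq> \<zeta> * u"
        "(\<beta> ^ 4 - (\<zeta> * u) ^ 4) / \<delta> \<in> M"
      using ex1_near[OF uV] by blast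
    have \<zeta>u: "\<zeta> * u \<simeq> \<zeta>" using req_mult[OF req_refl[of \<zeta>] u(3) \<zeta>(1) u(1)] by simp
    have "\<rho> (\<zeta> * u) = e * ((u - 1) / \<delta>)"
      by (simp add: \<rho>_def power_mult_distrib \<zeta>(2) u4 right_diff_distrib)
    then have \<rho>u: "\<rho> (\<zeta> * u) \<simeq> s" using u(5) by simp
    have "d = \<beta>" if d: "d \<in> B" "d \<simeq> \<zeta>" "\<rho> d \<simeq> s" for d
    proof -
      have "\<rho> d \<simeq> \<rho> (\<zeta> * u)" using d(3) \<rho>u req_sym req_trans by blast
      then have "(d ^ 4 - (\<zeta> * u) ^ 4) / \<delta> \<in> M" by (simp only: \<rho>_req_iff)
      moreover have "d \<simeq> \<zeta> * u" using d(2) \<zeta>u req_sym req_trans by blast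
      ultimately have "(d - \<zeta> * u) / \<delta> \<in> M"
        using fourth_power_near_iff[OF B_V[OF d(1)] uV uM] by blast
      then have "d \<in> {\<beta>}" unfolding \<beta>(1)[symmetric] using d(1) by simp
      then show ?thesis by simp
    qed
    moreover have "\<rho> \<beta> \<simeq> s" using \<beta>(4) \<rho>u \<rho>_req_iff req_trans by blast
    moreover have "\<beta> \<simeq> \<zeta>" using \<beta>(3) \<zeta>u by (rule req_trans)
    ultimately show ?thesis using \<beta>(1,2) by blast
  qed
  have "e * ((\<omega> - 1) / \<delta>) \<simeq> - e"
  proof -
    have "e * (\<omega> * \<omega>) \<simeq> e * 1" by (intro req_mult \<omega>_req_1 req_refl eV closed \<omega>_closed)
    then have "0 - e * (\<omega> * \<omega>) \<simeq> 0 - e * 1" by (intro req_diff req_refl)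
    then show ?thesis by (simp add: \<omega>_diff)
  qed
  then obtain \<beta> where \<beta>: "\<beta> \<in> B" "\<beta> \<simeq> \<zeta>" "\<rho> \<beta> \<simeq> - e" "\<And>d. d \<in> B \<Longrightarrow> d \<simeq> \<zeta> \<Longrightarrow> \<rho> d \<simeq> - e \<Longrightarrow> d = \<beta>"
    using near[OF \<omega>_closed \<omega>_notin_M \<omega>_req_1(1) \<omega>_eq(3)] by blast
  have "e * \<omega> \<simeq> e * 1" by (intro req_mult \<omega>_req_1 req_refl eV \<omega>_closed)
  then have "e * ((\<omega> * \<omega> - 1) / \<delta>) \<simeq> e" by (simp add: \<omega>_diff)
  moreover have "(\<omega> * \<omega>) ^ 3 = 1" by (simp add: power_mult_distrib \<omega>_eq(3))
  ultimately obtain \<gamma> where \<gamma>: "\<gamma> \<in> B" "\<gamma> \<simeq> \<zeta>" "\<rho> \<gamma> \<simeq> e" "\<And>d. d \<in> B \<Longrightarrow> d \<simeq> \<zeta> \<Longrightarrow> \<rho> d \<simeq> e \<Longrightarrow> d = \<gamma>"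
    using near[OF mult_closed[OF \<omega>_closed \<omega>_closed] not_M_mult[OF \<omega>_notin_M \<omega>_notin_M] \<omega>_req_1(2)] by blast
  have w\<beta>: "w \<beta> \<simeq> - 1" using w_req[OF \<beta>(1,3)] by (simp add: e_square)
  have w\<gamma>: "w \<gamma> \<simeq> - 1" using w_req[OF \<gamma>(1,3)] by (simp add: e_square)
  have "th \<beta> ^ 3 ^ k \<simeq> th \<beta>"
  proof (rule frobenius_fixed_3[OF k \<zeta>(1,3) \<beta>(1,2) w\<beta> \<gamma>(1,2) w\<gamma>])
    fix d assume d: "d \<in> B" "d \<simeq> \<zeta>" "w d \<simeq> - 1"
    have "(\<rho> d + e) * (\<rho> d - e) = - (w d - (- 1))"
      unfolding w_eq_\<rho> using e_square(2) by (simp add: algebra_simps power2_eq_square)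
    also have "\<dots> \<in> M" using d(3) M_uminus unfolding req_def by blast
    finally have "\<rho> d + e \<in> M \<or> \<rho> d - e \<in> M" using M_cancel by blast
    then have "\<rho> d \<simeq> - e \<or> \<rho> d \<simeq> e" by (simp add: req_def)
    then show "d = \<beta> \<or> d = \<gamma>" using \<beta>(4) \<gamma>(4) d by blast
  qed auto
  then show thesis using that[OF \<beta>(1,2) w\<beta>] by blast
qed

text \<open>Each \<open>\<zeta>\<close> yields one class where \<open>w\<close> has residue 0 and
  one where it is -1. The polynomial \<open>f\<close> is left open because residues known to avoid
  the prime field admit one of smaller degree than \<open>X^(3^k) - X\<close>.\<close>

lemma card_fixed_le:
  assumes k: "k > 0" and Z: "finite Z" "\<And>\<zeta>. \<zeta> \<in> Z \<Longrightarrow> \<zeta> ^ 4 = e \<and> \<zeta> ^ 3 ^ k \<simeq> \<zeta>"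
    and f: "lead_coeff f = 1" "\<And>i. coeff f i \<in> V"
      "\<And>\<beta> \<zeta>. \<beta> \<in> B \<Longrightarrow> \<zeta> \<in> Z \<Longrightarrow> \<beta> \<simeq> \<zeta> \<Longrightarrow> th \<beta> ^ 3 ^ k \<simeq> th \<beta> \<Longrightarrow> poly f (th \<beta>) \<in> M"
  shows "2 * card Z \<le> degree f"
proof -
  have ZV: "\<zeta> \<in> V" "\<zeta> \<notin> M" if "\<zeta> \<in> Z" for \<zeta>
  proof -
    show "\<zeta> \<in> V" using Z(2)[OF that] of_int_closed V_power_D[of \<zeta> 4] by simp
    show "\<zeta> \<notin> M" using Z(2)[OF that] e_notin_M M_power[of \<zeta> 4] by auto
  qed
  define J where "J = Z \<times> {0, - 1 :: complex}"
  have "\<exists>\<beta>. \<beta> \<in> B \<and> \<beta> \<simeq> fst j \<and> w \<beta> \<simeq> snd j \<and> th \<beta> ^ 3 ^ k \<simeq> th \<beta>" if j: "j \<in> J" for j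
  proof -
    have z: "fst j \<in> Z" "snd j = 0 \<or> snd j = - 1" using j by (auto simp: J_def)
    show ?thesis
      using z(2) unramified_residue_3[OF k ZV(1)[OF z(1)]] ramified_residue_3[OF k ZV(1)[OF z(1)]] Z(2)[OF z(1)]
      by metis
  qed
  then obtain \<beta> where \<beta>: "\<And>j. j \<in> J \<Longrightarrow> \<beta> j \<in> B \<and> \<beta> j \<simeq> fst j \<and> w (\<beta> j) \<simeq> snd j \<and> th (\<beta> j) ^ 3 ^ k \<simeq> th (\<beta> j)"
    by metis
  have "card J \<le> degree f"
  proof (rule card_separated_le_degree[of J \<beta>])
    show "finite J" using Z by (simp add: J_def)
    fix x y assume xy: "x \<in> J" "y \<in> J" "x \<noteq> y"
    show "\<exists>r\<in>R. \<not> r (\<beta> x) \<simeq> r (\<beta> y)"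
    proof (rule ccontr)
      assume "\<not> (\<exists>r\<in>R. \<not> r (\<beta> x) \<simeq> r (\<beta> y))"
      then have "\<beta> x \<simeq> \<beta> y" "w (\<beta> x) \<simeq> w (\<beta> y)" using id_R w_R by auto
      then have eq: "fst x \<simeq> fst y" "snd x \<simeq> snd y"
        using \<beta>[OF xy(1)] \<beta>[OF xy(2)] by (meson req_sym req_trans)+
      have z: "fst x \<in> Z" "fst y \<in> Z" using xy by (auto simp: J_def)
      have "fst x = fst y"
        using eq_of_power_eq[OF _ eq(1) ZV[OF z(1)], of 4] Z(2)[OF z(1)] Z(2)[OF z(2)] by simp
      moreover have "snd x = snd y"
        using eq(2) xy M_uminus[of "- 1"] one_notin_M by (auto simp: J_def req_def)
      ultimately show False using xy(3) by (simp add: prod_eq_iff)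
    qed
  next
    show "poly f (th (\<beta> j)) \<in> M" if "j \<in> J" for j
      using f(3)[of "\<beta> j" "fst j"] \<beta>[OF that] that by (auto simp: J_def)
  qed (use \<beta> f in auto)
  moreover have "card J = card Z * 2" by (simp add: J_def card_cartesian_product)
  ultimately show ?thesis by simp
qed

lemma contradiction_mod_9: False
  using \<epsilon>
proof
  assume 1: "\<epsilon> = 1"
  \<comment> \<open>Of the fourth roots of 1 only these two reduce to the prime field; the
    polynomial is \<open>X^3 - X\<close>, and 4 exceeds 3.\<close>
  have "2 * card {1, - 1 :: complex} \<le> degree [:0, - 1, 0, 1 :: complex:]"
  proof (rule card_fixed_le[of 1])
    fix \<beta> \<zeta> assume "th \<beta> ^ 3 ^ 1 \<simeq> th \<beta>"
    then show "poly [:0, - 1, 0, 1:] (th \<beta>) \<in> M"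
      by (simp add: req_def algebra_simps power3_eq_cube)
  qed (use 1 closed in \<open>auto simp: coeff_pCons split: nat.splits\<close>)
  then show False by simp
next
  assume m1: "\<epsilon> = - 1"
  define Z where "Z = {\<zeta> :: complex. \<zeta> ^ 4 = - 1}"
  have "card Z = 4" unfolding Z_def by (intro card_nth_roots) auto
  then have Z: "card Z = 4" "finite Z" using card.infinite by fastforce+
  \<comment> \<open>This is \<open>(X^9 - X) / (X^3 - X)\<close>, whose roots are the 6 elements of
    the field of 9 elements outside the prime field.\<close>
  have "2 * card Z \<le> degree [:1, 0, 1, 0, 1, 0, 1 :: complex:]"
  proof (rule card_fixed_le[of 2])
    fix \<zeta> assume \<zeta>: "\<zeta> \<in> Z"
    have "\<zeta> ^ 9 = (\<zeta> ^ 4) ^ 2 * \<zeta>" by (simp flip: power_mult power_Suc2)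
    also have "\<zeta> ^ 4 = - 1" using \<zeta> by (simp add: Z_def)
    finally have "\<zeta> ^ 9 = \<zeta>" by simp
    then show "\<zeta> ^ 4 = e \<and> \<zeta> ^ 3 ^ 2 \<simeq> \<zeta>" using \<zeta> m1 by (simp add: Z_def)
  next
    fix \<beta> \<zeta> assume *: "\<beta> \<in> B" "\<zeta> \<in> Z" "\<beta> \<simeq> \<zeta>" "th \<beta> ^ 3 ^ 2 \<simeq> th \<beta>"
    let ?x = "th \<beta>"
    \<comment> \<open>If \<open>th \<beta>\<close> reduced to the prime field, so would
      \<open>\<beta>\<close>; then \<open>\<beta>^4\<close> would be congruent to 1, whereas
      \<open>\<zeta>^4 = -1\<close>.\<close>
    have "\<not> ?x ^ 3 ^ 1 \<simeq> ?x"
    proof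
      assume "?x ^ 3 ^ 1 \<simeq> ?x"
      from frobenius_conjugate[OF *(1,1) id_R this] have "\<beta> * (\<beta> ^ 2 - 1) \<in> M"
        by (simp add: req_def algebra_simps eval_nat_numeral)
      then have "\<beta> ^ 2 - 1 \<in> M" using B_not_M[OF *(1)] by (rule M_cancel)
      then have "(\<beta> ^ 2 - 1) * (\<beta> ^ 2 + 1) \<in> M" using B_V[OF *(1)] by (intro M_mult(1) closed)
      then have 1: "\<beta> ^ 4 \<simeq> 1" by (simp add: req_def algebra_simps eval_nat_numeral)
      have "\<beta> ^ 4 \<simeq> \<zeta> ^ 4" using *(3) B_V[OF *(1)] by (rule req_power)
      then have "\<beta> ^ 4 \<simeq> - 1" using *(2) by (simp add: Z_def)
      from req_trans[OF req_sym[OF this] 1] have "- 1 \<simeq> 1" .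
      then have "2 \<in> M" using M_uminus[of "- 2"] by (simp add: req_def)
      then show False by (simp add: numeral_in_M_iff)
    qed
    then have "?x ^ 3 - ?x \<notin> M" by (simp add: req_def)
    moreover have "(?x ^ 3 - ?x) * poly [:1, 0, 1, 0, 1, 0, 1:] ?x = ?x ^ 9 - ?x"
      by (simp add: algebra_simps eval_nat_numeral)
    moreover have "?x ^ 9 - ?x \<in> M" using *(4) by (simp add: req_def)
    ultimately show "poly [:1, 0, 1, 0, 1, 0, 1:] ?x \<in> M" using M_cancel by metis
  qed (use Z closed in \<open>auto simp: coeff_pCons split: nat.splits\<close>)
  then show False using Z by simp
qed

end

section \<open>Divisibility of the index\<close>

lemma exists_residue_char:
  assumes "prime p"
  obtains V :: "complex set" where "residue_char V p"
proof -
  have Z: "subring (\<int> :: complex set)" by unfold_locales auto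
  have "inverse (of_nat p) \<notin> (\<int> :: complex set)"
  proof
    assume "inverse (of_nat p) \<in> (\<int> :: complex set)"
    then obtain n where n: "inverse (of_nat p) = (of_int n :: complex)" by (elim Ints_cases)
    have "of_int (int p * n) = (1 :: complex)"
      using prime_gt_0_nat[OF assms] by (simp flip: n)
    then have "int p * n = 1" by (metis of_int_eq_1_iff)
    then show False using assms by (simp add: zmult_eq_1_iff)
  qed
  then obtain V :: "complex set" where V: "valuation_ring V" "inverse (of_nat p) \<notin> V"
    using exists_valuation_ring[OF Z, of "of_nat p"] by auto
  interpret valuation_ring V by fact
  have "of_nat p \<in> M" using V(2) by (simp add: M_def)
  then have "residue_char V p" using assms by unfold_locales
  then show thesis by (rule that)
qed

lemma ev_monom [simp]: "ev (monom c n) x = of_rat c * x ^ n"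
  by (induction n) (simp_all add: monom_0 monom_Suc algebra_simps)

section \<open>The field generated by a root of the trinomial\<close>

locale trinomial_field =
  fixes m :: nat and a b :: int and F :: "rat poly" and \<alpha> :: "'a::field_char_0" and K :: "'a set"
  assumes m: "m < 12"
    and F: "F = monom 1 12 + monom (of_int a) m + [:of_int b:]"
    and irr: "irreducible F"
    and root: "ev F \<alpha> = 0"
    and K: "K = rat_adjoin \<alpha>"
begin

definition B :: "complex set" where "B = {z. ev F z = 0}"

definition R :: "(complex \<Rightarrow> complex) set" where "R = {\<lambda>z. ev f z | f. algebraic_int (ev f \<alpha>)}"

lemma \<alpha>_root: "\<alpha> ^ 12 = - of_int b - of_int a * \<alpha> ^ m"
proof -
  have "\<alpha> ^ 12 + of_int a * \<alpha> ^ m + of_int b = 0" using root by (simp add: F)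
  then show ?thesis by (simp add: algebra_simps eq_neg_iff_add_eq_0)
qed

lemma monic: "lead_coeff F = 1"
proof -
  have "coeff F i = 0" if "i > 12" for i
    using that m by (simp add: F coeff_pCons split: nat.splits)
  then have "degree F \<le> 12" by (intro degree_le) auto
  moreover have "coeff F 12 = 1"
    using m by (simp add: F coeff_pCons split: nat.splits)
  ultimately show ?thesis by (metis antisym le_degree zero_neq_one)
qed

lemma algebraic_int_\<alpha>: "algebraic_int \<alpha>"
proof (rule algebraic_int.intros)
  let ?P = "map_poly of_rat F :: 'a poly"
  have deg: "degree ?P = degree F" by (intro degree_map_poly) auto
  then show "lead_coeff ?P = 1" using monic by (simp add: coeff_map_poly)
  show "\<forall>i. coeff ?P i \<in> \<int>"
    by (auto simp: coeff_map_poly F coeff_pCons of_rat_add split: nat.splits)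
  show "poly ?P \<alpha> = 0" using root by (simp add: ev_def)
qed

sublocale AI: subring "{x :: 'a. algebraic_int x}"
  by (rule subring_algebraic_int)

lemma algebraic_int_arith:
  "algebraic_int (x :: 'a) \<Longrightarrow> algebraic_int y \<Longrightarrow> algebraic_int (x + y)"
  "algebraic_int (x :: 'a) \<Longrightarrow> algebraic_int y \<Longrightarrow> algebraic_int (x - y)"
  "algebraic_int (x :: 'a) \<Longrightarrow> algebraic_int y \<Longrightarrow> algebraic_int (x * y)"
  "algebraic_int (x :: 'a) \<Longrightarrow> algebraic_int (x ^ n)"
  using AI.add_closed AI.diff_closed AI.mult_closed AI.power_closed by auto

lemma R_I:
  assumes "algebraic_int (ev f \<alpha>)" "\<And>z. r z = ev f z"
  shows "r \<in> R"
proof -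
  have "r = (\<lambda>z. ev f z)" using assms(2) by auto
  then show ?thesis using assms(1) by (auto simp: R_def)
qed

lemma roots: "finite B" "(\<Prod>z\<in>B. [:- z, 1:]) = monom 1 12 + monom (of_int a) m + [:of_int b:]"
proof -
  show "finite B" unfolding B_def by (rule map_poly_of_rat_roots(1)[OF irr monic])
  have "(\<Prod>z\<in>B. [:- z, 1:]) = map_poly of_rat F"
    unfolding B_def by (rule map_poly_of_rat_roots(2)[OF irr monic, symmetric])
  also have "\<dots> = monom 1 12 + monom (of_int a) m + [:of_int b:]"
    by (rule poly_eqI) (simp add: F coeff_map_poly of_rat_add coeff_pCons split: nat.splits)
  finally show "(\<Prod>z\<in>B. [:- z, 1:]) = monom 1 12 + monom (of_int a) m + [:of_int b:]" .
qed

lemma id_R: "(\<lambda>z. z) \<in> R"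
  by (rule R_I[of "[:0, 1:]"]) (use algebraic_int_\<alpha> in auto)

lemma trinomial_conjugates_exists:
  assumes \<theta>: "\<theta> \<in> ring_of_integers K" "rat_adjoin \<theta> = K" and p: "prime p"
    and index: "\<not> p dvd add_index (ring_of_integers K) (int_adjoin \<theta>)"
    and ab: "int p dvd a" "\<not> int p dvd b"
  obtains V th G where "trinomial_conjugates V p B th G R m a b"
proof -
  obtain V :: "complex set" where V: "residue_char V p" using exists_residue_char[OF p] .
  obtain th G where "conjugate_system V p B th G R"
    using conjugate_system_exists[OF irr root K \<theta> V index roots(1) B_def]
    unfolding R_def by blast
  then have "trinomial_conjugates V p B th G R m a b"
    using roots(2) id_R ab by (simp add: trinomial_conjugates_def trinomial_conjugates_axioms_def)
  then show thesis by (rule that)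
qed

lemma two_dvd_index:
  assumes \<theta>: "\<theta> \<in> ring_of_integers K" "rat_adjoin \<theta> = K"
    and a: "[a = 0] (mod 8)" and b: "[b = 3] (mod 8) \<or> [b = 7] (mod 8)"
  shows "2 dvd add_index (ring_of_integers K) (int_adjoin \<theta>)"
proof (rule ccontr)
  assume index: "\<not> 2 dvd add_index (ring_of_integers K) (int_adjoin \<theta>)"
  have a8: "8 dvd a" using a by (simp add: cong_0_iff)
  obtain l where l: "a = 8 * l" using a8 by (elim dvdE)
  have b4: "4 dvd b + 1" using b by (auto simp: Cong.cong_def) presburger+
  then obtain k where k: "b + 1 = 4 * k" by (elim dvdE)
  have kc: "(of_int b :: 'a) = 4 * of_int k - 1"
    using arg_cong[OF k, of "of_int :: int \<Rightarrow> 'a"] by (simp add: algebra_simps)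
  have "int 2 dvd a" "\<not> int 2 dvd b" using a8 b4 by presburger+
  then obtain V th G where T: "trinomial_conjugates V 2 B th G R m a b"
    using trinomial_conjugates_exists[OF \<theta> _ index] by auto
  define t where "t = (\<alpha> ^ 6 + 1) / 2"
  have t2: "t ^ 2 = t + (\<alpha> ^ 12 - 1) / 4"
    by (simp add: t_def power2_eq_square field_simps flip: power_add)
  have "t ^ 2 = 1 * t + (- of_int k - of_int (2 * l) * \<alpha> ^ m)"
    unfolding t2 \<alpha>_root by (simp add: kc l field_simps)
  then have t: "algebraic_int t"
    by (rule algebraic_int_quadratic) (auto intro!: algebraic_int_arith algebraic_int_\<alpha>)
  have t_R: "(\<lambda>z. (z ^ 6 + 1) / 2) \<in> R"
    by (rule R_I[of "smult (1 / 2) (monom 1 6 + 1)"]) (use t in \<open>auto simp: t_def of_rat_divide\<close>)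
  have cube_R: "(\<lambda>z. z ^ 3 - 1) \<in> R"
    by (rule R_I[of "monom 1 3 - 1"]) (auto intro!: algebraic_int_arith algebraic_int_\<alpha>)
  interpret trinomial_2 B th G R m a b V
    using T a8 t_R cube_R by (simp add: trinomial_2_def trinomial_2_axioms_def)
  show False
  proof (cases "[b = 3] (mod 8)")
    case True
    then show False by (rule contradiction_3_mod_8)
  next
    case False
    then have b7: "[b = 7] (mod 8)" using b by simp
    then have "8 dvd b + 1" by (auto simp: Cong.cong_def) presburger
    then obtain k' where k': "b + 1 = 8 * k'" by (elim dvdE)
    have kc': "(of_int b :: 'a) = 8 * of_int k' - 1"
      using arg_cong[OF k', of "of_int :: int \<Rightarrow> 'a"] by (simp add: algebra_simps)
    \<comment> \<open>The factor \<open>t\<close> supplies the \<open>\<alpha>^6 + 1\<close> that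
      completes \<open>\<alpha>^6 - 1\<close> to \<open>\<alpha>^12 - 1\<close>, which is divisible
      by 8 because \<open>b\<close> is -1 modulo 8.\<close>
    define u where "u = t * ((\<alpha> ^ 3 + 1) / 2)"
    have "u ^ 2 - t * u = t * (t * ((\<alpha> ^ 6 - 1) / 2) / 2)"
      by (simp add: u_def power2_eq_square field_simps flip: power_add)
    also have "t * ((\<alpha> ^ 6 - 1) / 2) = (\<alpha> ^ 12 - 1) / 4"
      by (simp add: t_def field_simps flip: power_add)
    also have "t * ((\<alpha> ^ 12 - 1) / 4 / 2) = (- of_int k' - of_int l * \<alpha> ^ m) * t"
      unfolding \<alpha>_root by (simp add: kc' l field_simps)
    finally have "u ^ 2 = t * u + (- of_int k' - of_int l * \<alpha> ^ m) * t"
      by (simp add: algebra_simps)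
    then have "algebraic_int u"
      by (rule algebraic_int_quadratic) (auto intro!: algebraic_int_arith algebraic_int_\<alpha> t)
    then have "(\<lambda>z. (z ^ 6 + 1) / 2 * ((z ^ 3 + 1) / 2)) \<in> R"
      by (intro R_I[of "smult (1 / 2) (monom 1 6 + 1) * smult (1 / 2) (monom 1 3 + 1)"])
        (auto simp: u_def t_def of_rat_divide)
    with b7 show False by (rule contradiction_7_mod_8)
  qed
qed

lemma three_dvd_index:
  assumes \<theta>: "\<theta> \<in> ring_of_integers K" "rat_adjoin \<theta> = K"
    and a: "[a = 0] (mod 9)" and b: "[b = 1] (mod 9) \<or> [b = - 1] (mod 9)"
  shows "3 dvd add_index (ring_of_integers K) (int_adjoin \<theta>)"
proof (rule ccontr)
  assume index: "\<not> 3 dvd add_index (ring_of_integers K) (int_adjoin \<theta>)"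
  define \<epsilon> :: int where "\<epsilon> = (if [b = 1] (mod 9) then - 1 else 1)"
  have a9: "9 dvd a" using a by (simp add: cong_0_iff)
  have b9: "9 dvd b + \<epsilon>" using b by (auto simp: \<epsilon>_def cong_iff_dvd_diff split: if_splits)
  have \<epsilon>: "\<epsilon> = 1 \<or> \<epsilon> = - 1" by (simp add: \<epsilon>_def)
  obtain l where l: "a = 9 * l" using a9 by (elim dvdE)
  obtain k where k: "b + \<epsilon> = 9 * k" using b9 by (elim dvdE)
  have kc: "(of_int b :: 'a) = 9 * of_int k - of_int \<epsilon>"
    using arg_cong[OF k, of "of_int :: int \<Rightarrow> 'a"] by (simp add: algebra_simps)
  have "int 3 dvd a" "\<not> int 3 dvd b" using a9 b9 \<epsilon> by presburger+
  then obtain V th G where T: "trinomial_conjugates V 3 B th G R m a b"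
    using trinomial_conjugates_exists[OF \<theta> _ index] by auto
  define e :: 'a where "e = of_int \<epsilon>"
  have e: "e * e = 1" using \<epsilon> by (auto simp: e_def)
  define x where "x = \<alpha> ^ 4 - e"
  define \<kappa> where "\<kappa> = - of_int k - of_int l * \<alpha> ^ m"
  have x_int: "algebraic_int x" and \<kappa>_int: "algebraic_int \<kappa>"
    unfolding x_def e_def \<kappa>_def by (auto intro!: algebraic_int_arith algebraic_int_\<alpha>)
  \<comment> \<open>Expanding gives \<open>x^3 + 3 e x^2 + 3 x = 9 \<kappa>\<close>; multiplied by
    \<open>x\<close> and divided by 9, this becomes a quadratic equation for
    \<open>w = x^2/3\<close>.\<close>
  have "\<alpha> ^ 12 = (x + e) ^ 3" by (simp add: x_def flip: power_mult)
  then have "(x + e) ^ 3 = e + 9 * \<kappa>"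
    unfolding \<alpha>_root by (simp add: kc l \<kappa>_def e_def algebra_simps)
  moreover have "(x + e) ^ 3 = x ^ 3 + 3 * e * x ^ 2 + 3 * (e * e) * x + (e * e) * e"
    by (simp add: eval_nat_numeral algebra_simps)
  ultimately have x3: "x ^ 3 = 9 * \<kappa> - 3 * e * x ^ 2 - 3 * x"
    unfolding e by (simp add: algebra_simps)
  define w where "w = x ^ 2 / 3"
  have "w ^ 2 = x ^ 3 * x / 9"
    by (simp add: w_def eval_nat_numeral)
  also have "\<dots> = (9 * \<kappa> - 3 * e * x ^ 2 - 3 * x) * x / 9"
    by (simp only: x3)
  also have "\<dots> = \<kappa> * x - e * x ^ 3 / 3 - x ^ 2 / 3"
    by (simp add: field_simps eval_nat_numeral)
  also have "\<dots> = (- 1) * w + (\<kappa> * x - 3 * e * \<kappa> + (e * e) * x ^ 2 + e * x)"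
    unfolding x3 w_def by (simp add: field_simps)
  finally have "algebraic_int w"
    by (rule algebraic_int_quadratic) (auto intro!: algebraic_int_arith x_int \<kappa>_int simp: e e_def)
  then have w_R: "(\<lambda>z. (z ^ 4 - of_int \<epsilon>) ^ 2 / 3) \<in> R"
    by (intro R_I[of "smult (1 / 3) ((monom 1 4 - [:of_int \<epsilon>:]) ^ 2)"])
      (auto simp: w_def x_def e_def of_rat_divide)
  have fourth_R: "(\<lambda>z. z ^ 4 - of_int \<epsilon>) \<in> R"
    by (rule R_I[of "monom 1 4 - [:of_int \<epsilon>:]"]) (use x_int in \<open>auto simp: x_def e_def\<close>)
  interpret trinomial_3 B th G R m a b V \<epsilon>
    using T \<epsilon> a9 b9 w_R fourth_R by (simp add: trinomial_3_def trinomial_3_axioms_def)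
  show False by (rule contradiction_mod_9)
qed

lemma dvd_field_index:
  assumes "\<And>\<theta>. \<theta> \<in> ring_of_integers K \<Longrightarrow> rat_adjoin \<theta> = K \<Longrightarrow>
    p dvd add_index (ring_of_integers K) (int_adjoin \<theta>)"
  shows "p dvd field_index K"
  unfolding field_index_def using assms by (intro Gcd_greatest) auto

text \<open>A generator \<open>\<theta>\<close> of the ring also generates the field, since
  \<open>\<alpha>\<close> is integral and hence a polynomial in \<open>\<theta>\<close>. Its index
  is 1, the whole ring being a single coset.\<close>

lemma not_monogenic:
  assumes "\<And>\<theta>. \<theta> \<in> ring_of_integers K \<Longrightarrow> rat_adjoin \<theta> = K \<Longrightarrow>
    p dvd add_index (ring_of_integers K) (int_adjoin \<theta>)" and p: "p > 1"
  shows "\<not> monogenic K"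
proof
  assume "monogenic K"
  then obtain \<theta> where \<theta>: "\<theta> \<in> ring_of_integers K" "ring_of_integers K = int_adjoin \<theta>"
    by (auto simp: monogenic_def)
  have K_eq: "K = range (\<lambda>f. ev f \<alpha>)" using rat_adjoin_eq[OF irr root] K by simp
  have sub: "is_subfield K" using is_subfield_range_ev[OF irr root] K_eq by simp
  have "\<alpha> \<in> K" unfolding K_eq by (rule image_eqI[of _ _ "[:0, 1:]"]) auto
  then have "\<alpha> \<in> int_adjoin \<theta>" using algebraic_int_\<alpha> \<theta>(2) by (auto simp: ring_of_integers_def)
  then obtain f where f: "\<alpha> = poly (map_poly of_int f) \<theta>" by (auto simp: int_adjoin_def)
  have "rat_adjoin \<theta> = K"
  proof
    show "rat_adjoin \<theta> \<subseteq> K"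
      using \<theta>(1) sub by (auto simp: rat_adjoin_def ring_of_integers_def)
    have "\<alpha> \<in> S" if "is_subfield S" "\<theta> \<in> S" for S
      unfolding f ev_map_poly_of_int[symmetric] by (rule is_subfield_ev_closed[OF that])
    then show "K \<subseteq> rat_adjoin \<theta>" unfolding K by (auto simp: rat_adjoin_def)
  qed
  then have "p dvd add_index (ring_of_integers K) (int_adjoin \<theta>)" using assms \<theta>(1) by blast
  moreover have "add_index (ring_of_integers K) (int_adjoin \<theta>) = 1"
  proof -
    let ?O = "ring_of_integers K"
    have K_diff: "x - y \<in> K" if "x \<in> K" "y \<in> K" for x y
      using sub that unfolding is_subfield_def by (metis add_uminus_conv_diff)
    have O: "x + y \<in> ?O" "x - y \<in> ?O" if "x \<in> ?O" "y \<in> ?O" for x y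
      using that sub K_diff algebraic_int_arith(1,2)
      by (auto simp: ring_of_integers_def is_subfield_def)
    have "(\<lambda>h. x + h) ` ?O = ?O" if "x \<in> ?O" for x
    proof (intro equalityI subsetI)
      fix y assume "y \<in> ?O"
      then show "y \<in> (\<lambda>h. x + h) ` ?O" using O(2)[OF _ that, of y]
        by (intro image_eqI[of _ _ "y - x"]) auto
    qed (use O that in auto)
    then have "(\<lambda>x. (\<lambda>h. x + h) ` ?O) ` ?O = {?O}" using \<theta>(1) by auto
    then show ?thesis by (simp add: add_index_def flip: \<theta>(2))
  qed
  ultimately show False using p by simp
qed

end

theorem theorem2p1:
  fixes m :: nat and a b :: int and F :: "rat poly"
    and \<alpha> :: "'a::field_char_0" and K :: "'a set"
  assumes m: "m \<in> {1..11}"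
    and F: "F = monom 1 12 + monom (of_int a) m + [:of_int b:]"
    and irr: "irreducible F"
    and val: "\<And>p::nat. prime p \<Longrightarrow>
           padic_val p a < enat (12 - m) \<or> padic_val p b < enat 12"
    and root: "poly (map_poly of_rat F) \<alpha> = 0"
    and K: "K = rat_adjoin \<alpha>"
  shows "(([a = 0] (mod 8) \<and> [b = 3] (mod 8)) \<or> ([a = 0] (mod 8) \<and> [b = 7] (mod 8))
            \<longrightarrow> 2 dvd field_index K) \<and>
         (([a = 0] (mod 9) \<and> [b = 1] (mod 9)) \<or> ([a = 0] (mod 9) \<and> [b = -1] (mod 9))
            \<longrightarrow> 3 dvd field_index K) \<and>
         (([a = 0] (mod 8) \<and> [b = 3] (mod 8)) \<or> ([a = 0] (mod 8) \<and> [b = 7] (mod 8)) \<or>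
          ([a = 0] (mod 9) \<and> [b = 1] (mod 9)) \<or> ([a = 0] (mod 9) \<and> [b = -1] (mod 9))
            \<longrightarrow> \<not> monogenic K)"
proof -
  interpret trinomial_field m a b F \<alpha> K
    using m F irr root K by unfold_locales (auto simp: ev_def)
  have 2: "2 dvd field_index K" "\<not> monogenic K"
    if "[a = 0] (mod 8)" "[b = 3] (mod 8) \<or> [b = 7] (mod 8)"
    using dvd_field_index[of 2] not_monogenic[of 2] two_dvd_index[OF _ _ that] by auto
  have 3: "3 dvd field_index K" "\<not> monogenic K"
    if "[a = 0] (mod 9)" "[b = 1] (mod 9) \<or> [b = - 1] (mod 9)"
    using dvd_field_index[of 3] not_monogenic[of 3] three_dvd_index[OF _ _ that] by auto
  show ?thesis using 2 3 by blast
qed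

end
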